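(* For every knot $K$ in $S^3$, the lift $J_K(t,q)\in\mathcal{H}_{R_K}$, $R_K=\mathbb{Z}[t^{\pm1},\Delta_K(t)^{-1}]$, of the colored Jones polynomial is $q$-holonomic, and in fact it satisfies the same $q$-difference equations as the sequence $(J_{K,n}(q))_{n\ge1}$. That is: there is a nonzero operator $P=\sum_{j=0}^{d}a_j(t,q)\sigma^j$ with $a_j\in\mathbb{Z}[t^{\pm1},q^{\pm1}]$ such that $PJ_K=0$; and for any such operator $P$, one has $PJ_K=0$ if and only if $\sum_{j=0}^{d}a_j(q^{n-1},q)J_{K,n+j}(q)=0$ for all $n\ge1$.
   Context: Colored Jones polynomial: $J_{K,n}(q)\in\mathbb{Z}[q^{\pm1}]$, $n\ge1$, is the (framing-independent) quantum invariant of $K$ colored by the $n$-dimensional irreducible representation of $\mathfrak{sl}_2$, normalized to be $1$ on the unknot. $\Delta_K(t)\in\mathbb{Z}[t^{\pm1}]$ is the Alexander polynomial normalized by $\Delta_K(t)=\Delta_K(t^{-1})$, $\Delta_K(1)=1$. Roots of unity: fix primitive $m$-th roots of unity $\zeta_m$ ($m\ge1$) with $\zeta_{mm'}=\zeta_m\zeta_{m'}$ if $\gcd(m,m')=1$ and $(\zeta_{p^r})^p=\zeta_{p^{r-1}}$ for primes $p$, $r\ge1$. Then $\zeta_{pm}-\zeta_m$ is topologically nilpotent in $\mathbb{Z}_p[\zeta_{pm}]$, so power series in $q-\zeta_m=(q-\zeta_{pm})+(\zeta_{pm}-\zeta_m)$ can be re-expanded in $q-\zeta_{pm}$ after $p$-adic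 completion. Habiro ring: for $R=\mathbb{Z}[t^{\pm1},\Delta(t)^{-1}]$ and $p$ prime let $R_p=\varprojlim_n R/p^nR$ and let $\varphi_p:R_p\to R_p$ be the Frobenius lift with $\varphi_p(t)=t^p$; extend it by $t^{1/(pm)}\mapsto t^{1/m}$, $\varphi_p(q)=q$, $\varphi_p(\zeta)=\zeta$ for roots of unity $\zeta$. Then $\mathcal{H}_R$ is the ring of all collections $(f_m)_{m\ge1}\in\prod_{m\ge1}R[\zeta_m,t^{1/m}][\![q-\zeta_m]\!]$ such that for all $m\ge1$ and all primes $p$, $f_m$ re-expanded at $q=\zeta_{pm}$ equals $\varphi_p f_{pm}$ in $R_p[\zeta_{pm},t^{1/m}][\![q-\zeta_{pm}]\!]$. $\mathcal{H}_{\mathbb{Z}}$ is defined in the same way with $R$ replaced by $\mathbb{Z}$, no variable $t$ and $\varphi_p$ the identity; it contains $\mathbb{Z}[q^{\pm1}]$ by Taylor expansion at each $\zeta_m$. For $n\in\mathbb{Z}$ and $\Delta(1)=1$, $f(t,q)\mapsto f(q^n,q)$, $\mathcal{H}_R\to\mathcal{H}_{\mathbb{Z}}$, is given on the $m$-th component by $t^{1/m}\mapsto q^n$. The ring $\mathbb{Z}[t^{\pm1},q^{\pm1}]$ maps to $\mathcal{H}_R$ by $a(t,q)\mapsto(a(t^{1/m},q))_m$ (expanded at $q=\zeta_m$). $\sigma:\mathcal{H}_R\to\mathcal{H}_R$ is the ring automorphism $t\mapsto qt$, given on the $m$-th component by $t^{1/m}\mapsto q\,t^{1/m}$. The lift $J_K(t,q)\in\mathcal{H}_{R_K}$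 is the element provided by the paper's main theorem; it satisfies $J_K(q^{n-1},q)=J_{K,n}(q)$ for all $n>0$. *)

theory Defs
  imports
    "HOL-Analysis.Analysis"
    "HOL-Library.Poly_Mapping"
    "HOL-Computational_Algebra.Computational_Algebra"
    "HOL-Computational_Algebra.Field_as_Ring"
    "Jordan_Normal_Form.Determinant"
begin

section \<open>Laurent polynomials\<close>

text \<open>
  \<open>\<int>[t\<^sup>\<plusminus>\<^sup>1]\<close> and \<open>\<int>[t\<^sup>\<plusminus>\<^sup>1, q\<^sup>\<plusminus>\<^sup>1]\<close> as the integral group rings of \<open>\<int>\<close> and \<open>\<int>\<^sup>2\<close>; in the second one
  the key \<open>(i, l)\<close> is the monomial \<open>t\<^sup>i q\<^sup>l\<close>.
\<close>

type_synonym laurent = "int \<Rightarrow>\<^sub>0 int"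
type_synonym laurent2 = "int \<times> int \<Rightarrow>\<^sub>0 int"

text \<open>Values at units; the \<open>inverse\<close> hidden in \<open>powi\<close> is the inverse of the unit.\<close>

definition laurent_at :: "laurent \<Rightarrow> 'a::{comm_ring_1,inverse} \<Rightarrow> 'a" where
  "laurent_at a u = (\<Sum>i\<in>Poly_Mapping.keys a. of_int (Poly_Mapping.lookup a i) * u powi i)"

definition laurent2_at :: "laurent2 \<Rightarrow> 'a::{comm_ring_1,inverse} \<Rightarrow> 'a \<Rightarrow> 'a" where
  "laurent2_at a u v =
     (\<Sum>(i, l)\<in>Poly_Mapping.keys a. of_int (Poly_Mapping.lookup a (i, l)) * (u powi i * v powi l))"

text \<open>\<open>a(q\<^sup>s, q) \<in> \<int>[q\<^sup>\<plusminus>\<^sup>1]\<close> for \<open>a(t, q) \<in> \<int>[t\<^sup>\<plusminus>\<^sup>1, q\<^sup>\<plusminus>\<^sup>1]\<close>.\<close>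

definition laurent2_at_q_power :: "laurent2 \<Rightarrow> int \<Rightarrow> laurent" where
  "laurent2_at_q_power a s =
     (\<Sum>(i, l)\<in>Poly_Mapping.keys a. Poly_Mapping.single (s * i + l) (Poly_Mapping.lookup a (i, l)))"


section \<open>The field of rational functions\<close>

type_synonym ratfun = "complex poly fract"

definition const_fun :: "complex \<Rightarrow> ratfun" where
  "const_fun c = to_fract [:c:]"

definition indet :: ratfun where
  "indet = to_fract [:0, 1:]"


section \<open>Knots in the 3-sphere\<close>

type_synonym R3 = "real \<times> real \<times> real"

definition S3 :: "(R3 \<times> real) set" where
  "S3 = sphere 0 1"

text \<open>A knot is the image of a smooth embedding of the circle \<open>\<real>/\<int>\<close>; \<open>D k\<close> is the \<open>k\<close>-th derivative.\<close>

definition knot :: "(R3 \<times> real) set \<Rightarrow> bool" where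
  "knot K \<longleftrightarrow> K \<subseteq> S3 \<and>
     (\<exists>D :: nat \<Rightarrow> real \<Rightarrow> R3 \<times> real.
        (\<forall>k s. (D k has_vector_derivative D (Suc k) s) (at s)) \<and>
        (\<forall>s. D 0 (s + 1) = D 0 s) \<and> inj_on (D 0) {0..<1} \<and>
        (\<forall>s. D 1 s \<noteq> 0) \<and> range (D 0) = K)"

definition ambient_isotopic :: "(R3 \<times> real) set \<Rightarrow> (R3 \<times> real) set \<Rightarrow> bool" where
  "ambient_isotopic K L \<longleftrightarrow>
     (\<exists>H :: real \<times> (R3 \<times> real) \<Rightarrow> R3 \<times> real.
        continuous_on ({0..1} \<times> S3) H \<and>
        (\<forall>s\<in>{0..1}. \<exists>g. homeomorphism S3 S3 (\<lambda>x. H (s, x)) g) \<and>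
        (\<forall>x\<in>S3. H (0, x) = x) \<and> (\<lambda>x. H (1, x)) ` K = L)"

definition inverse_stereographic :: "R3 \<Rightarrow> R3 \<times> real" where
  "inverse_stereographic x =
     ((2 / ((norm x)\<^sup>2 + 1)) *\<^sub>R x, ((norm x)\<^sup>2 - 1) / ((norm x)\<^sup>2 + 1))"

text \<open>
  Braid words on the strands \<open>0, \<dots>, k - 1\<close>: the letter \<open>(p, True)\<close> is the Artin generator crossing the
  strands at positions \<open>p\<close> and \<open>p + 1\<close> positively, \<open>(p, False)\<close> is its inverse.
\<close>

type_synonym braid_word = "(nat \<times> bool) list"

definition braid_word :: "nat \<Rightarrow> braid_word \<Rightarrow> bool" where
  "braid_word k w \<longleftrightarrow> (\<forall>(p, e)\<in>set w. Suc p < k)"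

text \<open>
  The geometric braid closure. The coordinates are (position, height, distance to the reader): the
  letter \<open>w ! s\<close> sits between the heights \<open>s\<close> and \<open>s + 1\<close>, all strands are oriented upwards, and at a
  positive crossing the over-strand (lifted to 1 in the third coordinate) goes from the lower left to
  the upper right. Strand \<open>p\<close> is closed up by a rectangular arc on the right; the arcs are nested.
\<close>

fun polyline :: "R3 list \<Rightarrow> R3 set" where
  "polyline (x # y # xs) = closed_segment x y \<union> polyline (y # xs)"
| "polyline _ = {}"

definition crossing_segments :: "nat \<Rightarrow> real \<Rightarrow> nat \<times> bool \<Rightarrow> R3 set" where
  "crossing_segments k s g = (case g of (p, e) \<Rightarrow>
     (\<Union>x\<in>{..<k} - {p, Suc p}. polyline [(real x, s, 0), (real x, s + 1, 0)]) \<union>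
     polyline [(real p, s, 0), (real p + 1/2, s + 1/2, if e then 1 else 0), (real p + 1, s + 1, 0)] \<union>
     polyline [(real p + 1, s, 0), (real p + 1/2, s + 1/2, if e then 0 else 1), (real p, s + 1, 0)])"

definition closing_arc :: "nat \<Rightarrow> real \<Rightarrow> nat \<Rightarrow> R3 set" where
  "closing_arc k l p = (let x = real p; c = real k - real p in
     polyline [(x, l, 0), (x, l + c, 0), (x + 2 * c, l + c, 0),
               (x + 2 * c, - c, 0), (x, - c, 0), (x, 0, 0)])"

definition braid_closure :: "nat \<Rightarrow> braid_word \<Rightarrow> R3 set" where
  "braid_closure k w =
     (\<Union>s<length w. crossing_segments k (real s) (w ! s)) \<union>
     (\<Union>p<k. closing_arc k (real (length w)) p)"

definition is_closure_of :: "(R3 \<times> real) set \<Rightarrow> nat \<Rightarrow> braid_word \<Rightarrow> bool" where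
  "is_closure_of K k w \<longleftrightarrow> k \<ge> 1 \<and> braid_word k w \<and>
     ambient_isotopic K (inverse_stereographic ` braid_closure k w)"


section \<open>The Alexander polynomial\<close>

text \<open>
  For the closure of a braid, \<open>1 - B\<close> with \<open>B\<close> the unreduced Burau matrix is the Fox--Jacobi matrix of
  the presentation \<open>\<langle>x\<^sub>1, \<dots>, x\<^sub>k | x\<^sub>i = \<beta>(x\<^sub>i)\<rangle>\<close> of the knot group, hence a presentation matrix of its
  Alexander module. Its \<open>(k - 1)\<close>-minors all agree up to units \<open>\<plusminus>t\<^sup>e\<close>, and each of them is the
  Alexander polynomial up to such a unit; symmetry and the value 1 at \<open>t = 1\<close> fix the unit.
\<close>

abbreviation laurent_monom :: "int \<Rightarrow> laurent" where
  "laurent_monom e \<equiv> Poly_Mapping.single e 1"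

definition burau_gen :: "nat \<Rightarrow> nat \<times> bool \<Rightarrow> laurent mat" where
  "burau_gen k g = (case g of (p, e) \<Rightarrow> Matrix.mat k k (\<lambda>(x, y).
     if x = p \<and> y = p then (if e then 1 - laurent_monom 1 else 0)
     else if x = p \<and> y = Suc p then (if e then laurent_monom 1 else 1)
     else if x = Suc p \<and> y = p then (if e then 1 else laurent_monom (- 1))
     else if x = Suc p \<and> y = Suc p then (if e then 0 else 1 - laurent_monom (- 1))
     else if x = y then 1 else 0))"

definition burau :: "nat \<Rightarrow> braid_word \<Rightarrow> laurent mat" where
  "burau k w = foldr (\<lambda>g M. burau_gen k g * M) w (1\<^sub>m k)"

definition alexander_polynomial :: "(R3 \<times> real) set \<Rightarrow> laurent \<Rightarrow> bool" where
  "alexander_polynomial K \<Delta> \<longleftrightarrow>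
     (\<forall>i. Poly_Mapping.lookup \<Delta> (- i) = Poly_Mapping.lookup \<Delta> i) \<and>
     (\<Sum>i\<in>Poly_Mapping.keys \<Delta>. Poly_Mapping.lookup \<Delta> i) = 1 \<and>
     (\<exists>k w. is_closure_of K k w \<and>
        (\<exists>c\<in>{1, - 1}. \<exists>e. Poly_Mapping.single e c * \<Delta> =
           Determinant.det (mat_delete (1\<^sub>m k - burau k w) 0 0)))"


section \<open>The colored Jones polynomial\<close>

text \<open>
  Turaev's construction from the enhanced \<open>R\<close>-matrix of the \<open>N\<close>-dimensional irreducible
  representation of quantum \<open>\<ss>\<ll>\<^sub>2\<close>, with basis indexed by \<open>0, \<dots>, N - 1\<close>, over the field of rational
  functions in \<open>v = q\<^sup>1\<^sup>/\<^sup>2\<close>. Below \<open>k, l\<close> are the colors entering the crossing at the bottom left and right,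
  and \<open>i, j\<close> those leaving it at the top left and right. The usual \<open>R\<close>-matrix has the entries
  \<open>{l}! {N-1-k}! / ({i}! {m}! {N-1-j}!) q^((i-(N-1)/2)(j-(N-1)/2) - m(i-j)/2 - m(m+1)/4)\<close>,
  where \<open>m = l - i = j - k\<close> and \<open>{n} = v\<^sup>n - v\<^sup>-\<^sup>n\<close>. It has been divided here by the framing
  factor \<open>q^((N^2-1)/4)\<close> of a positive curl, so that no correction by the writhe is left to be made and
  all exponents of \<open>v\<close> become integers. With this convention the right-handed trefoil
  has \<open>J\<^sub>2 = q\<^sup>-\<^sup>1 + q\<^sup>-\<^sup>3 - q\<^sup>-\<^sup>4\<close>; the opposite convention amounts to replacing each knot by its mirror image.
\<close>

definition qbrace :: "nat \<Rightarrow> ratfun" where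
  "qbrace n = indet powi int n - indet powi (- int n)"

definition qbrace_fact :: "nat \<Rightarrow> ratfun" where
  "qbrace_fact n = (\<Prod>s=1..n. qbrace s)"

definition R_matrix :: "nat \<Rightarrow> nat \<Rightarrow> nat \<Rightarrow> nat \<Rightarrow> nat \<Rightarrow> ratfun" where
  "R_matrix N k l i j =
     (if i \<le> l \<and> i + j = k + l then
        (let m = l - i;
             e = 2 * int i * int j - (int i + int j + 1) * (int N - 1)
                 - int m * (int i - int j) - int (m * (m + 1) div 2)
         in indet powi e * (qbrace_fact l * qbrace_fact (N - 1 - k)) /
            (qbrace_fact i * qbrace_fact m * qbrace_fact (N - 1 - j)))
      else 0)"

definition R_matrix_inv :: "nat \<Rightarrow> nat \<Rightarrow> nat \<Rightarrow> nat \<Rightarrow> nat \<Rightarrow> ratfun" where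
  "R_matrix_inv N k l i j =
     (if l \<le> i \<and> i + j = k + l then
        (let m = i - l;
             e = - 2 * int i * int j + (int i + int j + 1) * (int N - 1)
                 - int m * (int i - int j) + int (m * (m + 1) div 2)
         in (- 1) ^ m * indet powi e * (qbrace_fact k * qbrace_fact (N - 1 - l)) /
            (qbrace_fact j * qbrace_fact m * qbrace_fact (N - 1 - i)))
      else 0)"

definition color_states :: "nat \<Rightarrow> nat \<Rightarrow> nat list set" where
  "color_states N k = {s. length s = k \<and> set s \<subseteq> {..<N}}"

definition letter_entry :: "nat \<Rightarrow> nat \<times> bool \<Rightarrow> nat list \<Rightarrow> nat list \<Rightarrow> ratfun" where
  "letter_entry N g s r = (case g of (p, e) \<Rightarrow>
     (if \<forall>x<length s. x \<noteq> p \<and> x \<noteq> Suc p \<longrightarrow> s ! x = r ! x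
      then (if e then R_matrix else R_matrix_inv) N (s ! p) (s ! Suc p) (r ! p) (r ! Suc p)
      else 0))"

fun braid_entry :: "nat \<Rightarrow> nat \<Rightarrow> braid_word \<Rightarrow> nat list \<Rightarrow> nat list \<Rightarrow> ratfun" where
  "braid_entry N k [] s r = (if s = r then 1 else 0)"
| "braid_entry N k (g # w) s r =
     (\<Sum>u\<in>color_states N k. letter_entry N g s u * braid_entry N k w u r)"

definition quantum_trace :: "nat \<Rightarrow> nat \<Rightarrow> braid_word \<Rightarrow> ratfun" where
  "quantum_trace N k w =
     (\<Sum>s\<in>color_states N k.
        (\<Prod>x<k. indet powi (2 * int (s ! x) - int N + 1)) * braid_entry N k w s s)"

text \<open>\<open>J n\<close> is \<open>J\<^bsub>K,n\<^esub>(q)\<close> for \<open>n \<ge> 1\<close>; the trace of the unknot is \<open>{n} / {1}\<close>.\<close>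

definition colored_jones :: "(R3 \<times> real) set \<Rightarrow> (nat \<Rightarrow> laurent) \<Rightarrow> bool" where
  "colored_jones K J \<longleftrightarrow>
     (\<exists>k w. is_closure_of K k w \<and>
        (\<forall>n\<ge>1. laurent_at (J n) (indet ^ 2) = qbrace 1 / qbrace n * quantum_trace n k w))"


section \<open>The Habiro ring\<close>

definition compatible_roots_of_unity :: "(nat \<Rightarrow> complex) \<Rightarrow> bool" where
  "compatible_roots_of_unity \<zeta> \<longleftrightarrow>
     (\<forall>m\<ge>1. \<zeta> m ^ m = 1 \<and> (\<forall>k. 0 < k \<and> k < m \<longrightarrow> \<zeta> m ^ k \<noteq> 1)) \<and>
     (\<forall>m\<ge>1. \<forall>m'\<ge>1. coprime m m' \<longrightarrow> \<zeta> (m * m') = \<zeta> m * \<zeta> m') \<and>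
     (\<forall>p r. prime p \<longrightarrow> r \<ge> 1 \<longrightarrow> \<zeta> (p ^ r) ^ p = \<zeta> (p ^ (r - 1)))"

inductive_set subring_generated :: "'a::ring_1 set \<Rightarrow> 'a set" for S where
  of_int: "of_int c \<in> subring_generated S"
| gen: "a \<in> S \<Longrightarrow> a \<in> subring_generated S"
| add: "a \<in> subring_generated S \<Longrightarrow> b \<in> subring_generated S \<Longrightarrow> a + b \<in> subring_generated S"
| mult: "a \<in> subring_generated S \<Longrightarrow> b \<in> subring_generated S \<Longrightarrow> a * b \<in> subring_generated S"

text \<open>
  In the \<open>m\<close>-th component the indeterminate of \<^typ>\<open>ratfun\<close> stands for \<open>t\<^sup>1\<^sup>/\<^sup>m\<close>, so that
  \<open>coeff_ring \<zeta> \<Delta> l m\<close> is the subring \<open>R[\<zeta>\<^sub>l, t\<^sup>1\<^sup>/\<^sup>m]\<close> of \<open>\<complex>(t\<^sup>1\<^sup>/\<^sup>m)\<close>, where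
  \<open>R = \<int>[t\<^sup>\<plusminus>\<^sup>1, \<Delta>(t)\<^sup>-\<^sup>1]\<close>.
\<close>

definition coeff_ring :: "(nat \<Rightarrow> complex) \<Rightarrow> laurent \<Rightarrow> nat \<Rightarrow> nat \<Rightarrow> ratfun set" where
  "coeff_ring \<zeta> \<Delta> l m =
     subring_generated {const_fun (\<zeta> l), indet, inverse indet, inverse (laurent_at \<Delta> (indet ^ m))}"

text \<open>
  Power series in \<open>q - \<zeta>\<^sub>m\<close> are formal power series whose variable stands for \<open>q - \<zeta>\<^sub>m\<close>.

  Let \<open>B = R[\<zeta>\<^bsub>pm\<^esub>, t\<^sup>1\<^sup>/\<^sup>m]\<close>. An element of its \<open>p\<close>-adic completion \<open>R\<^sub>p[\<zeta>\<^bsub>pm\<^esub>, t\<^sup>1\<^sup>/\<^sup>m] = lim\<^sub>N B/p\<^sup>NB\<close> is given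
  as the family, indexed by \<open>N\<close>, of its residue classes, each of which is a subset of \<open>B\<close>.
  The \<open>k\<close>-th coefficient of the re-expansion of \<open>g = \<Sum>\<^sub>j g\<^sub>j (q - \<zeta>\<^sub>m)\<^sup>j\<close> at \<open>\<zeta>\<^bsub>pm\<^esub>\<close> is the \<open>p\<close>-adic limit of
  \<open>\<Sum>\<^sub>j (j choose k) (\<zeta>\<^bsub>pm\<^esub> - \<zeta>\<^sub>m)\<^bsup>j-k\<^esup> g\<^sub>j\<close>, the partial sums of which are eventually constant modulo \<open>p\<^sup>N\<close>.
\<close>

definition residue_class :: "ratfun set \<Rightarrow> nat \<Rightarrow> nat \<Rightarrow> ratfun \<Rightarrow> ratfun set" where
  "residue_class B p N a = {b \<in> B. \<exists>c\<in>B. a - b = of_nat p ^ N * c}"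

definition reexpansion ::
  "(nat \<Rightarrow> complex) \<Rightarrow> laurent \<Rightarrow> nat \<Rightarrow> nat \<Rightarrow> ratfun fps \<Rightarrow> nat \<Rightarrow> nat \<Rightarrow> ratfun set" where
  "reexpansion \<zeta> \<Delta> p m g k N =
     {b. \<forall>\<^sub>F n in sequentially.
           b \<in> residue_class (coeff_ring \<zeta> \<Delta> (p * m) m) p N
                 (\<Sum>j=k..n. of_nat (j choose k) * const_fun ((\<zeta> (p * m) - \<zeta> m) ^ (j - k)) * fps_nth g j)}"

text \<open>
  The map \<open>\<phi>\<^sub>p\<close> on the coefficients of a power series over \<open>R[\<zeta>\<^bsub>pm\<^esub>, t\<^bsup>1/(pm)\<^esup>]\<close>. Since it sends \<open>t\<^bsup>1/(pm)\<^esup>\<close> to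
  \<open>t\<^sup>1\<^sup>/\<^sup>m\<close> and both are denoted by \<^const>\<open>indet\<close>, as a map of rational functions it is the identity. Its
  values are fractions \<open>a/\<Delta>(t\<^sup>p)\<^sup>e\<close>; they have to be read in the completion, where \<open>\<Delta>(t\<^sup>p)\<close> is a unit
  because \<open>\<Delta>(t\<^sup>p) \<equiv> \<Delta>(t)\<^sup>p\<close> modulo \<open>p\<close>: the residue class of such a fraction \<open>h\<close> consists of
  the \<open>b \<in> B\<close> with \<open>\<Delta>(t\<^sup>p)\<^sup>e (h - b) \<in> p\<^sup>NB\<close> for some \<open>e\<close>.
\<close>

definition frobenius ::
  "(nat \<Rightarrow> complex) \<Rightarrow> laurent \<Rightarrow> nat \<Rightarrow> nat \<Rightarrow> ratfun fps \<Rightarrow> nat \<Rightarrow> nat \<Rightarrow> ratfun set" where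
  "frobenius \<zeta> \<Delta> p m h k N =
     (let B = coeff_ring \<zeta> \<Delta> (p * m) m in
      {b \<in> B. \<exists>e. \<exists>c\<in>B.
         laurent_at \<Delta> (indet ^ (p * m)) ^ e * (fps_nth h k - b) = of_nat p ^ N * c})"

definition habiro_ring :: "(nat \<Rightarrow> complex) \<Rightarrow> laurent \<Rightarrow> (nat \<Rightarrow> ratfun fps) set" where
  "habiro_ring \<zeta> \<Delta> =
     {f. (\<forall>m\<ge>1. \<forall>k. fps_nth (f m) k \<in> coeff_ring \<zeta> \<Delta> m m) \<and>
         (\<forall>m\<ge>1. \<forall>p. prime p \<longrightarrow> reexpansion \<zeta> \<Delta> p m (f m) = frobenius \<zeta> \<Delta> p m (f (p * m)))}"

text \<open>The element \<open>q = \<zeta>\<^sub>m + (q - \<zeta>\<^sub>m)\<close> in the \<open>m\<close>-th component.\<close>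

definition q_at :: "(nat \<Rightarrow> complex) \<Rightarrow> nat \<Rightarrow> ratfun fps" where
  "q_at \<zeta> m = fps_const (const_fun (\<zeta> m)) + fps_X"

text \<open>
  Substitution of a unit \<open>u\<close> for \<open>t\<^sup>1\<^sup>/\<^sup>m\<close>, first in a coefficient and then in a power series (\<open>q\<close> being fixed).
  The denominators that occur for elements of the Habiro ring and \<open>u = q\<^sup>n\<close>, \<open>u = q t\<^sup>1\<^sup>/\<^sup>m\<close> become units,
  since \<open>\<Delta>(1) = 1\<close> and \<open>\<zeta>\<^sub>m\<^sup>m = 1\<close>.
\<close>

definition subst_coeff :: "ratfun fps \<Rightarrow> ratfun \<Rightarrow> ratfun fps" where
  "subst_coeff u g =
     (case quot_of_fract g of (a, b) \<Rightarrow>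
        poly (map_poly (\<lambda>c. fps_const (const_fun c)) a) u *
        inverse (poly (map_poly (\<lambda>c. fps_const (const_fun c)) b) u))"

definition subst :: "ratfun fps \<Rightarrow> ratfun fps \<Rightarrow> ratfun fps" where
  "subst u f = Abs_fps (\<lambda>n. \<Sum>k\<le>n. fps_nth (subst_coeff u (fps_nth f k)) (n - k))"

definition sigma :: "(nat \<Rightarrow> complex) \<Rightarrow> (nat \<Rightarrow> ratfun fps) \<Rightarrow> nat \<Rightarrow> ratfun fps" where
  "sigma \<zeta> f m = subst (q_at \<zeta> m * fps_const indet) (f m)"

text \<open>
  The \<open>m\<close>-th component of \<open>f(q\<^sup>n, q)\<close>. Its coefficients are constant rational functions, in \<open>\<int>[\<zeta>\<^sub>m]\<close>. The
  Habiro ring of \<open>\<int>\<close> is a subring of the product of all \<open>\<int>[\<zeta>\<^sub>m][[q - \<zeta>\<^sub>m]]\<close>, so identities in it are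
  componentwise.
\<close>

definition specialize :: "(nat \<Rightarrow> complex) \<Rightarrow> nat \<Rightarrow> (nat \<Rightarrow> ratfun fps) \<Rightarrow> nat \<Rightarrow> ratfun fps" where
  "specialize \<zeta> n f m = subst (q_at \<zeta> m ^ n) (f m)"

text \<open>
  An element of the Habiro ring is determined by its values \<open>f(q\<^bsup>n-1\<^esup>, q)\<close>, \<open>n \<ge> 1\<close>, so these conditions
  characterize the lift \<open>J\<^sub>K(t, q)\<close> of the colored Jones polynomial.
\<close>

definition jones_lift ::
  "(nat \<Rightarrow> complex) \<Rightarrow> laurent \<Rightarrow> (nat \<Rightarrow> laurent) \<Rightarrow> (nat \<Rightarrow> ratfun fps) \<Rightarrow> bool" where
  "jones_lift \<zeta> \<Delta> J f \<longleftrightarrow> f \<in> habiro_ring \<zeta> \<Delta> \<and>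
     (\<forall>n\<ge>1. \<forall>m\<ge>1. specialize \<zeta> (n - 1) f m = laurent_at (J n) (q_at \<zeta> m))"

text \<open>The operator \<open>\<Sum>\<^sub>j\<^sub>\<le>\<^sub>d a\<^sub>j(t, q) \<sigma>\<^sup>j\<close>; \<open>a(t, q)\<close> acts on the \<open>m\<close>-th component by \<open>a(t\<^sup>1\<^sup>/\<^sup>m, q)\<close>.\<close>

definition q_difference_op ::
  "(nat \<Rightarrow> complex) \<Rightarrow> nat \<Rightarrow> (nat \<Rightarrow> laurent2) \<Rightarrow> (nat \<Rightarrow> ratfun fps) \<Rightarrow> nat \<Rightarrow> ratfun fps" where
  "q_difference_op \<zeta> d a f m =
     (\<Sum>j\<le>d. laurent2_at (a j) (fps_const indet) (q_at \<zeta> m) * (sigma \<zeta> ^^ j) f m)"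

end

theory Submission
  imports Defs
begin

text \<open>
  Existence of an annihilator. The colored Jones polynomial is a state sum whose summand is a product of
  \<open>q\<close>-factorials, inverse \<open>q\<close>-factorials and powers of \<open>v\<close> with quadratic exponents, cut off at the
  boundary of a polytope. Deforming the \<open>q\<close>-factorials by a formal parameter makes the summand a genuine
  \<open>q\<close>-hypergeometric term on a whole lattice of rank \<open>d\<close>, the cut-offs reappearing in the limit since the
  orders in the parameter are positive outside the polytope. The shifts of such a term by vectors of size
  \<open>L\<close> span a space of dimension \<open>O(L\<^sup>d)\<close>, too small for all products of these shifts with powers
  \<open>q\<^bsup>in\<^esup>\<close>, \<open>i \<le> L\<close>, to be independent; the resulting relation is summed over all states.

  Comparison of the two kinds of equations. Substituting \<open>t = q\<^bsup>n - 1\<^esup>\<close> into \<open>P J\<^sub>K\<close> gives the value of the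
  recurrence at \<open>n\<close>, so what remains to be seen is that a series vanishes if all these substitutions vanish. This
  holds for each component \<open>m\<close> separately, already for the exponents divisible by \<open>m\<close>: these substitute
  \<open>1 + O(q - \<zeta>\<^sub>m)\<close> for \<open>t\<^bsup>1/m\<^esup>\<close>, the coefficients have no pole at 1 because \<open>\<Delta>(1) = 1\<close>, and the lowest
  coefficient of the result is a nonzero polynomial in the exponent.
\<close>

section \<open>Laurent polynomials, subrings and linear relations\<close>

text \<open>The existence proof is an elimination in the style of Fasenmyer. It requires that all
  shifts of the summand are Laurent polynomials in the quantities \<open>q^(x v)\<close> times one
  common function. A factorial fails this at negative arguments: its recursion passes through the
  factor \<open>1 - q^0 = 0\<close>, so values on the two sides of 0 cannot be compared. The
  deformed factor \<open>1 - q^a * (1 + X^k)\<close> is never 0. Several strengths \<open>k\<close>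
  are needed, because a factorial in a numerator acquires a pole in \<open>X\<close>, which only a
  quotient of deformations of different strengths turns into a zero. The price is that relations are
  found over power series in \<open>X\<close> and must be brought back to \<open>X = 0\<close>
  without becoming trivial. The summand lives over rational functions in \<open>v\<close>, but the
  operator has integral coefficients in \<open>q = v^2\<close>. Hence the elimination avoids
  fractions, and every comparison of shifts is arranged so that only even powers of \<open>v\<close>
  enter. In the second half the difficulty is that \<open>t = q^n\<close> is a partially defined
  substitution, so that its compatibility with products, sums and \<open>\<sigma>\<close> has to be
  secured by controlling denominators.\<close>

lemma powi_diff_of_unit:
  fixes u :: "'a::{comm_ring_1,inverse}"
  assumes "u * inverse u = 1"
  shows "u powi (int a - int b) = u ^ a * inverse u ^ b"
proof (cases "b \<le> a")
  case True
  then obtain c where c: "a = b + c" using le_Suc_ex by blast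
  have "u ^ a * inverse u ^ b = u ^ c * (u * inverse u) ^ b"
    by (simp add: c power_add power_mult_distrib mult_ac)
  with assms c show ?thesis by (simp add: power_int_def)
next
  case False
  then obtain c where c: "b = a + c" "c > 0" by (metis less_imp_add_positive not_le)
  have "u ^ a * inverse u ^ b = inverse u ^ c * (u * inverse u) ^ a"
    by (simp add: c power_add power_mult_distrib mult_ac)
  with assms c show ?thesis by (simp add: power_int_def)
qed

text \<open>These rules serve rational functions and power series alike. In the latter
  \<open>inverse\<close> inverts only some elements, so the unit is given by the equation
  \<open>u * inverse u = 1\<close>. Writing exponents as differences of natural numbers avoids a
  distinction of signs.\<close>

lemma powi_add_of_unit:
  fixes u :: "'a::{comm_ring_1,inverse}"
  assumes u: "u * inverse u = 1"
  shows "u powi (i + j) = u powi i * u powi j"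
proof -
  obtain a b where i: "i = int a - int b" by (metis int_diff_cases)
  obtain c d where j: "j = int c - int d" by (metis int_diff_cases)
  have "i + j = int (a + c) - int (b + d)" using i j by simp
  then show ?thesis
    by (simp only: powi_diff_of_unit[OF u] i j) (simp add: power_add mult_ac)
qed

lemma power_powi_of_unit:
  fixes u :: "'a::{comm_ring_1,inverse}"
  assumes u: "u * inverse u = 1" and w: "u ^ n * inverse (u ^ n) = 1"
  shows "(u ^ n) powi i = u powi (int n * i)"
proof -
  have inv: "inverse (u ^ n) = inverse u ^ n"
  proof -
    have 1: "u ^ n * inverse u ^ n = 1"
      using u by (metis power_mult_distrib power_one)
    have "inverse (u ^ n) = inverse (u ^ n) * (u ^ n * inverse u ^ n)" using 1 by simp
    also have "\<dots> = (u ^ n * inverse (u ^ n)) * inverse u ^ n" by (simp add: mult_ac)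
    finally show ?thesis using w by simp
  qed
  obtain a b where i: "i = int a - int b" by (metis int_diff_cases)
  have "int n * i = int (n * a) - int (n * b)" by (simp add: i right_diff_distrib)
  then show ?thesis
    by (simp only: i powi_diff_of_unit[OF u] powi_diff_of_unit[OF w] inv power_mult)
qed

text \<open>The linear extension of a map on monomials to an integral group ring, a ring
  homomorphism if the map is multiplicative. Both \<open>laurent_at\<close> and
  \<open>laurent2_at_q_power\<close> are instances.\<close>

definition pm_eval :: "('k \<Rightarrow> 'a::comm_ring_1) \<Rightarrow> ('k \<Rightarrow>\<^sub>0 int) \<Rightarrow> 'a" where
  "pm_eval \<phi> a = (\<Sum>k\<in>Poly_Mapping.keys a. of_int (Poly_Mapping.lookup a k) * \<phi> k)"

lemma pm_eval_superset:
  assumes "finite S" "Poly_Mapping.keys a \<subseteq> S"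
  shows "pm_eval \<phi> a = (\<Sum>k\<in>S. of_int (Poly_Mapping.lookup a k) * \<phi> k)"
  unfolding pm_eval_def
  by (rule sum.mono_neutral_left) (use assms in \<open>auto simp: in_keys_iff\<close>)

lemma pm_eval_add: "pm_eval \<phi> (a + b) = pm_eval \<phi> a + pm_eval \<phi> b"
proof -
  let ?S = "Poly_Mapping.keys a \<union> Poly_Mapping.keys b"
  have "pm_eval \<phi> (a + b) = (\<Sum>k\<in>?S. of_int (Poly_Mapping.lookup (a + b) k) * \<phi> k)"
    by (rule pm_eval_superset) (use keys_add[of a b] in auto)
  also have "\<dots> = (\<Sum>k\<in>?S. of_int (Poly_Mapping.lookup a k) * \<phi> k)
      + (\<Sum>k\<in>?S. of_int (Poly_Mapping.lookup b k) * \<phi> k)"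
    by (simp add: lookup_add distrib_right sum.distrib)
  also have "\<dots> = pm_eval \<phi> a + pm_eval \<phi> b"
    by (simp add: pm_eval_superset[of ?S])
  finally show ?thesis .
qed

lemma pm_eval_0 [simp]: "pm_eval \<phi> 0 = 0"
  by (simp add: pm_eval_def)

lemma pm_eval_single [simp]: "pm_eval \<phi> (Poly_Mapping.single k c) = of_int c * \<phi> k"
  by (simp add: pm_eval_def)

lemma pm_eval_sum: "pm_eval \<phi> (sum f S) = (\<Sum>s\<in>S. pm_eval \<phi> (f s))"
  by (induction S rule: infinite_finite_induct) (simp_all add: pm_eval_add)

lemma pm_expansion: "(\<Sum>k\<in>Poly_Mapping.keys a. Poly_Mapping.single k (Poly_Mapping.lookup a k)) = a"
proof (rule poly_mapping_eqI)
  fix i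
  show "Poly_Mapping.lookup (\<Sum>k\<in>Poly_Mapping.keys a. Poly_Mapping.single k (Poly_Mapping.lookup a k)) i
      = Poly_Mapping.lookup a i"
    by (cases "i \<in> Poly_Mapping.keys a")
      (auto simp: lookup_sum lookup_single when_def in_keys_iff sum.delta)
qed

lemma pm_eval_mult:
  fixes \<phi> :: "'k::cancel_comm_monoid_add \<Rightarrow> 'a::comm_ring_1"
  assumes \<phi>: "\<And>k l. \<phi> (k + l) = \<phi> k * \<phi> l"
  shows "pm_eval \<phi> (a * b) = pm_eval \<phi> a * pm_eval \<phi> b"
proof -
  let ?s = "\<lambda>a k. Poly_Mapping.single k (Poly_Mapping.lookup a k)"
  have "a * b = (\<Sum>k\<in>Poly_Mapping.keys a. ?s a k) * (\<Sum>l\<in>Poly_Mapping.keys b. ?s b l)"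
    by (simp only: pm_expansion)
  also have "\<dots> = (\<Sum>k\<in>Poly_Mapping.keys a. \<Sum>l\<in>Poly_Mapping.keys b. ?s a k * ?s b l)"
    by (simp add: sum_product)
  finally have "pm_eval \<phi> (a * b) = (\<Sum>k\<in>Poly_Mapping.keys a. \<Sum>l\<in>Poly_Mapping.keys b.
      of_int (Poly_Mapping.lookup a k) * \<phi> k * (of_int (Poly_Mapping.lookup b l) * \<phi> l))"
    by (simp add: pm_eval_sum mult_single \<phi> mult_ac)
  also have "\<dots> = pm_eval \<phi> a * pm_eval \<phi> b"
    by (simp add: pm_eval_def sum_product)
  finally show ?thesis .
qed

lemma laurent_at_eq_pm_eval: "laurent_at a u = pm_eval (\<lambda>i. u powi i) a"
  by (simp add: laurent_at_def pm_eval_def)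

lemma laurent_at_0 [simp]: "laurent_at 0 u = 0"
  by (simp add: laurent_at_eq_pm_eval)

lemma laurent_at_add: "laurent_at (a + b) u = laurent_at a u + laurent_at b u"
  by (simp add: laurent_at_eq_pm_eval pm_eval_add)

lemma laurent_at_sum: "laurent_at (sum f S) u = (\<Sum>s\<in>S. laurent_at (f s) u)"
  by (simp add: laurent_at_eq_pm_eval pm_eval_sum)

lemma laurent_at_single [simp]: "laurent_at (Poly_Mapping.single i c) u = of_int c * u powi i"
  by (simp add: laurent_at_eq_pm_eval)

lemma laurent_at_mult:
  fixes u :: "'a::{comm_ring_1,inverse}"
  assumes "u * inverse u = 1"
  shows "laurent_at (a * b) u = laurent_at a u * laurent_at b u"
  unfolding laurent_at_eq_pm_eval
  by (rule pm_eval_mult) (rule powi_add_of_unit[OF assms])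

lemma laurent2_at_q_power:
  fixes u :: "'a::{comm_ring_1,inverse}"
  assumes u: "u * inverse u = 1" and w: "u ^ n * inverse (u ^ n) = 1"
  shows "laurent_at (laurent2_at_q_power a (int n)) u = laurent2_at a (u ^ n) u"
  unfolding laurent2_at_q_power_def laurent2_at_def
  by (simp add: laurent_at_sum case_prod_unfold powi_add_of_unit[OF u] power_powi_of_unit[OF u w])

text \<open>Multiplication by \<open>u ^ N\<close>, with \<open>N\<close> a bound for the exponents,
  leaves an ordinary polynomial in \<open>u\<close>, to which \<open>indep\<close> applies. The unit
  is general because both \<open>q = v^2\<close> among the rational functions and
  \<open>q = z + X\<close> among the power series are needed.\<close>

lemma laurent_eq_0_if_laurent_at_eq_0:
  fixes u :: "'a::{comm_ring_1,inverse}"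
  assumes u: "u * inverse u = 1"
    and indep: "\<And>n c. (\<Sum>k\<le>n. of_int (c k) * u ^ k) = 0 \<Longrightarrow> \<forall>k\<le>n. c k = (0::int)"
    and a: "laurent_at a u = 0"
  shows "a = 0"
proof -
  obtain N where N: "\<And>i. i \<in> Poly_Mapping.keys a \<Longrightarrow> \<bar>i\<bar> \<le> int N"
  proof -
    have "finite (Poly_Mapping.keys a)" by simp
    then have "\<exists>N. \<forall>i\<in>Poly_Mapping.keys a. \<bar>i\<bar> \<le> int N"
    proof (induction rule: finite_induct)
      case (insert x F)
      then obtain N where "\<forall>i\<in>F. \<bar>i\<bar> \<le> int N" by blast
      then show ?case by (intro exI[of _ "max N (nat \<bar>x\<bar>)"]) auto
    qed simp
    then show ?thesis using that by blast
  qed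
  have "0 = u ^ N * laurent_at a u" by (simp add: a)
  also have "laurent_at a u
      = (\<Sum>i\<in>{- int N..int N}. of_int (Poly_Mapping.lookup a i) * u powi i)"
    unfolding laurent_at_eq_pm_eval
    by (rule pm_eval_superset) (use N in \<open>auto simp: abs_le_iff\<close>, fastforce)
  also have "\<dots> = (\<Sum>k\<le>2 * N. of_int (Poly_Mapping.lookup a (int k - int N)) * u powi (int k - int N))"
    by (rule sum.reindex_bij_witness[of _ "\<lambda>k. int k - int N" "\<lambda>i. nat (i + int N)"]) auto
  also have "u ^ N * \<dots> = (\<Sum>k\<le>2 * N. of_int (Poly_Mapping.lookup a (int k - int N)) * u ^ k)"
    unfolding sum_distrib_left
  proof (rule sum.cong[OF refl])
    fix k
    have "u ^ N * u powi (int k - int N) = u ^ k * (u * inverse u) ^ N"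
      by (simp only: powi_diff_of_unit[OF u] power_mult_distrib mult_ac)
    then have "u ^ N * u powi (int k - int N) = u ^ k" using u by simp
    then show "u ^ N * (of_int (Poly_Mapping.lookup a (int k - int N)) * u powi (int k - int N))
        = of_int (Poly_Mapping.lookup a (int k - int N)) * u ^ k"
      by (metis mult.left_commute)
  qed
  finally have *: "\<forall>k\<le>2 * N. Poly_Mapping.lookup a (int k - int N) = 0"
    using indep by metis
  then have "Poly_Mapping.lookup a i = 0" if "\<bar>i\<bar> \<le> int N" for i
  proof -
    have "int (nat (i + int N)) - int N = i" "nat (i + int N) \<le> 2 * N" using that by auto
    with * show ?thesis by metis
  qed
  then show ?thesis using N by (metis in_keys_iff poly_mapping_eqI lookup_zero)
qed

section \<open>Subrings as closed sets, and power series with coefficients in them\<close>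

definition is_subring :: "'a::comm_ring_1 set \<Rightarrow> bool" where
  "is_subring S \<longleftrightarrow> 1 \<in> S \<and> (\<forall>a\<in>S. \<forall>b\<in>S. a - b \<in> S \<and> a * b \<in> S)"

lemma is_subring_closed:
  assumes "is_subring S"
  shows is_subring_0: "0 \<in> S" and is_subring_1: "1 \<in> S"
    and is_subring_diff: "\<And>a b. a \<in> S \<Longrightarrow> b \<in> S \<Longrightarrow> a - b \<in> S"
    and is_subring_uminus: "\<And>a. a \<in> S \<Longrightarrow> - a \<in> S"
    and is_subring_add: "\<And>a b. a \<in> S \<Longrightarrow> b \<in> S \<Longrightarrow> a + b \<in> S"
    and is_subring_mult: "\<And>a b. a \<in> S \<Longrightarrow> b \<in> S \<Longrightarrow> a * b \<in> S"
proof -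
  show 1: "1 \<in> S" using assms by (simp add: is_subring_def)
  show diff: "a - b \<in> S" if "a \<in> S" "b \<in> S" for a b
    using assms that by (simp add: is_subring_def)
  show "a * b \<in> S" if "a \<in> S" "b \<in> S" for a b
    using assms that by (simp add: is_subring_def)
  show 0: "0 \<in> S" using diff[OF 1 1] by simp
  show um: "- a \<in> S" if "a \<in> S" for a using diff[OF 0 that] by simp
  show "a + b \<in> S" if "a \<in> S" "b \<in> S" for a b using diff[OF that(1) um[OF that(2)]] by simp
qed

lemma is_subring_sum:
  assumes "is_subring S" "\<And>i. i \<in> I \<Longrightarrow> f i \<in> S"
  shows "sum f I \<in> S"
  using assms(2)
  by (induction I rule: infinite_finite_induct)
    (auto intro: is_subring_0[OF assms(1)] is_subring_add[OF assms(1)])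

lemma is_subring_power: "is_subring S \<Longrightarrow> a \<in> S \<Longrightarrow> a ^ n \<in> S"
  by (induction n) (auto intro: is_subring_1 is_subring_mult)

lemma is_subring_of_nat: "is_subring S \<Longrightarrow> of_nat n \<in> S"
  by (induction n) (auto intro: is_subring_0 is_subring_1 is_subring_add)

lemma is_subring_of_int: "is_subring S \<Longrightarrow> of_int n \<in> S"
  by (cases n) (auto intro: is_subring_of_nat is_subring_uminus simp del: of_nat_Suc)

lemma is_subring_powi:
  fixes a :: "'a::{comm_ring_1,inverse}"
  shows "is_subring S \<Longrightarrow> a \<in> S \<Longrightarrow> inverse a \<in> S \<Longrightarrow> a powi i \<in> S"
  by (auto simp: power_int_def intro: is_subring_power)

lemma is_subring_subring_generated: "is_subring (subring_generated G)"
proof -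
  have "a - b \<in> subring_generated G" if "a \<in> subring_generated G" "b \<in> subring_generated G" for a b
    using subring_generated.add[OF that(1) subring_generated.mult[OF subring_generated.of_int[of "-1"] that(2)]]
    by simp
  moreover have "1 \<in> subring_generated G"
    using subring_generated.of_int[of 1] by simp
  ultimately show ?thesis
    by (auto simp: is_subring_def intro: subring_generated.mult)
qed

lemma subring_generated_subset:
  assumes S: "is_subring S" and G: "G \<subseteq> S"
  shows "subring_generated G \<subseteq> S"
proof
  fix a assume "a \<in> subring_generated G"
  then show "a \<in> S"
    by induction (use S G in \<open>auto intro: is_subring_of_int is_subring_add is_subring_mult\<close>)
qed

definition coeffs_in :: "'a::comm_ring_1 set \<Rightarrow> 'a fps set" where
  "coeffs_in S = {f. \<forall>k. fps_nth f k \<in> S}"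

lemma coeffs_inD: "f \<in> coeffs_in S \<Longrightarrow> fps_nth f k \<in> S"
  by (simp add: coeffs_in_def)

lemma is_subring_coeffs_in:
  assumes S: "is_subring S"
  shows "is_subring (coeffs_in S)"
  using is_subring_closed[OF S]
  by (auto simp: is_subring_def coeffs_in_def fps_mult_nth intro!: is_subring_sum[OF S])

lemma fps_const_in_coeffs_in: "is_subring S \<Longrightarrow> c \<in> S \<Longrightarrow> fps_const c \<in> coeffs_in S"
  by (auto simp: coeffs_in_def is_subring_0)

lemma fps_X_in_coeffs_in: "is_subring S \<Longrightarrow> fps_X \<in> coeffs_in S"
  by (auto simp: coeffs_in_def is_subring_0 is_subring_1)

lemma inverse_in_coeffs_in:
  fixes f :: "'a::field fps"
  assumes S: "is_subring S" and f: "f \<in> coeffs_in S" and inv: "inverse (fps_nth f 0) \<in> S"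
  shows "inverse f \<in> coeffs_in S"
proof (cases "fps_nth f 0 = 0")
  \<comment> \<open>A series without constant term has inverse 0 by convention.\<close>
  case True
  then have "inverse f = 0" by simp
  show ?thesis
    unfolding \<open>inverse f = 0\<close> by (simp add: coeffs_in_def is_subring_0[OF S])
next
  case False
  have "fps_nth (inverse f) k \<in> S" for k
  proof (induction k rule: less_induct)
    case (less k)
    show ?case
    proof (cases k)
      case 0
      then show ?thesis using inv by simp
    next
      case (Suc l)
      have "0 = fps_nth (f * inverse f) k"
        using False Suc by (simp add: inverse_mult_eq_1')
      also have "\<dots> = (\<Sum>i=0..k. fps_nth f i * fps_nth (inverse f) (k - i))"
        by (simp add: fps_mult_nth)
      also have "\<dots> = fps_nth f 0 * fps_nth (inverse f) k
          + (\<Sum>i=1..k. fps_nth f i * fps_nth (inverse f) (k - i))"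
        by (simp add: sum.atLeast_Suc_atMost)
      finally have "fps_nth (inverse f) k = - inverse (fps_nth f 0) *
          (\<Sum>i=1..k. fps_nth f i * fps_nth (inverse f) (k - i))"
        using False by (simp add: field_simps eq_neg_iff_add_eq_0)
      moreover have "(\<Sum>i=1..k. fps_nth f i * fps_nth (inverse f) (k - i)) \<in> S"
        by (rule is_subring_sum[OF S], rule is_subring_mult[OF S])
          (use f less.IH in \<open>auto simp: coeffs_in_def\<close>)
      ultimately show ?thesis
        using inv by (simp add: is_subring_mult[OF S] is_subring_uminus[OF S])
    qed
  qed
  then show ?thesis by (simp add: coeffs_in_def)
qed

text \<open>Elimination without fractions, one equation at a time: a pivot \<open>C i0 b\<close>
  removes the unknown \<open>i0\<close> by cross multiplication, so that all coefficients stay in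
  \<open>S\<close>. Each step removes one equation and one unknown, which preserves
  \<open>card B < card I\<close>.\<close>

lemma exists_nontrivial_relation:
  fixes C :: "'i \<Rightarrow> 'b \<Rightarrow> 'a::idom"
  assumes S: "is_subring S" and "finite B" "finite I" "card B < card I"
    and "\<And>i b. i \<in> I \<Longrightarrow> b \<in> B \<Longrightarrow> C i b \<in> S"
  shows "\<exists>c. (\<forall>i\<in>I. c i \<in> S) \<and> (\<exists>i\<in>I. c i \<noteq> 0) \<and> (\<forall>b\<in>B. (\<Sum>i\<in>I. c i * C i b) = 0)"
  using assms(2-)
proof (induction B arbitrary: I C rule: finite_induct)
  case empty
  then have "I \<noteq> {}" by auto
  then show ?case by (intro exI[of _ "\<lambda>_. 1"]) (auto simp: is_subring_1[OF S])
next
  case (insert b B)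
  show ?case
  proof (cases "\<forall>i\<in>I. C i b = 0")
    case True
    have "\<exists>c. (\<forall>i\<in>I. c i \<in> S) \<and> (\<exists>i\<in>I. c i \<noteq> 0) \<and> (\<forall>b\<in>B. (\<Sum>i\<in>I. c i * C i b) = 0)"
      by (rule insert.IH) (use insert in auto)
    then show ?thesis using True by auto
  next
    case False
    then obtain i0 where i0: "i0 \<in> I" "C i0 b \<noteq> 0" by auto
    define I' where "I' = I - {i0}"
    define C' where "C' = (\<lambda>i \<beta>. C i0 b * C i \<beta> - C i b * C i0 \<beta>)"
    have I: "I = insert i0 I'" "i0 \<notin> I'" "finite I'"
      using i0 insert.prems by (auto simp: I'_def)
    have "\<exists>c. (\<forall>i\<in>I'. c i \<in> S) \<and> (\<exists>i\<in>I'. c i \<noteq> 0) \<and> (\<forall>\<beta>\<in>B. (\<Sum>i\<in>I'. c i * C' i \<beta>) = 0)"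
    proof (rule insert.IH)
      show "card B < card I'" using insert I by simp
      show "C' i \<beta> \<in> S" if "i \<in> I'" "\<beta> \<in> B" for i \<beta>
        unfolding C'_def using that I insert.prems i0
        by (intro is_subring_diff[OF S] is_subring_mult[OF S]) auto
    qed (use I in auto)
    then obtain c where c: "\<forall>i\<in>I'. c i \<in> S" "\<exists>i\<in>I'. c i \<noteq> 0"
      "\<And>\<beta>. \<beta> \<in> B \<Longrightarrow> (\<Sum>i\<in>I'. c i * C' i \<beta>) = 0" by blast
    \<comment> \<open>The solution of the reduced system is multiplied by the pivot, which keeps it
      nonzero in a domain, and the equation \<open>b\<close> is then solved for the unknown
      \<open>i0\<close>.\<close>
    define d where "d = (\<lambda>i. if i = i0 then - (\<Sum>i\<in>I'. c i * C i b) else c i * C i0 b)"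
    have d: "(\<Sum>i\<in>I. d i * C i \<beta>)
        = (\<Sum>i\<in>I'. c i * C i0 b * C i \<beta>) - (\<Sum>i\<in>I'. c i * C i b) * C i0 \<beta>" for \<beta>
    proof -
      have "(\<Sum>i\<in>I'. d i * C i \<beta>) = (\<Sum>i\<in>I'. c i * C i0 b * C i \<beta>)"
        by (rule sum.cong) (use I in \<open>auto simp: d_def\<close>)
      then show ?thesis using I by (simp add: d_def)
    qed
    show ?thesis
    proof (intro exI[of _ d] conjI ballI)
      show "d i \<in> S" if "i \<in> I" for i
        unfolding d_def using that I i0 insert.prems c
        by (auto intro!: is_subring_uminus[OF S] is_subring_sum[OF S] is_subring_mult[OF S])
      show "\<exists>i\<in>I. d i \<noteq> 0" using c(2) I i0 by (auto simp: d_def)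
      fix \<beta> assume "\<beta> \<in> insert b B"
      then consider "\<beta> = b" | "\<beta> \<in> B" by blast
      then show "(\<Sum>i\<in>I. d i * C i \<beta>) = 0"
      proof cases
        case 1
        then show ?thesis unfolding d by (simp add: sum_distrib_left sum_distrib_right mult_ac)
      next
        case 2
        have "(\<Sum>i\<in>I'. c i * C' i \<beta>) = (\<Sum>i\<in>I'. c i * C i0 b * C i \<beta>) - (\<Sum>i\<in>I'. c i * C i b) * C i0 \<beta>"
          by (simp add: C'_def right_diff_distrib sum_subtractf sum_distrib_left sum_distrib_right mult_ac)
        then show ?thesis unfolding d using c(3)[OF 2] by simp
      qed
    qed
  qed
qed

text \<open>Dividing a relation between power series by the largest power of the variable and then
  setting the variable to 0 keeps it nontrivial.\<close>

lemma specialize_relation: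
  fixes c :: "'i \<Rightarrow> 'a::idom fps"
  assumes "finite I" and c: "\<And>i. i \<in> I \<Longrightarrow> c i \<in> coeffs_in S" "i0 \<in> I" "c i0 \<noteq> 0"
  shows "\<exists>d. (\<forall>i\<in>I. d i \<in> S) \<and> (\<exists>i\<in>I. d i \<noteq> 0) \<and>
    (\<forall>g. (\<Sum>i\<in>I. c i * g i) = 0 \<longrightarrow> (\<Sum>i\<in>I. d i * fps_nth (g i) 0) = 0)"
proof -
  define N where "N = (LEAST k. \<exists>i\<in>I. fps_nth (c i) k \<noteq> 0)"
  have ex: "\<exists>k. \<exists>i\<in>I. fps_nth (c i) k \<noteq> 0"
    using c(2,3) by (metis fps_nonzero_nth)
  have N: "\<exists>i\<in>I. fps_nth (c i) N \<noteq> 0"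
    unfolding N_def by (rule LeastI_ex[OF ex])
  have less: "fps_nth (c i) k = 0" if "k < N" "i \<in> I" for i k
    using not_less_Least[of k "\<lambda>k. \<exists>i\<in>I. fps_nth (c i) k \<noteq> 0"] that by (auto simp: N_def)
  have "fps_nth (c i * g) N = fps_nth (c i) N * fps_nth g 0" if "i \<in> I" for i g
  proof -
    have "fps_nth (c i * g) N = (\<Sum>k=0..N. fps_nth (c i) k * fps_nth g (N - k))"
      by (simp add: fps_mult_nth)
    also have "\<dots> = (\<Sum>k\<in>{N}. fps_nth (c i) k * fps_nth g (N - k))"
      by (rule sum.mono_neutral_right) (use less that in auto)
    finally show ?thesis by simp
  qed
  then have "(\<Sum>i\<in>I. fps_nth (c i) N * fps_nth (g i) 0) = fps_nth (\<Sum>i\<in>I. c i * g i) N" for g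
    by (simp add: fps_sum_nth)
  then show ?thesis
    using N c(1) by (intro exI[of _ "\<lambda>i. fps_nth (c i) N"]) (auto simp: coeffs_in_def)
qed

section \<open>Deformed proper hypergeometric functions\<close>

abbreviation q_fun :: ratfun where "q_fun \<equiv> indet ^ 2"

abbreviation q_fls :: "ratfun fls" where "q_fls \<equiv> fls_const q_fun"

lemma indet_nonzero [simp]: "indet \<noteq> 0"
  by (simp add: indet_def)

lemma to_fract_var_power: "to_fract ([:0, 1:] ^ n) = indet ^ n"
  unfolding indet_def by (induction n) (simp_all only: power_0 power_Suc to_fract_mult to_fract_1)

lemma indet_power_neq_1: "n > 0 \<Longrightarrow> indet ^ n \<noteq> 1"
proof
  assume n: "n > 0" and "indet ^ n = 1"
  then have "to_fract ([:0, 1:] ^ n) = (to_fract 1 :: ratfun)"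
    by (simp only: to_fract_var_power to_fract_1)
  then have "([:0, 1:] :: complex poly) ^ n = 1" by (simp only: to_fract_eq_iff)
  then have "degree (([:0, 1:] :: complex poly) ^ n) = 0" by simp
  then show False using n by (simp add: degree_power_eq)
qed

lemma q_powi_neq_1: "a \<noteq> 0 \<Longrightarrow> q_fun powi a \<noteq> 1"
proof -
  assume "a \<noteq> 0"
  have 1: "q_fun ^ n \<noteq> 1" if "n > 0" for n
    using indet_power_neq_1[of "2 * n"] that by (simp add: power_mult)
  show ?thesis
  proof (cases "a > 0")
    case True
    then show ?thesis using 1[of "nat a"] by (simp add: power_int_def)
  next
    case False
    then show ?thesis using \<open>a \<noteq> 0\<close> 1[of "nat (- a)"]
      by (simp add: power_int_def power_inverse)
  qed
qed

definition q_ring :: "ratfun set" where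
  "q_ring = subring_generated {q_fun, inverse q_fun}"

lemma is_subring_q_ring: "is_subring q_ring"
  by (simp add: q_ring_def is_subring_subring_generated)

lemma q_powi_in_q_ring: "q_fun powi i \<in> q_ring"
  by (rule is_subring_powi[OF is_subring_q_ring]) (auto simp: q_ring_def intro: subring_generated.gen)

text \<open>Relations are computed among rational functions in \<open>v\<close>; this is how their
  coefficients become Laurent polynomials in \<open>q\<close> again.\<close>

lemma q_ring_laurent_at:
  assumes "c \<in> q_ring"
  obtains a where "c = laurent_at a q_fun"
proof -
  have u: "q_fun * inverse q_fun = 1" by simp
  have "is_subring (range (\<lambda>a. laurent_at a q_fun))"
    unfolding is_subring_def
  proof (intro conjI ballI)
    show "1 \<in> range (\<lambda>a. laurent_at a q_fun)"
      by (rule range_eqI[of _ _ "Poly_Mapping.single 0 1"]) (simp only: laurent_at_single, simp)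
  next
    fix a b assume "a \<in> range (\<lambda>a. laurent_at a q_fun)" "b \<in> range (\<lambda>a. laurent_at a q_fun)"
    then obtain x y where xy: "a = laurent_at x q_fun" "b = laurent_at y q_fun" by auto
    have "a - b = laurent_at (x + Poly_Mapping.single 0 (- 1) * y) q_fun"
      unfolding laurent_at_add laurent_at_mult[OF u] by (simp add: xy)
    then show "a - b \<in> range (\<lambda>a. laurent_at a q_fun)" by blast
    show "a * b \<in> range (\<lambda>a. laurent_at a q_fun)"
      by (rule range_eqI[of _ _ "x * y"]) (simp add: laurent_at_mult[OF u] xy)
  qed
  moreover have "{q_fun, inverse q_fun} \<subseteq> range (\<lambda>a. laurent_at a q_fun)"
  proof -
    have "laurent_at (Poly_Mapping.single 1 1) q_fun = q_fun"
      "laurent_at (Poly_Mapping.single (- 1) 1) q_fun = inverse q_fun"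
      by (simp_all add: power_int_minus)
    then show ?thesis by (metis empty_subsetI insert_subset range_eqI)
  qed
  ultimately have "c \<in> range (\<lambda>a. laurent_at a q_fun)"
    using subring_generated_subset assms unfolding q_ring_def by blast
  then show ?thesis using that by auto
qed

text \<open>The ring \<open>Z[q, 1/q][[X]]\<close> of admissible coefficients. It is placed inside
  the field of Laurent series because the deformed factorials have poles at \<open>X = 0\<close> for
  negative arguments.\<close>

definition deform_ring :: "ratfun fls set" where
  "deform_ring = fps_to_fls ` coeffs_in q_ring"

lemma is_subring_deform_ring: "is_subring deform_ring"
proof -
  note 1 = is_subring_closed[OF is_subring_coeffs_in[OF is_subring_q_ring]]
  have "1 \<in> deform_ring"
    unfolding deform_ring_def using 1(2) by (intro image_eqI[of _ _ 1]) auto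
  moreover have "a - b \<in> deform_ring" "a * b \<in> deform_ring"
    if ab: "a \<in> deform_ring" "b \<in> deform_ring" for a b
  proof -
    from ab obtain f g where f: "a = fps_to_fls f" "f \<in> coeffs_in q_ring"
      and g: "b = fps_to_fls g" "g \<in> coeffs_in q_ring" by (auto simp: deform_ring_def)
    show "a - b \<in> deform_ring"
      unfolding deform_ring_def using 1(3) f g by (intro image_eqI[of _ _ "f - g"]) auto
    show "a * b \<in> deform_ring"
      unfolding deform_ring_def using 1(6) f g
      by (intro image_eqI[of _ _ "f * g"]) (auto simp: fls_times_fps_to_fls)
  qed
  ultimately show ?thesis by (simp add: is_subring_def)
qed

lemma q_powi_in_deform_ring: "q_fls powi i \<in> deform_ring"
  unfolding deform_ring_def
  by (rule image_eqI[of _ _ "fps_const (q_fun powi i)"])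
    (simp_all add: fls_const_power_int fps_const_in_coeffs_in[OF is_subring_q_ring] q_powi_in_q_ring)

section \<open>Linear forms and Laurent polynomials in the quantities \<open>q^(x v)\<close>\<close>

definition lin :: "'i set \<Rightarrow> ('i \<Rightarrow> int) \<Rightarrow> ('i \<Rightarrow> int) \<Rightarrow> int" where
  "lin V a x = (\<Sum>v\<in>V. a v * x v)"

lemma lin_add: "lin V (\<lambda>v. a v + b v) x = lin V a x + lin V b x"
  by (simp add: lin_def distrib_right sum.distrib)

lemma lin_shift: "lin V a (\<lambda>v. x v + 4 * u v) = lin V a x + 4 * lin V a u"
  by (simp add: lin_def distrib_left sum.distrib sum_distrib_left mult_ac)

lemma lin_scale: "lin V (\<lambda>v. c * a v) x = c * lin V a x"
  by (simp add: lin_def sum_distrib_left mult_ac)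

lemma lin_bound:
  assumes "\<forall>v\<in>V. \<bar>u v\<bar> \<le> L"
  shows "\<bar>lin V a u\<bar> \<le> (\<Sum>v\<in>V. \<bar>a v\<bar>) * L"
proof -
  have "\<bar>lin V a u\<bar> \<le> (\<Sum>v\<in>V. \<bar>a v * u v\<bar>)" unfolding lin_def by (rule sum_abs)
  also have "\<dots> \<le> (\<Sum>v\<in>V. \<bar>a v\<bar> * L)"
    by (rule sum_mono) (use assms in \<open>auto simp: abs_mult intro: mult_left_mono\<close>)
  finally show ?thesis by (simp add: sum_distrib_right)
qed

text \<open>Laurent polynomials in the variables \<open>q^(x v)\<close>, regarded as functions of
  the lattice point \<open>x\<close>. The bound \<open>M\<close> on the degree in each variable is
  carried along because it limits the number of monomials in the dimension count.\<close>

inductive_set laurent_funs :: "'i set \<Rightarrow> int \<Rightarrow> (('i \<Rightarrow> int) \<Rightarrow> ratfun fls) set"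
  for V M where
  monom: "c \<in> deform_ring \<Longrightarrow> (\<forall>v\<in>V. \<bar>b v\<bar> \<le> M) \<Longrightarrow>
    (\<lambda>x. c * q_fls powi lin V b x) \<in> laurent_funs V M"
| add: "f \<in> laurent_funs V M \<Longrightarrow> g \<in> laurent_funs V M \<Longrightarrow> (\<lambda>x. f x + g x) \<in> laurent_funs V M"

lemma laurent_funs_mono:
  assumes "f \<in> laurent_funs V M" "M \<le> M'"
  shows "f \<in> laurent_funs V M'"
  using assms(1) by induction (use assms(2) in \<open>auto intro!: laurent_funs.intros\<close>)

lemma laurent_funs_const:
  assumes "c \<in> deform_ring" "0 \<le> M"
  shows "(\<lambda>_. c) \<in> laurent_funs V M"
  using laurent_funs.monom[of c V "\<lambda>_. 0" M] assms by (simp add: lin_def)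

lemma laurent_funs_mult:
  assumes "f \<in> laurent_funs V M" "g \<in> laurent_funs V M'"
  shows "(\<lambda>x. f x * g x) \<in> laurent_funs V (M + M')"
  using assms(1)
proof induction
  case (monom c b)
  note f = monom
  from assms(2) show ?case
  proof induction
    case (monom c' b')
    have "(\<lambda>x. (c * c') * q_fls powi lin V (\<lambda>v. b v + b' v) x) \<in> laurent_funs V (M + M')"
    proof (rule laurent_funs.monom)
      show "c * c' \<in> deform_ring" using f monom by (simp add: is_subring_mult[OF is_subring_deform_ring])
      show "\<forall>v\<in>V. \<bar>b v + b' v\<bar> \<le> M + M'" using f(2) monom(2) by fastforce
    qed
    then show ?case by (simp add: lin_add power_int_add mult_ac)
  next
    case (add g h)
    from laurent_funs.add[OF add.IH] show ?case by (simp add: distrib_left)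
  qed
next
  case (add f h)
  from laurent_funs.add[OF add.IH] show ?case by (simp add: distrib_right)
qed

lemma laurent_funs_prod:
  assumes "finite S" "0 \<le> M" "\<And>s. s \<in> S \<Longrightarrow> f s \<in> laurent_funs V M"
  shows "(\<lambda>x. \<Prod>s\<in>S. f s x) \<in> laurent_funs V (int (card S) * M)"
  using assms
proof (induction S rule: finite_induct)
  case empty
  then show ?case
    by (simp add: laurent_funs_const is_subring_1[OF is_subring_deform_ring])
next
  case (insert s S)
  have "(\<lambda>x. f s x * (\<Prod>s\<in>S. f s x)) \<in> laurent_funs V (M + int (card S) * M)"
    by (rule laurent_funs_mult) (use insert in auto)
  then show ?case using insert.hyps by (simp add: algebra_simps)
qed

text \<open>Coordinates for the linear algebra: all functions of degree at most \<open>M\<close> are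
  expanded over one finite set of \<open>(2 M + 1)^|V|\<close> exponent vectors.\<close>

lemma laurent_funs_expansion:
  assumes "f \<in> laurent_funs V M" "finite V"
  shows "\<exists>C. (\<forall>b. C b \<in> deform_ring) \<and>
    (\<forall>x. f x = (\<Sum>b\<in>V \<rightarrow>\<^sub>E {-M..M}. C b * q_fls powi lin V b x))"
  using assms(1)
proof induction
  case (monom c b)
  \<comment> \<open>Only the values on \<open>V\<close> matter for the monomial; restricting picks
    its index in the extensional function space.\<close>
  let ?b = "restrict b V"
  have fin: "finite (V \<rightarrow>\<^sub>E {-M..M})" by (rule finite_PiE) (use assms in auto)
  have "b v \<in> {-M..M}" if "v \<in> V" for v using monom(2) that by (auto simp: abs_le_iff)
  then have b: "?b \<in> V \<rightarrow>\<^sub>E {-M..M}" by simp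
  have "lin V b x = lin V ?b x" for x by (simp add: lin_def)
  then have "c * q_fls powi lin V b x
      = (\<Sum>b\<in>V \<rightarrow>\<^sub>E {-M..M}. (if b = ?b then c else 0) * q_fls powi lin V b x)" for x
    using sum.remove[OF fin b, of "\<lambda>b. (if b = ?b then c else 0) * q_fls powi lin V b x"] by simp
  note eq = this
  show ?case
  proof (intro exI[of _ "\<lambda>b. if b = ?b then c else 0"] conjI allI)
    show "(if b' = ?b then c else 0) \<in> deform_ring" for b'
      using monom(1) is_subring_0[OF is_subring_deform_ring] by simp
  qed (rule eq)
next
  case (add f g)
  from add.IH obtain C D where C: "\<forall>b. C b \<in> deform_ring"
      "\<forall>x. f x = (\<Sum>b\<in>V \<rightarrow>\<^sub>E {-M..M}. C b * q_fls powi lin V b x)"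
    and D: "\<forall>b. D b \<in> deform_ring"
      "\<forall>x. g x = (\<Sum>b\<in>V \<rightarrow>\<^sub>E {-M..M}. D b * q_fls powi lin V b x)" by blast
  show ?case
  proof (intro exI[of _ "\<lambda>b. C b + D b"] conjI allI)
    show "C b + D b \<in> deform_ring" for b
      using C(1) D(1) by (simp add: is_subring_add[OF is_subring_deform_ring])
    show "f x + g x = (\<Sum>b\<in>V \<rightarrow>\<^sub>E {-M..M}. (C b + D b) * q_fls powi lin V b x)" for x
      unfolding C(2)[rule_format, of x] D(2)[rule_format, of x]
      by (simp add: distrib_right sum.distrib)
  qed
qed

text \<open>Shifts by multiples of 4 change all occurring exponents of \<open>v\<close> by even numbers, so that only
  powers of \<open>q = v\<^sup>2\<close> are needed to compare a function with its shifts.\<close>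

definition shift_regular :: "'i set \<Rightarrow> (('i \<Rightarrow> int) \<Rightarrow> ratfun fls) \<Rightarrow> bool" where
  "shift_regular V \<Phi> \<longleftrightarrow> (\<exists>c\<ge>0. \<forall>L\<ge>0. \<exists>G. \<forall>u. (\<forall>v\<in>V. \<bar>u v\<bar> \<le> L) \<longrightarrow>
     (\<exists>P\<in>laurent_funs V (c * L). \<forall>x. \<Phi> (\<lambda>v. x v + 4 * u v) = P x * G x))"

lemma shift_regular_mult:
  assumes "shift_regular V \<Phi>" "shift_regular V \<Psi>"
  shows "shift_regular V (\<lambda>x. \<Phi> x * \<Psi> x)"
proof -
  obtain c where c: "c \<ge> 0" "\<And>L. L \<ge> 0 \<Longrightarrow> \<exists>G. \<forall>u. (\<forall>v\<in>V. \<bar>u v\<bar> \<le> L) \<longrightarrow>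
     (\<exists>P\<in>laurent_funs V (c * L). \<forall>x. \<Phi> (\<lambda>v. x v + 4 * u v) = P x * G x)"
    using assms(1) unfolding shift_regular_def by blast
  obtain d where d: "d \<ge> 0" "\<And>L. L \<ge> 0 \<Longrightarrow> \<exists>G. \<forall>u. (\<forall>v\<in>V. \<bar>u v\<bar> \<le> L) \<longrightarrow>
     (\<exists>P\<in>laurent_funs V (d * L). \<forall>x. \<Psi> (\<lambda>v. x v + 4 * u v) = P x * G x)"
    using assms(2) unfolding shift_regular_def by blast
  show ?thesis
    unfolding shift_regular_def
  proof (intro exI[of _ "c + d"] conjI allI impI)
    show "0 \<le> c + d" using c d by simp
    fix L :: int assume L: "0 \<le> L"
    obtain G where G: "\<And>u. (\<forall>v\<in>V. \<bar>u v\<bar> \<le> L) \<Longrightarrow>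
     (\<exists>P\<in>laurent_funs V (c * L). \<forall>x. \<Phi> (\<lambda>v. x v + 4 * u v) = P x * G x)" using c(2)[OF L] by blast
    obtain H where H: "\<And>u. (\<forall>v\<in>V. \<bar>u v\<bar> \<le> L) \<Longrightarrow>
     (\<exists>P\<in>laurent_funs V (d * L). \<forall>x. \<Psi> (\<lambda>v. x v + 4 * u v) = P x * H x)" using d(2)[OF L] by blast
    show "\<exists>G. \<forall>u. (\<forall>v\<in>V. \<bar>u v\<bar> \<le> L) \<longrightarrow> (\<exists>P\<in>laurent_funs V ((c + d) * L).
        \<forall>x. \<Phi> (\<lambda>v. x v + 4 * u v) * \<Psi> (\<lambda>v. x v + 4 * u v) = P x * G x)"
    proof (intro exI[of _ "\<lambda>x. G x * H x"] allI impI)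
      fix u :: "'a \<Rightarrow> int" assume u: "\<forall>v\<in>V. \<bar>u v\<bar> \<le> L"
      obtain P where P: "P \<in> laurent_funs V (c * L)" "\<And>x. \<Phi> (\<lambda>v. x v + 4 * u v) = P x * G x"
        using G[OF u] by blast
      obtain Q where Q: "Q \<in> laurent_funs V (d * L)" "\<And>x. \<Psi> (\<lambda>v. x v + 4 * u v) = Q x * H x"
        using H[OF u] by blast
      show "\<exists>P\<in>laurent_funs V ((c + d) * L).
        \<forall>x. \<Phi> (\<lambda>v. x v + 4 * u v) * \<Psi> (\<lambda>v. x v + 4 * u v) = P x * (G x * H x)"
      proof (intro bexI[of _ "\<lambda>x. P x * Q x"] allI)
        show "(\<lambda>x. P x * Q x) \<in> laurent_funs V ((c + d) * L)"
          using laurent_funs_mult[OF P(1) Q(1)] by (simp only: distrib_right)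
        show "\<Phi> (\<lambda>v. x v + 4 * u v) * \<Psi> (\<lambda>v. x v + 4 * u v) = P x * Q x * (G x * H x)" for x
          unfolding P(2) Q(2) by (simp add: mult_ac)
      qed
    qed
  qed
qed

text \<open>The factors of a deformed \<open>q\<close>-factorial do not vanish, so that it has a well-defined value at
  every integer, negative ones included, where the order of its pole in the deformation variable
  is \<open>k\<close>.\<close>

definition dq_factor :: "nat \<Rightarrow> int \<Rightarrow> ratfun fps" where
  "dq_factor k a = 1 - fps_const (q_fun powi a) * (1 + fps_X ^ k)"

definition dq_fact :: "nat \<Rightarrow> int \<Rightarrow> ratfun fls" where
  "dq_fact k a = (if 0 \<le> a then fps_to_fls (\<Prod>s\<in>{1..a}. dq_factor k s)
     else inverse (fps_to_fls (\<Prod>s\<in>{a + 1..0}. dq_factor k s)))"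

lemma fps_prod_nth_0: "fps_nth (prod f S) 0 = (\<Prod>s\<in>S. fps_nth (f s) 0)"
  by (induction S rule: infinite_finite_induct) simp_all

lemma dq_factor_nth_0: "k > 0 \<Longrightarrow> fps_nth (dq_factor k a) 0 = 1 - q_fun powi a"
  by (simp add: dq_factor_def)

lemma dq_factor_0: "dq_factor k 0 = - (fps_X ^ k)"
  by (simp add: dq_factor_def)

lemma dq_factor_nonzero: "k > 0 \<Longrightarrow> dq_factor k a \<noteq> 0"
proof
  assume "k > 0" and 0: "dq_factor k a = 0"
  then have "a = 0" using dq_factor_nth_0[of k a] q_powi_neq_1[of a] by fastforce
  with 0 show False by (simp add: dq_factor_0)
qed

lemma dq_fact_nonzero: "k > 0 \<Longrightarrow> dq_fact k a \<noteq> 0"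
  by (auto simp: dq_fact_def prod_zero_iff dq_factor_nonzero)

text \<open>This is what the deformation achieves: the recursion continues across 0, since the
  factor at 0 is \<open>- X^k\<close> and can be divided by.\<close>

lemma dq_fact_add_1:
  assumes k: "k > 0"
  shows "dq_fact k (a + 1) = fps_to_fls (dq_factor k (a + 1)) * dq_fact k a"
proof -
  consider "0 \<le> a" | "a = - 1" | "a < - 1" by linarith
  then show ?thesis
  proof cases
    case 1
    then have "{1..a + 1} = insert (a + 1) {1..a}" by auto
    with 1 show ?thesis by (simp add: dq_fact_def fls_times_fps_to_fls)
  next
    case 2
    then show ?thesis using dq_factor_nonzero[OF k, of 0] by (simp add: dq_fact_def)
  next
    case 3
    then have "{a + 1..0} = insert (a + 1) {a + 2..0}" by auto
    with 3 show ?thesis using dq_factor_nonzero[OF k, of "a + 1"]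
      by (simp add: dq_fact_def fls_times_fps_to_fls add.commute)
  qed
qed

lemma dq_fact_add:
  assumes k: "k > 0"
  shows "dq_fact k (a + int n) = (\<Prod>s=1..n. fps_to_fls (dq_factor k (a + int s))) * dq_fact k a"
proof (induction n)
  case (Suc n)
  have "dq_fact k (a + int (Suc n)) = dq_fact k ((a + int n) + 1)" by (simp add: add_ac)
  also have "\<dots> = fps_to_fls (dq_factor k (a + int (Suc n))) * dq_fact k (a + int n)"
    unfolding dq_fact_add_1[OF k] by (simp add: add_ac)
  finally show ?case by (simp add: Suc mult_ac)
qed simp

lemma dq_fact_nonneg:
  assumes k: "k > 0" and a: "0 \<le> a"
  shows "\<exists>f. dq_fact k a = fps_to_fls f \<and> fps_nth f 0 = (\<Prod>s\<in>{1..a}. 1 - q_fun powi s)"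
proof (intro exI conjI)
  show "dq_fact k a = fps_to_fls (\<Prod>s\<in>{1..a}. dq_factor k s)" using a by (simp add: dq_fact_def)
  show "fps_nth (\<Prod>s\<in>{1..a}. dq_factor k s) 0 = (\<Prod>s\<in>{1..a}. 1 - q_fun powi s)"
    by (simp add: fps_prod_nth_0 dq_factor_nth_0[OF k])
qed

lemma q_poch_nonzero: "(\<Prod>s\<in>{1..a}. 1 - q_fun powi s) \<noteq> 0"
  using q_powi_neq_1 by (fastforce simp: prod_zero_iff)

text \<open>Among the factors in the denominator only the one at 0 vanishes for
  \<open>X = 0\<close>, and it equals \<open>- X^k\<close>. The others have nonzero constant terms
  because \<open>q\<close> is not a root of unity. So the order of the pole does not depend on how
  negative \<open>a\<close> is.\<close>

lemma dq_fact_neg: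
  assumes k: "k > 0" and a: "a < 0"
  shows "\<exists>f. dq_fact k a = inverse (fps_to_fls (fps_X ^ k * f)) \<and> fps_nth f 0 \<noteq> 0"
proof (intro exI conjI)
  have "{a + 1..0} = insert 0 {a + 1..-1}" using a by auto
  then show "dq_fact k a = inverse (fps_to_fls (fps_X ^ k * - (\<Prod>s\<in>{a + 1..-1}. dq_factor k s)))"
    using a by (simp add: dq_fact_def dq_factor_0)
  have "(\<Prod>s\<in>{a + 1..-1}. 1 - q_fun powi s) \<noteq> 0"
    using q_powi_neq_1 by (fastforce simp: prod_zero_iff)
  then show "fps_nth (- (\<Prod>s\<in>{a + 1..-1}. dq_factor k s)) 0 \<noteq> 0"
    by (simp add: fps_prod_nth_0 dq_factor_nth_0[OF k])
qed

section \<open>Affine arguments and the comparison of deformed factorials with their shifts\<close>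

definition is_affine :: "'i set \<Rightarrow> (('i \<Rightarrow> int) \<Rightarrow> int) \<Rightarrow> bool" where
  "is_affine V l \<longleftrightarrow> (\<exists>a b. \<forall>x. l x = lin V a x + b)"

lemma is_affine_const: "is_affine V (\<lambda>_. b)"
  unfolding is_affine_def by (rule exI[of _ "\<lambda>_. 0"], rule exI[of _ b]) (simp add: lin_def)

lemma is_affine_var: "finite V \<Longrightarrow> v \<in> V \<Longrightarrow> is_affine V (\<lambda>x. x v)"
  unfolding is_affine_def
  by (rule exI[of _ "\<lambda>w. if w = v then 1 else 0"], rule exI[of _ 0])
    (simp add: lin_def if_distrib[of "\<lambda>t. t * _"] sum.delta cong: if_cong)

lemma is_affine_add: "is_affine V l \<Longrightarrow> is_affine V m \<Longrightarrow> is_affine V (\<lambda>x. l x + m x)"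
proof -
  assume "is_affine V l" "is_affine V m"
  then obtain a b a' b' where "\<And>x. l x = lin V a x + b" "\<And>x. m x = lin V a' x + b'"
    unfolding is_affine_def by metis
  then show ?thesis
    unfolding is_affine_def by (intro exI[of _ "\<lambda>v. a v + a' v"] exI[of _ "b + b'"]) (simp add: lin_add)
qed

lemma is_affine_scale: "is_affine V l \<Longrightarrow> is_affine V (\<lambda>x. c * l x)"
proof -
  assume "is_affine V l"
  then obtain a b where "\<And>x. l x = lin V a x + b" unfolding is_affine_def by metis
  then show ?thesis
    unfolding is_affine_def
    by (intro exI[of _ "\<lambda>v. c * a v"] exI[of _ "c * b"]) (simp add: lin_scale distrib_left)
qed

lemma is_affine_uminus: "is_affine V l \<Longrightarrow> is_affine V (\<lambda>x. - l x)"
  using is_affine_scale[of V l "- 1"] by simp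

lemma is_affine_diff: "is_affine V l \<Longrightarrow> is_affine V m \<Longrightarrow> is_affine V (\<lambda>x. l x - m x)"
  using is_affine_add[of V l "\<lambda>x. - m x"] is_affine_uminus by force

lemma dq_factor_in_laurent_funs:
  assumes l: "\<And>x. l x = lin V a x + b" and V: "finite V"
  shows "(\<lambda>x. fps_to_fls (dq_factor k (l x))) \<in> laurent_funs V (\<Sum>v\<in>V. \<bar>a v\<bar>)"
proof -
  let ?Y = "fps_to_fls (1 + fps_X ^ k) :: ratfun fls"
  have "1 + fps_X ^ k \<in> coeffs_in q_ring"
    by (rule is_subring_add is_subring_power is_subring_1 is_subring_coeffs_in is_subring_q_ring
        fps_X_in_coeffs_in)+
  then have Y: "?Y \<in> deform_ring" unfolding deform_ring_def by (rule imageI)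
  have "- (q_fls powi b * ?Y) \<in> deform_ring"
    by (intro is_subring_uminus is_subring_mult is_subring_deform_ring Y q_powi_in_deform_ring)
  moreover have "\<forall>v\<in>V. \<bar>a v\<bar> \<le> (\<Sum>v\<in>V. \<bar>a v\<bar>)"
    using V by (auto intro: member_le_sum)
  ultimately have "(\<lambda>x. - (q_fls powi b * ?Y) * q_fls powi lin V a x) \<in> laurent_funs V (\<Sum>v\<in>V. \<bar>a v\<bar>)"
    by (rule laurent_funs.monom)
  moreover have "(\<lambda>_. 1) \<in> laurent_funs V (\<Sum>v\<in>V. \<bar>a v\<bar>)"
    by (rule laurent_funs_const) (simp_all add: is_subring_1[OF is_subring_deform_ring] sum_nonneg)
  ultimately have "(\<lambda>x. 1 + - (q_fls powi b * ?Y) * q_fls powi lin V a x)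
      \<in> laurent_funs V (\<Sum>v\<in>V. \<bar>a v\<bar>)"
    by (intro laurent_funs.add)
  moreover have "fps_to_fls (dq_factor k (l x)) = 1 + - (q_fls powi b * ?Y) * q_fls powi lin V a x" for x
    unfolding dq_factor_def l
    by (simp add: fls_times_fps_to_fls power_int_add mult_ac del: fps_to_fls_plus
        flip: fls_const_power_int)
  ultimately show ?thesis by simp
qed

lemma prod_dq_factor_in_laurent_funs:
  assumes l: "\<And>x. l x = lin V a x + b" and V: "finite V"
  shows "(\<lambda>x. \<Prod>s=1..n. fps_to_fls (dq_factor k (l x + int s)))
    \<in> laurent_funs V (int n * (\<Sum>v\<in>V. \<bar>a v\<bar>))"
proof -
  have "(\<lambda>x. fps_to_fls (dq_factor k (l x + int s))) \<in> laurent_funs V (\<Sum>v\<in>V. \<bar>a v\<bar>)" for s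
    by (rule dq_factor_in_laurent_funs[where b = "b + int s"]) (use l V in auto)
  then show ?thesis
    using laurent_funs_prod[of "{1..n}" "\<Sum>v\<in>V. \<bar>a v\<bar>" "\<lambda>s x. fps_to_fls (dq_factor k (l x + int s))" V]
    by (simp add: sum_nonneg)
qed

text \<open>For given \<open>L\<close>, the common function is the value at the far end of the range
  of arguments: at \<open>l x - W\<close> for the factorial, at \<open>l x + W\<close> for its
  inverse, where \<open>W = 4 A L\<close>. Every shift is then reached by multiplying with factors
  and never by dividing. At most \<open>2 W = 8 A L\<close> factors occur, each of degree at most
  \<open>A\<close>, which explains the constant \<open>8 A^2\<close>.\<close>

lemma shift_regular_dq_fact:
  assumes k: "k > 0" and l: "is_affine V l" and V: "finite V"
  shows "shift_regular V (\<lambda>x. dq_fact k (l x))"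
    and "shift_regular V (\<lambda>x. inverse (dq_fact k (l x)))"
proof -
  obtain a b where ab: "\<And>x. l x = lin V a x + b" using l unfolding is_affine_def by metis
  define A where "A = (\<Sum>v\<in>V. \<bar>a v\<bar>)"
  have A: "A \<ge> 0" by (simp add: A_def sum_nonneg)
  have shift: "l (\<lambda>v. x v + 4 * u v) = l x + 4 * lin V a u" for x u
    by (simp add: ab lin_shift)
  have w: "\<bar>4 * lin V a u\<bar> \<le> 4 * A * L" if "\<forall>v\<in>V. \<bar>u v\<bar> \<le> L" for u L
    using lin_bound[OF that, of a] by (simp add: A_def)
  have inv: "inverse d = p * inverse e" if "e = p * d" "e \<noteq> 0" for d e p :: "ratfun fls"
    using that by (auto simp: field_simps)
  have bound: "int (nat n) * A \<le> 8 * A * A * L" if "n \<le> 8 * A * L" "L \<ge> 0" for n L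
  proof -
    have "int (nat n) \<le> 8 * A * L" using that A by simp
    from mult_right_mono[OF this A] show ?thesis by (simp add: mult_ac)
  qed
  show "shift_regular V (\<lambda>x. dq_fact k (l x))"
    unfolding shift_regular_def
  proof (intro exI[of _ "8 * A * A"] conjI allI impI)
    fix L :: int assume L: "L \<ge> 0"
    let ?W = "4 * A * L"
    show "\<exists>G. \<forall>u. (\<forall>v\<in>V. \<bar>u v\<bar> \<le> L) \<longrightarrow> (\<exists>P\<in>laurent_funs V (8 * A * A * L).
        \<forall>x. dq_fact k (l (\<lambda>v. x v + 4 * u v)) = P x * G x)"
    proof (intro exI[of _ "\<lambda>x. dq_fact k (l x - ?W)"] allI impI)
      fix u assume u: "\<forall>v\<in>V. \<bar>u v\<bar> \<le> L"
      let ?n = "nat (4 * lin V a u + ?W)"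
      have n: "int ?n = 4 * lin V a u + ?W" using w[OF u] by (simp add: abs_le_iff)
      have eq: "dq_fact k (l (\<lambda>v. x v + 4 * u v))
          = (\<Prod>s=1..?n. fps_to_fls (dq_factor k (l x - ?W + int s))) * dq_fact k (l x - ?W)" for x
      proof -
        have "l (\<lambda>v. x v + 4 * u v) = l x - ?W + int ?n" by (simp only: shift n)
        then show ?thesis by (simp only: dq_fact_add[OF k])
      qed
      have mem: "(\<lambda>x. \<Prod>s=1..?n. fps_to_fls (dq_factor k (l x - ?W + int s)))
          \<in> laurent_funs V (8 * A * A * L)"
      proof (rule laurent_funs_mono[OF prod_dq_factor_in_laurent_funs[where V = V and a = a and b = "b - ?W", folded A_def]])
        show "int ?n * A \<le> 8 * A * A * L"
          by (rule bound) (use w[OF u] L in \<open>auto simp: abs_le_iff\<close>)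
      qed (use ab V in \<open>auto simp: A_def\<close>)
      show "\<exists>P\<in>laurent_funs V (8 * A * A * L).
        \<forall>x. dq_fact k (l (\<lambda>v. x v + 4 * u v)) = P x * dq_fact k (l x - ?W)"
        by (rule bexI[OF _ mem]) (intro allI eq)
    qed
  qed (use A in auto)
  show "shift_regular V (\<lambda>x. inverse (dq_fact k (l x)))"
    unfolding shift_regular_def
  proof (intro exI[of _ "8 * A * A"] conjI allI impI)
    fix L :: int assume L: "L \<ge> 0"
    let ?W = "4 * A * L"
    show "\<exists>G. \<forall>u. (\<forall>v\<in>V. \<bar>u v\<bar> \<le> L) \<longrightarrow> (\<exists>P\<in>laurent_funs V (8 * A * A * L).
        \<forall>x. inverse (dq_fact k (l (\<lambda>v. x v + 4 * u v))) = P x * G x)"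
    proof (intro exI[of _ "\<lambda>x. inverse (dq_fact k (l x + ?W))"] allI impI)
      fix u assume u: "\<forall>v\<in>V. \<bar>u v\<bar> \<le> L"
      let ?w = "4 * lin V a u"
      let ?n = "nat (?W - ?w)"
      have n: "int ?n = ?W - ?w" using w[OF u] by (simp add: abs_le_iff)
      have eq: "inverse (dq_fact k (l (\<lambda>v. x v + 4 * u v)))
          = (\<Prod>s=1..?n. fps_to_fls (dq_factor k (l x + ?w + int s))) * inverse (dq_fact k (l x + ?W))" for x
      proof -
        have "dq_fact k (l x + ?W)
          = (\<Prod>s=1..?n. fps_to_fls (dq_factor k (l x + ?w + int s))) * dq_fact k (l x + ?w)"
        proof -
          have "l x + ?W = l x + ?w + int ?n" by (simp only: n)
          then show ?thesis by (simp only: dq_fact_add[OF k])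
        qed
        moreover have "dq_fact k (l x + ?W) \<noteq> 0" "dq_fact k (l x + ?w) \<noteq> 0"
          by (rule dq_fact_nonzero[OF k])+
        ultimately show ?thesis unfolding shift by (intro inv) auto
      qed
      have mem: "(\<lambda>x. \<Prod>s=1..?n. fps_to_fls (dq_factor k (l x + ?w + int s)))
          \<in> laurent_funs V (8 * A * A * L)"
      proof (rule laurent_funs_mono[OF prod_dq_factor_in_laurent_funs[where V = V and a = a and b = "b + ?w", folded A_def]])
        show "int ?n * A \<le> 8 * A * A * L"
          by (rule bound) (use w[OF u] L in \<open>auto simp: abs_le_iff\<close>)
      qed (use ab V in \<open>auto simp: A_def\<close>)
      show "\<exists>P\<in>laurent_funs V (8 * A * A * L).
        \<forall>x. inverse (dq_fact k (l (\<lambda>v. x v + 4 * u v))) = P x * inverse (dq_fact k (l x + ?W))"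
        by (rule bexI[OF _ mem]) (intro allI eq)
    qed
  qed (use A in auto)
qed

text \<open>The analogue of a proper hypergeometric term in the sense of Wilf and Zeilberger, except
  that \<open>f\<close> is only the limit at \<open>X = 0\<close> of such a term. This admits
  functions that vanish on parts of the lattice. The deformation is not part of the data, so
  different factors may use different ones.\<close>

definition proper :: "'i set \<Rightarrow> (('i \<Rightarrow> int) \<Rightarrow> ratfun) \<Rightarrow> bool" where
  "proper V f \<longleftrightarrow> (\<exists>\<Phi>. shift_regular V \<Phi> \<and>
     (\<forall>x. \<exists>g. \<Phi> x = fps_to_fls g \<and> fps_nth g 0 = f x))"

lemma q_powi_eq: "q_fun powi i = indet powi (2 * i)"
  by (simp add: power_int_mult)

lemma proper_mult:
  assumes "proper V f" "proper V g"
  shows "proper V (\<lambda>x. f x * g x)"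
proof -
  obtain \<Phi> where \<Phi>: "shift_regular V \<Phi>" "\<And>x. \<exists>h. \<Phi> x = fps_to_fls h \<and> fps_nth h 0 = f x"
    using assms(1) unfolding proper_def by blast
  obtain \<Psi> where \<Psi>: "shift_regular V \<Psi>" "\<And>x. \<exists>h. \<Psi> x = fps_to_fls h \<and> fps_nth h 0 = g x"
    using assms(2) unfolding proper_def by blast
  show ?thesis
    unfolding proper_def
  proof (intro exI[of _ "\<lambda>x. \<Phi> x * \<Psi> x"] conjI allI)
    show "shift_regular V (\<lambda>x. \<Phi> x * \<Psi> x)" using \<Phi>(1) \<Psi>(1) by (rule shift_regular_mult)
    fix x
    obtain h k where "\<Phi> x = fps_to_fls h" "fps_nth h 0 = f x" "\<Psi> x = fps_to_fls k" "fps_nth k 0 = g x"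
      using \<Phi>(2)[of x] \<Psi>(2)[of x] by blast
    then show "\<exists>h. \<Phi> x * \<Psi> x = fps_to_fls h \<and> fps_nth h 0 = f x * g x"
      by (intro exI[of _ "h * k"]) (simp add: fls_times_fps_to_fls)
  qed
qed

text \<open>The condition is made for quadratic exponents: the change of \<open>e\<close> under a
  shift is affine in \<open>x\<close>, with coefficients growing linearly in the size of the shift.
  The factor 2 turns powers of \<open>v\<close> into powers of \<open>q\<close>, and the power of
  \<open>v\<close> itself serves as the common function.\<close>

lemma proper_indet_powi:
  fixes e :: "('i \<Rightarrow> int) \<Rightarrow> int"
  assumes c: "c \<ge> 0"
    and e: "\<And>u L. L \<ge> 0 \<Longrightarrow> \<forall>v\<in>V. \<bar>u v\<bar> \<le> L \<Longrightarrow> \<exists>a b. (\<forall>v\<in>V. \<bar>a v\<bar> \<le> c * L) \<and>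
      (\<forall>x. e (\<lambda>v. x v + 4 * u v) = e x + 2 * (lin V a x + b))"
  shows "proper V (\<lambda>x. indet powi e x)"
  unfolding proper_def
proof (intro exI[of _ "\<lambda>x. fls_const (indet powi e x)"] conjI allI)
  show "shift_regular V (\<lambda>x. fls_const (indet powi e x))"
    unfolding shift_regular_def
  proof (intro exI[of _ c] conjI allI impI)
    fix L :: int assume L: "L \<ge> 0"
    show "\<exists>G. \<forall>u. (\<forall>v\<in>V. \<bar>u v\<bar> \<le> L) \<longrightarrow> (\<exists>P\<in>laurent_funs V (c * L).
        \<forall>x. fls_const (indet powi e (\<lambda>v. x v + 4 * u v)) = P x * G x)"
    proof (intro exI[of _ "\<lambda>x. fls_const (indet powi e x)"] allI impI)
      fix u assume "\<forall>v\<in>V. \<bar>u v\<bar> \<le> L"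
      then obtain a b where a: "\<forall>v\<in>V. \<bar>a v\<bar> \<le> c * L"
        and ab: "\<And>x. e (\<lambda>v. x v + 4 * u v) = e x + 2 * (lin V a x + b)"
        using e[OF L] by blast
      have "(\<lambda>x. q_fls powi b * q_fls powi lin V a x) \<in> laurent_funs V (c * L)"
        by (rule laurent_funs.monom[OF q_powi_in_deform_ring a])
      moreover have "fls_const (indet powi e (\<lambda>v. x v + 4 * u v))
          = q_fls powi b * q_fls powi lin V a x * fls_const (indet powi e x)" for x
      proof -
        have "indet powi e (\<lambda>v. x v + 4 * u v) = q_fun powi b * q_fun powi lin V a x * indet powi e x"
          unfolding ab q_powi_eq by (simp add: power_int_add distrib_left mult_ac)
        then show ?thesis
          by (simp only: fls_const_power_int[symmetric] fls_const_mult_const)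
      qed
      ultimately show "\<exists>P\<in>laurent_funs V (c * L).
        \<forall>x. fls_const (indet powi e (\<lambda>v. x v + 4 * u v)) = P x * fls_const (indet powi e x)"
        by (intro bexI[where x = "\<lambda>x. q_fls powi b * q_fls powi lin V a x"] allI)
    qed
  qed (use c in auto)
  show "\<exists>g. fls_const (indet powi e x) = fps_to_fls g \<and> fps_nth g 0 = indet powi e x" for x
    by (rule exI[of _ "fps_const (indet powi e x)"]) simp
qed

lemma proper_indet_powi_mult:
  assumes l: "is_affine V l" and m: "is_affine V m" and V: "finite V"
  shows "proper V (\<lambda>x. indet powi (l x * m x))"
proof -
  obtain a b where l: "\<And>x. l x = lin V a x + b" using l unfolding is_affine_def by blast
  obtain a' b' where m: "\<And>x. m x = lin V a' x + b'" using m unfolding is_affine_def by blast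
  define A where "A = (\<Sum>v\<in>V. \<bar>a v\<bar>)"
  define A' where "A' = (\<Sum>v\<in>V. \<bar>a' v\<bar>)"
  have A: "A \<ge> 0" "\<And>v. v \<in> V \<Longrightarrow> \<bar>a v\<bar> \<le> A"
    unfolding A_def using V by (auto intro: sum_nonneg member_le_sum)
  have A': "A' \<ge> 0" "\<And>v. v \<in> V \<Longrightarrow> \<bar>a' v\<bar> \<le> A'"
    unfolding A'_def using V by (auto intro: sum_nonneg member_le_sum)
  show ?thesis
  proof (rule proper_indet_powi[of "4 * (A * A')"])
    show "4 * (A * A') \<ge> 0" using A A' by simp
    fix u :: "'a \<Rightarrow> int" and L :: int assume L: "L \<ge> 0" and u: "\<forall>v\<in>V. \<bar>u v\<bar> \<le> L"
    let ?w = "lin V a u" and ?w' = "lin V a' u"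
    have w: "\<bar>?w\<bar> \<le> A * L" "\<bar>?w'\<bar> \<le> A' * L"
      using lin_bound[OF u] by (auto simp: A_def A'_def)
    \<comment> \<open>From \<open>(l + 4 w) (m + 4 w') - l m = 4 w m + 4 w' l + 16 w w'\<close>,
      divided by 2. The coefficients are bounded by \<open>2 A L A' + 2 A' L A\<close>, whence the
      constant \<open>4 A A'\<close>.\<close>
    let ?a = "\<lambda>v. (2 * ?w) * a' v + (2 * ?w') * a v"
    let ?b = "2 * (?w * b' + ?w' * b) + 8 * ?w * ?w'"
    show "\<exists>a b. (\<forall>v\<in>V. \<bar>a v\<bar> \<le> 4 * (A * A') * L) \<and>
      (\<forall>x. l (\<lambda>v. x v + 4 * u v) * m (\<lambda>v. x v + 4 * u v) = l x * m x + 2 * (lin V a x + b))"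
    proof (intro exI[of _ ?a] exI[of _ ?b] conjI ballI allI)
      fix v assume v: "v \<in> V"
      have "\<bar>?w\<bar> * \<bar>a' v\<bar> \<le> (A * L) * A'"
        by (rule mult_mono) (use w A'(2)[OF v] A(1) L in auto)
      moreover have "\<bar>?w'\<bar> * \<bar>a v\<bar> \<le> (A' * L) * A"
        by (rule mult_mono) (use w A(2)[OF v] A'(1) L in auto)
      moreover have "\<bar>?a v\<bar> \<le> 2 * (\<bar>?w\<bar> * \<bar>a' v\<bar>) + 2 * (\<bar>?w'\<bar> * \<bar>a v\<bar>)"
        using abs_triangle_ineq[of "(2 * ?w) * a' v" "(2 * ?w') * a v"] by (simp add: abs_mult)
      ultimately show "\<bar>?a v\<bar> \<le> 4 * (A * A') * L" by (simp add: algebra_simps)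
    next
      fix x
      show "l (\<lambda>v. x v + 4 * u v) * m (\<lambda>v. x v + 4 * u v) = l x * m x + 2 * (lin V ?a x + ?b)"
        unfolding l m lin_shift lin_add lin_scale by (simp add: algebra_simps)
    qed
  qed
qed

lemma proper_indet_powi_affine:
  assumes "is_affine V l" "finite V"
  shows "proper V (\<lambda>x. indet powi (l x))"
  using proper_indet_powi_mult[OF assms(1) is_affine_const[of V 1] assms(2)] by simp

text \<open>Triangular numbers dictate the step 4 of the shifts. Replacing \<open>l\<close> by
  \<open>l + 4 w\<close> changes \<open>l (l + 1) / 2\<close> by the even number
  \<open>4 w l + 8 w^2 + 2 w\<close>, whereas \<open>l + 2 w\<close> would give
  \<open>2 w l + 2 w^2 + w\<close>, which can be odd.\<close>

lemma proper_indet_powi_triangle: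
  assumes l: "is_affine V l" and V: "finite V"
  shows "proper V (\<lambda>x. indet powi (l x * (l x + 1) div 2))"
proof -
  obtain a b where l: "\<And>x. l x = lin V a x + b" using l unfolding is_affine_def by blast
  define A where "A = (\<Sum>v\<in>V. \<bar>a v\<bar>)"
  have A: "A \<ge> 0" "\<And>v. v \<in> V \<Longrightarrow> \<bar>a v\<bar> \<le> A"
    unfolding A_def using V by (auto intro: sum_nonneg member_le_sum)
  show ?thesis
  proof (rule proper_indet_powi[of "2 * (A * A)"])
    show "2 * (A * A) \<ge> 0" using A by simp
    fix u :: "'a \<Rightarrow> int" and L :: int assume L: "L \<ge> 0" and u: "\<forall>v\<in>V. \<bar>u v\<bar> \<le> L"
    let ?w = "lin V a u"
    have w: "\<bar>?w\<bar> \<le> A * L" using lin_bound[OF u] by (auto simp: A_def)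
    let ?a = "\<lambda>v. (2 * ?w) * a v"
    let ?b = "2 * ?w * b + 4 * ?w * ?w + ?w"
    show "\<exists>a b. (\<forall>v\<in>V. \<bar>a v\<bar> \<le> 2 * (A * A) * L) \<and>
      (\<forall>x. l (\<lambda>v. x v + 4 * u v) * (l (\<lambda>v. x v + 4 * u v) + 1) div 2
         = l x * (l x + 1) div 2 + 2 * (lin V a x + b))"
    proof (intro exI[of _ ?a] exI[of _ ?b] conjI ballI allI)
      fix v assume v: "v \<in> V"
      have "\<bar>?w\<bar> * \<bar>a v\<bar> \<le> (A * L) * A"
        by (rule mult_mono) (use w A(2)[OF v] A(1) L in auto)
      then show "\<bar>?a v\<bar> \<le> 2 * (A * A) * L" by (simp add: abs_mult algebra_simps)
    next
      fix x
      have "l (\<lambda>v. x v + 4 * u v) * (l (\<lambda>v. x v + 4 * u v) + 1)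
        = l x * (l x + 1) + (2 * (lin V ?a x + ?b)) * 2"
        unfolding l lin_shift lin_scale by (simp add: algebra_simps)
      then show "l (\<lambda>v. x v + 4 * u v) * (l (\<lambda>v. x v + 4 * u v) + 1) div 2
         = l x * (l x + 1) div 2 + 2 * (lin V ?a x + ?b)" by simp
    qed
  qed
qed

text \<open>Shifts by multiples of 4 preserve the parity of an affine form with integral
  coefficients, so the comparison factor is 1.\<close>

lemma proper_sign:
  assumes l: "is_affine V l"
  shows "proper V (\<lambda>x. if even (l x) then 1 else - 1)"
  unfolding proper_def
proof (intro exI[of _ "\<lambda>x. if even (l x) then 1 else - 1"] conjI allI)
  obtain a b where l: "\<And>x. l x = lin V a x + b" using l unfolding is_affine_def by blast
  show "shift_regular V (\<lambda>x. if even (l x) then 1 else - 1)"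
    unfolding shift_regular_def
  proof (intro exI[of _ 0] conjI allI impI exI[of _ "\<lambda>x. if even (l x) then 1 else - 1"])
    fix L :: int and u :: "'a \<Rightarrow> int"
    show "\<exists>P\<in>laurent_funs V (0 * L). \<forall>x. (if even (l (\<lambda>v. x v + 4 * u v)) then 1 else - 1)
      = P x * (if even (l x) then 1 else - 1)"
      by (rule bexI[of _ "\<lambda>_. 1"])
        (auto simp: l lin_shift intro: laurent_funs_const is_subring_1[OF is_subring_deform_ring])
  qed simp
  show "\<exists>g. (if even (l x) then 1 else - 1) = fps_to_fls g \<and> fps_nth g 0 = (if even (l x) then 1 else - 1)"
    for x
    by (rule exI[of _ "if even (l x) then 1 else - 1"]) simp
qed

text \<open>The Pochhammer symbol \<open>(q; q)_a\<close>. For negative \<open>a\<close> the product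
  is empty and the value is 1, so cut-offs have to be written out.\<close>

definition q_fact :: "int \<Rightarrow> ratfun" where
  "q_fact a = (\<Prod>s\<in>{1..a}. 1 - q_fun powi s)"

lemma q_fact_nonzero [simp]: "q_fact a \<noteq> 0"
  unfolding q_fact_def by (rule q_poch_nonzero)

lemma inverse_fps_to_fls_unit:
  fixes f :: "ratfun fps"
  shows "fps_nth f 0 \<noteq> 0 \<Longrightarrow> inverse (fps_to_fls f) = fps_to_fls (inverse f)"
  by (rule fls_inverse_fps_to_fls) (simp add: subdegree_eq_0)

text \<open>At negative integers the order in the deformation variable is \<open>- 2 + 3\<close> for the first function
  below and 1 for the second one; this is what cuts off their limits.\<close>

lemma proper_q_fact:
  assumes l: "is_affine V l" and V: "finite V"
  shows "proper V (\<lambda>x. if 0 \<le> l x then q_fact (l x) else 0)"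
    and "proper V (\<lambda>x. if 0 \<le> l x then inverse (q_fact (l x)) else 0)"
proof -
  have cube: "inverse y * inverse y * y ^ 3 = y" if "y \<noteq> 0" for y :: "ratfun fls"
    using that by (simp add: power3_eq_cube field_simps)
  show "proper V (\<lambda>x. if 0 \<le> l x then q_fact (l x) else 0)"
    unfolding proper_def
  \<comment> \<open>At nonnegative arguments all three factors have constant term
    \<open>q_fact (l x)\<close>, so two of them over the third give \<open>q_fact (l x)\<close>
    again.\<close>
  proof (intro exI[of _ "\<lambda>x. dq_fact 1 (l x) * dq_fact 1 (l x) * inverse (dq_fact 3 (l x))"] conjI allI)
    show "shift_regular V (\<lambda>x. dq_fact 1 (l x) * dq_fact 1 (l x) * inverse (dq_fact 3 (l x)))"
      by (intro shift_regular_mult shift_regular_dq_fact l V) auto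
    fix x
    show "\<exists>g. dq_fact 1 (l x) * dq_fact 1 (l x) * inverse (dq_fact 3 (l x)) = fps_to_fls g \<and>
      fps_nth g 0 = (if 0 \<le> l x then q_fact (l x) else 0)"
    proof (cases "0 \<le> l x")
      case True
      obtain f where f: "dq_fact 1 (l x) = fps_to_fls f" "fps_nth f 0 = q_fact (l x)"
        using dq_fact_nonneg[of 1 "l x"] True by (auto simp: q_fact_def)
      obtain g where g: "dq_fact 3 (l x) = fps_to_fls g" "fps_nth g 0 = q_fact (l x)"
        using dq_fact_nonneg[of 3 "l x"] True by (auto simp: q_fact_def)
      have "inverse (dq_fact 3 (l x)) = fps_to_fls (inverse g)"
        unfolding g(1) by (rule inverse_fps_to_fls_unit) (simp add: g(2))
      then show ?thesis
        using True f g by (intro exI[of _ "f * f * inverse g"]) (simp add: fls_times_fps_to_fls)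
    next
      case False
      obtain f where f: "dq_fact 1 (l x) = inverse (fps_to_fls (fps_X ^ 1 * f))" "fps_nth f 0 \<noteq> 0"
        using dq_fact_neg[of 1 "l x"] False by auto
      obtain g where g: "dq_fact 3 (l x) = inverse (fps_to_fls (fps_X ^ 3 * g))" "fps_nth g 0 \<noteq> 0"
        using dq_fact_neg[of 3 "l x"] False by auto
      let ?X = "fps_to_fls fps_X :: ratfun fls"
      have f': "inverse (fps_to_fls f) = fps_to_fls (inverse f)"
        by (rule inverse_fps_to_fls_unit) (rule f(2))
      have X: "?X \<noteq> 0" by simp
      have "dq_fact 1 (l x) * dq_fact 1 (l x) * inverse (dq_fact 3 (l x))
        = inverse ?X * inverse ?X * ?X ^ 3 * inverse (fps_to_fls f) * inverse (fps_to_fls f) * fps_to_fls g"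
        unfolding f(1) g(1) by (simp only: fls_times_fps_to_fls fps_to_fls_power
            inverse_mult_distrib inverse_inverse_eq power_one_right mult_ac)
      also have "inverse ?X * inverse ?X * ?X ^ 3 = ?X"
        by (rule cube[OF X])
      finally show ?thesis
        unfolding f' using False
        by (intro exI[of _ "fps_X * inverse f * inverse f * g"])
          (simp only: fls_times_fps_to_fls, simp)
    qed
  qed
  show "proper V (\<lambda>x. if 0 \<le> l x then inverse (q_fact (l x)) else 0)"
    unfolding proper_def
  proof (intro exI[of _ "\<lambda>x. inverse (dq_fact 1 (l x))"] conjI allI)
    show "shift_regular V (\<lambda>x. inverse (dq_fact 1 (l x)))"
      by (intro shift_regular_dq_fact l V) auto
    fix x
    show "\<exists>g. inverse (dq_fact 1 (l x)) = fps_to_fls g \<and>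
      fps_nth g 0 = (if 0 \<le> l x then inverse (q_fact (l x)) else 0)"
    proof (cases "0 \<le> l x")
      case True
      obtain f where f: "dq_fact 1 (l x) = fps_to_fls f" "fps_nth f 0 = q_fact (l x)"
        using dq_fact_nonneg[of 1 "l x"] True by (auto simp: q_fact_def)
      have "inverse (dq_fact 1 (l x)) = fps_to_fls (inverse f)"
        unfolding f(1) by (rule inverse_fps_to_fls_unit) (simp add: f(2))
      then show ?thesis
        using True f by (intro exI[of _ "inverse f"]) simp
    next
      case False
      obtain f where f: "dq_fact 1 (l x) = inverse (fps_to_fls (fps_X ^ 1 * f))"
        using dq_fact_neg[of 1 "l x"] False by auto
      show ?thesis
        unfolding f using False by (intro exI[of _ "fps_X ^ 1 * f"]) simp
    qed
  qed
qed

lemma proper_prod: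
  assumes "finite S" "\<And>s. s \<in> S \<Longrightarrow> proper V (f s)"
  shows "proper V (\<lambda>x. \<Prod>s\<in>S. f s x)"
  using assms
proof (induction S rule: finite_induct)
  case empty
  have "proper V (\<lambda>x. if even (0::int) then 1 else - 1)"
    by (rule proper_sign) (rule is_affine_const)
  then show ?case by simp
qed (simp add: proper_mult)

section \<open>From Pochhammer symbols to the symmetric factorials of the R-matrix\<close>

lemma qbrace_eq: "qbrace n = - (indet powi (- int n) * (1 - q_fun powi int n))"
proof -
  have "indet powi (- int n) * q_fun powi int n = indet powi int n"
    unfolding q_powi_eq by (simp add: power_int_add[symmetric])
  then show ?thesis by (simp add: qbrace_def right_diff_distrib)
qed

lemma qbrace_fact_eq:
  "qbrace_fact n = (if even (int n) then 1 else - 1) * indet powi (- (int n * (int n + 1) div 2)) * q_fact (int n)"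
proof (induction n)
  case 0
  then show ?case by (simp add: qbrace_fact_def q_fact_def)
next
  case (Suc n)
  have 1: "qbrace_fact (Suc n) = qbrace_fact n * qbrace (Suc n)"
    by (simp add: qbrace_fact_def)
  have 2: "q_fact (int (Suc n)) = q_fact (int n) * (1 - q_fun powi int (Suc n))"
  proof -
    have "{1..int (Suc n)} = insert (int (Suc n)) {1..int n}" by auto
    then show ?thesis by (simp add: q_fact_def mult_ac)
  qed
  have "int (Suc n) * (int (Suc n) + 1) = int n * (int n + 1) + 2 * int (Suc n)"
    by (simp add: algebra_simps)
  then have *: "- (int (Suc n) * (int (Suc n) + 1) div 2) = - (int n * (int n + 1) div 2) + - int (Suc n)"
    by simp
  have 3: "indet powi (- (int (Suc n) * (int (Suc n) + 1) div 2))
      = indet powi (- (int n * (int n + 1) div 2)) * indet powi (- int (Suc n))"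
    unfolding * by (rule power_int_add) simp
  show ?case
    unfolding 1 2 3 Suc qbrace_eq by (simp add: mult_ac del: of_nat_Suc)
qed

lemma qbrace_fact_nonzero [simp]: "qbrace_fact n \<noteq> 0"
  by (simp add: qbrace_fact_eq)

lemma qbrace_fact_rec: "n \<ge> 1 \<Longrightarrow> qbrace_fact n = qbrace_fact (n - 1) * qbrace n"
  by (cases n) (simp_all add: qbrace_fact_def)

lemma qbrace_nonzero: "n \<ge> 1 \<Longrightarrow> qbrace n \<noteq> 0"
  by (metis qbrace_fact_rec mult_zero_right qbrace_fact_nonzero)

lemma proper_qbrace_fact:
  assumes l: "is_affine V l" and V: "finite V"
  shows "proper V (\<lambda>x. if 0 \<le> l x then qbrace_fact (nat (l x)) else 0)"
    and "proper V (\<lambda>x. if 0 \<le> l x then inverse (qbrace_fact (nat (l x))) else 0)"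
proof -
  let ?s = "\<lambda>x. if even (l x) then 1 else - 1 :: ratfun"
  have "proper V (\<lambda>x. indet powi (l x * (l x + 1) div 2))"
    by (rule proper_indet_powi_triangle[OF l V])
  \<comment> \<open>The negative of the triangular number \<open>T\<close> is
    \<open>- l (l + 1) + T\<close>, a product of two affine forms plus a triangular number.\<close>
  have neg: "proper V (\<lambda>x. indet powi (- (l x * (l x + 1) div 2)))"
  proof -
    have "proper V (\<lambda>x. indet powi ((- l x) * (l x + 1)) * indet powi (l x * (l x + 1) div 2))"
      by (intro proper_mult proper_indet_powi_mult proper_indet_powi_triangle l V is_affine_uminus
          is_affine_add is_affine_const)
    moreover have "indet powi ((- l x) * (l x + 1)) * indet powi (l x * (l x + 1) div 2)
        = indet powi (- (l x * (l x + 1) div 2))" for x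
    proof -
      have "even (l x * (l x + 1))" by auto
      then have "(- l x) * (l x + 1) + l x * (l x + 1) div 2 = - (l x * (l x + 1) div 2)"
        by (auto elim!: evenE)
      then show ?thesis by (simp only: power_int_add[symmetric] indet_nonzero simp_thms)
    qed
    ultimately show ?thesis by simp
  qed
  have "proper V (\<lambda>x. ?s x * indet powi (- (l x * (l x + 1) div 2)) * (if 0 \<le> l x then q_fact (l x) else 0))"
    by (intro proper_mult proper_sign proper_q_fact neg l V)
  moreover have "?s x * indet powi (- (l x * (l x + 1) div 2)) * (if 0 \<le> l x then q_fact (l x) else 0)
      = (if 0 \<le> l x then qbrace_fact (nat (l x)) else 0)" for x
    by (simp add: qbrace_fact_eq)
  ultimately show "proper V (\<lambda>x. if 0 \<le> l x then qbrace_fact (nat (l x)) else 0)" by simp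
  have "proper V (\<lambda>x. ?s x * indet powi (l x * (l x + 1) div 2) * (if 0 \<le> l x then inverse (q_fact (l x)) else 0))"
    by (intro proper_mult proper_sign proper_q_fact proper_indet_powi_triangle l V)
  moreover have "?s x * indet powi (l x * (l x + 1) div 2) * (if 0 \<le> l x then inverse (q_fact (l x)) else 0)
      = (if 0 \<le> l x then inverse (qbrace_fact (nat (l x))) else 0)" for x
    by (simp add: qbrace_fact_eq power_int_minus)
  ultimately show "proper V (\<lambda>x. if 0 \<le> l x then inverse (qbrace_fact (nat (l x))) else 0)" by simp
qed

text \<open>The factorial and the reciprocal factorial are limits of different deformations, so
  their product is 1 only where both arguments are admissible and 0 elsewhere. Inequalities between
  affine forms thereby become factors of the summand.\<close>

lemma proper_nonneg_indicator:
  assumes "is_affine V l" "finite V"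
  shows "proper V (\<lambda>x. if 0 \<le> l x then 1 else 0)"
proof -
  have "proper V (\<lambda>x. (if 0 \<le> l x then q_fact (l x) else 0) * (if 0 \<le> l x then inverse (q_fact (l x)) else 0))"
    by (intro proper_mult proper_q_fact assms)
  moreover have "(if 0 \<le> l x then q_fact (l x) else 0) * (if 0 \<le> l x then inverse (q_fact (l x)) else 0)
      = (if 0 \<le> l x then 1 else 0)" for x by simp
  ultimately show ?thesis by simp
qed

lemma proper_eq_indicator:
  assumes "is_affine V l" "is_affine V m" "finite V"
  shows "proper V (\<lambda>x. if l x = m x then 1 else 0)"
proof -
  have "proper V (\<lambda>x. (if 0 \<le> l x - m x then 1 else 0) * (if 0 \<le> m x - l x then 1 else 0))"
    by (intro proper_mult proper_nonneg_indicator is_affine_diff assms)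
  moreover have "(if 0 \<le> l x - m x then 1 else 0) * (if 0 \<le> m x - l x then 1 else 0)
      = (if l x = m x then 1 else 0 :: ratfun)" for x by simp
  ultimately show ?thesis by simp
qed

section \<open>Recurrences by counting dimensions\<close>

text \<open>A dimension count: the shifts of a proper function by vectors of size \<open>L\<close>, multiplied by powers of
  size \<open>L\<close> of one coordinate, are \<open>(L + 1)\<^bsup>d + 1\<^esup>\<close> in number, but they lie in a space of dimension
  \<open>O(L\<^sup>d)\<close>.\<close>

lemma proper_relation:
  fixes V :: "'i set"
  assumes f: "proper V f" and V: "finite V" and z: "z \<in> V" and s: "\<And>v. v \<in> V \<Longrightarrow> \<bar>s v\<bar> \<le> 1"
  shows "\<exists>L c. (\<forall>i u. c i u \<in> q_ring) \<and>
    (\<exists>i\<le>L. \<exists>u\<in>V \<rightarrow>\<^sub>E {..L}. c i u \<noteq> 0) \<and>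
    (\<forall>x. (\<Sum>(i, u)\<in>{..L} \<times> (V \<rightarrow>\<^sub>E {..L}).
       c i u * (q_fun powi (int i * x z) * f (\<lambda>v. x v + 4 * (s v * int (u v))))) = 0)"
proof -
  obtain \<Phi> where \<Phi>: "shift_regular V \<Phi>" "\<And>x. \<exists>g. \<Phi> x = fps_to_fls g \<and> fps_nth g 0 = f x"
    using f unfolding proper_def by blast
  obtain c where c: "c \<ge> 0" "\<And>L. L \<ge> 0 \<Longrightarrow> \<exists>G. \<forall>u. (\<forall>v\<in>V. \<bar>u v\<bar> \<le> L) \<longrightarrow>
     (\<exists>P\<in>laurent_funs V (c * L). \<forall>x. \<Phi> (\<lambda>v. x v + 4 * u v) = P x * G x)"
    using \<Phi>(1) unfolding shift_regular_def by blast
  \<comment> \<open>Exponents are bounded by \<open>M\<close>: degree \<open>c L\<close> from the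
    shifts and at most \<open>L\<close> from the power of \<open>q^(x z)\<close>. Since
    \<open>2 M + 1 \<le> (2 c + 3) (L + 1) = K (L + 1)\<close>, there are at most
    \<open>K^|V| (L + 1)^|V|\<close> monomials. For \<open>L = K^|V|\<close> this is less than the
    number \<open>(L + 1)^(|V| + 1)\<close> of unknowns.\<close>
  define K where "K = nat (2 * c + 3)"
  have K: "int K = 2 * c + 3" using c(1) by (simp add: K_def)
  define L where "L = K ^ card V"
  define M where "M = (c + 1) * int L"
  define B where "B = V \<rightarrow>\<^sub>E {-M..M}"
  define I where "I = {..L} \<times> (V \<rightarrow>\<^sub>E {..L})"
  have fin: "finite B" "finite I"
    unfolding B_def I_def using V by (auto intro!: finite_PiE)
  have M: "M \<ge> 0" using c(1) by (simp add: M_def)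
  have card: "card B < card I"
  proof -
    have "int (card {-M..M}) = 2 * (c + 1) * int L + 1"
      using M c(1) by (simp add: M_def)
    also have "\<dots> \<le> int (K * (L + 1))"
      unfolding of_nat_mult K using c(1) by (simp add: algebra_simps)
    finally have "card {-M..M} \<le> K * (L + 1)" by linarith
    moreover have "card B = card {-M..M} ^ card V"
      unfolding B_def using V by (simp add: card_PiE)
    ultimately have "card B \<le> (K * (L + 1)) ^ card V" by (simp add: power_mono)
    also have "\<dots> = L * (L + 1) ^ card V" unfolding power_mult_distrib by (simp only: L_def)
    also have "\<dots> < (L + 1) * (L + 1) ^ card V" by simp
    also have "\<dots> = card I"
      unfolding I_def using V by (simp add: card_cartesian_product card_PiE)
    finally show ?thesis .
  qed
  obtain G where G: "\<And>u. (\<forall>v\<in>V. \<bar>u v\<bar> \<le> int L) \<Longrightarrow>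
     (\<exists>P\<in>laurent_funs V (c * int L). \<forall>x. \<Phi> (\<lambda>v. x v + 4 * u v) = P x * G x)"
    using c(2)[of "int L"] by auto
  have "\<exists>C. (\<forall>b. C b \<in> deform_ring) \<and>
      (\<forall>x. q_fls powi (int i * x z) * \<Phi> (\<lambda>v. x v + 4 * (s v * int (u v)))
        = (\<Sum>b\<in>B. C b * q_fls powi lin V b x) * G x)" if iu: "(i, u) \<in> I" for i u
  proof -
    have u: "u v \<le> L" if "v \<in> V" for v using iu that by (auto simp: I_def)
    have "\<forall>v\<in>V. \<bar>s v * int (u v)\<bar> \<le> int L"
    proof
      fix v assume v: "v \<in> V"
      have "\<bar>s v\<bar> * int (u v) \<le> 1 * int (u v)" by (rule mult_right_mono) (use s[OF v] in auto)
      then show "\<bar>s v * int (u v)\<bar> \<le> int L" using u[OF v] by (simp add: abs_mult)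
    qed
    from G[OF this] obtain P where P: "P \<in> laurent_funs V (c * int L)"
      "\<And>x. \<Phi> (\<lambda>v. x v + 4 * (s v * int (u v))) = P x * G x" by blast
    let ?e = "\<lambda>v. if v = z then int i else 0"
    have e: "lin V ?e x = int i * x z" for x
      using V z by (simp add: lin_def if_distrib[of "\<lambda>t. t * _"] sum.delta cong: if_cong)
    have "(\<lambda>x. 1 * q_fls powi lin V ?e x) \<in> laurent_funs V (int L)"
      by (rule laurent_funs.monom) (use iu in \<open>auto simp: is_subring_1[OF is_subring_deform_ring] I_def\<close>)
    from laurent_funs_mult[OF this P(1)]
    have "(\<lambda>x. q_fls powi (int i * x z) * P x) \<in> laurent_funs V M"
      by (simp add: e M_def algebra_simps)
    from laurent_funs_expansion[OF this V] obtain C where C: "\<forall>b. C b \<in> deform_ring"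
      "\<And>x. q_fls powi (int i * x z) * P x = (\<Sum>b\<in>B. C b * q_fls powi lin V b x)"
      unfolding B_def by blast
    show ?thesis
    proof (intro exI[of _ C] conjI allI)
      show "C b \<in> deform_ring" for b using C(1) by blast
      show "q_fls powi (int i * x z) * \<Phi> (\<lambda>v. x v + 4 * (s v * int (u v)))
        = (\<Sum>b\<in>B. C b * q_fls powi lin V b x) * G x" for x
        unfolding P(2) C(2)[symmetric] by (simp add: mult_ac)
    qed
  qed
  then have "\<forall>p\<in>I. \<exists>C. (\<forall>b. C b \<in> deform_ring) \<and>
      (\<forall>x. q_fls powi (int (fst p) * x z) * \<Phi> (\<lambda>v. x v + 4 * (s v * int (snd p v)))
        = (\<Sum>b\<in>B. C b * q_fls powi lin V b x) * G x)"
    by auto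
  from bchoice[OF this] obtain C where C: "\<And>p b. p \<in> I \<Longrightarrow> C p b \<in> deform_ring"
      "\<And>p x. p \<in> I \<Longrightarrow> q_fls powi (int (fst p) * x z) * \<Phi> (\<lambda>v. x v + 4 * (s v * int (snd p v)))
        = (\<Sum>b\<in>B. C p b * q_fls powi lin V b x) * G x"
    by blast
  obtain d where d: "\<And>p. p \<in> I \<Longrightarrow> d p \<in> deform_ring" "\<exists>p\<in>I. d p \<noteq> 0"
    "\<And>b. b \<in> B \<Longrightarrow> (\<Sum>p\<in>I. d p * C p b) = 0"
  proof -
    have "\<exists>c. (\<forall>p\<in>I. c p \<in> deform_ring) \<and> (\<exists>p\<in>I. c p \<noteq> 0) \<and> (\<forall>b\<in>B. (\<Sum>p\<in>I. c p * C p b) = 0)"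
      by (rule exists_nontrivial_relation[OF is_subring_deform_ring fin card]) (rule C(1))
    with that show thesis by blast
  qed
  \<comment> \<open>The monomials and the common function \<open>G\<close> do not depend on
    \<open>p\<close>; a relation between the coordinates therefore holds at all lattice points at
    once.\<close>
  have rel: "(\<Sum>p\<in>I. d p * (q_fls powi (int (fst p) * x z) * \<Phi> (\<lambda>v. x v + 4 * (s v * int (snd p v))))) = 0"
    for x
  proof -
    have "(\<Sum>p\<in>I. d p * (q_fls powi (int (fst p) * x z) * \<Phi> (\<lambda>v. x v + 4 * (s v * int (snd p v)))))
      = (\<Sum>p\<in>I. \<Sum>b\<in>B. (d p * C p b) * (q_fls powi lin V b x * G x))"
    proof (rule sum.cong[OF refl])
      fix p assume "p \<in> I"
      then show "d p * (q_fls powi (int (fst p) * x z) * \<Phi> (\<lambda>v. x v + 4 * (s v * int (snd p v))))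
          = (\<Sum>b\<in>B. (d p * C p b) * (q_fls powi lin V b x * G x))"
        unfolding C(2)[OF \<open>p \<in> I\<close>] by (simp add: sum_distrib_left sum_distrib_right mult_ac)
    qed
    also have "\<dots> = (\<Sum>b\<in>B. \<Sum>p\<in>I. (d p * C p b) * (q_fls powi lin V b x * G x))"
      by (rule sum.swap)
    also have "\<dots> = (\<Sum>b\<in>B. (\<Sum>p\<in>I. d p * C p b) * (q_fls powi lin V b x * G x))"
      by (simp only: sum_distrib_right)
    also have "\<dots> = 0" using d(3) by simp
    finally show ?thesis .
  qed
  have "\<forall>p\<in>I. \<exists>e. e \<in> coeffs_in q_ring \<and> d p = fps_to_fls e"
    using d(1) by (auto simp: deform_ring_def)
  from bchoice[OF this] obtain e where e: "\<And>p. p \<in> I \<Longrightarrow> e p \<in> coeffs_in q_ring"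
    "\<And>p. p \<in> I \<Longrightarrow> d p = fps_to_fls (e p)" by blast
  obtain p0 where p0: "p0 \<in> I" "e p0 \<noteq> 0" using d(2) e(2) by fastforce
  obtain a where a: "\<And>p. p \<in> I \<Longrightarrow> a p \<in> q_ring" "\<exists>p\<in>I. a p \<noteq> 0"
    "\<And>g. (\<Sum>p\<in>I. e p * g p) = 0 \<Longrightarrow> (\<Sum>p\<in>I. a p * fps_nth (g p) 0) = 0"
    using specialize_relation[where c = e and S = q_ring, OF fin(2) e(1) p0] by blast
  have rel': "(\<Sum>p\<in>I. a p * (q_fun powi (int (fst p) * x z) * f (\<lambda>v. x v + 4 * (s v * int (snd p v))))) = 0"
    for x
  proof -
    obtain \<phi> where \<phi>: "\<And>x. \<Phi> x = fps_to_fls (\<phi> x)" "\<And>x. fps_nth (\<phi> x) 0 = f x"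
      using choice[of "\<lambda>x g. \<Phi> x = fps_to_fls g \<and> fps_nth g 0 = f x"] \<Phi>(2) by blast
    let ?g = "\<lambda>p. fps_const (q_fun powi (int (fst p) * x z)) * \<phi> (\<lambda>v. x v + 4 * (s v * int (snd p v)))"
    have sum: "fps_to_fls (sum h S) = (\<Sum>s\<in>S. fps_to_fls (h s))" for h :: "nat \<times> ('i \<Rightarrow> nat) \<Rightarrow> ratfun fps" and S
      by (induction S rule: infinite_finite_induct) auto
    have "fps_to_fls (\<Sum>p\<in>I. e p * ?g p)
        = (\<Sum>p\<in>I. d p * (q_fls powi (int (fst p) * x z) * \<Phi> (\<lambda>v. x v + 4 * (s v * int (snd p v)))))"
      unfolding sum
      by (rule sum.cong)
        (simp_all only: e fls_times_fps_to_fls \<phi>(1) fps_const_to_fls fls_const_power_int)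
    then have "fps_to_fls (\<Sum>p\<in>I. e p * ?g p) = 0" unfolding rel[of x] .
    then have "(\<Sum>p\<in>I. e p * ?g p) = 0" by (simp only: fps_to_fls_eq_0_iff)
    from a(3)[OF this] show ?thesis by (simp add: \<phi>(2))
  qed
  show ?thesis
  proof (rule exI[of _ L], rule exI[of _ "\<lambda>i u. if (i, u) \<in> I then a (i, u) else 0"], intro conjI allI)
    show "(if (i, u) \<in> I then a (i, u) else 0) \<in> q_ring" for i u
      using a(1) is_subring_0[OF is_subring_q_ring] by auto
    show "\<exists>i\<le>L. \<exists>u\<in>V \<rightarrow>\<^sub>E {..L}. (if (i, u) \<in> I then a (i, u) else 0) \<noteq> 0"
      using a(2) by (auto simp: I_def)
    fix x
    show "(\<Sum>(i, u)\<in>{..L} \<times> (V \<rightarrow>\<^sub>E {..L}). (if (i, u) \<in> I then a (i, u) else 0) *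
        (q_fun powi (int i * x z) * f (\<lambda>v. x v + 4 * (s v * int (u v))))) = 0"
      using rel'[of x] unfolding I_def[symmetric] by (simp add: case_prod_unfold)
  qed
qed

text \<open>Mixed radix notation: the new weight exceeds every value of the old weighted sum on the
  box, so that division by it recovers the new coordinate as quotient and the old sum as
  remainder.\<close>

lemma exists_separating_weights:
  fixes S :: "'i set"
  assumes "finite S"
  shows "\<exists>e :: 'i \<Rightarrow> nat. inj_on (\<lambda>u. \<Sum>v\<in>S. e v * u v) (S \<rightarrow>\<^sub>E {..L::nat})"
  using assms
proof (induction S rule: finite_induct)
  case empty
  then show ?case by simp
next
  case (insert w S)
  then obtain e where e: "inj_on (\<lambda>u. \<Sum>v\<in>S. e v * u v) (S \<rightarrow>\<^sub>E {..L})" by blast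
  define M where "M = Suc (\<Sum>v\<in>S. e v * L)"
  have less: "(\<Sum>v\<in>S. e v * u v) < M" if "\<And>v. v \<in> S \<Longrightarrow> u v \<le> L" for u
    unfolding M_def using that by (auto intro!: sum_mono simp: less_Suc_eq_le)
  have val: "(\<Sum>v\<in>insert w S. (e(w := M)) v * u v) = M * u w + (\<Sum>v\<in>S. e v * u v)" for u
  proof -
    have "(\<Sum>v\<in>S. (e(w := M)) v * u v) = (\<Sum>v\<in>S. e v * u v)"
      by (rule sum.cong) (use insert in auto)
    then show ?thesis using insert by simp
  qed
  have "inj_on (\<lambda>u. \<Sum>v\<in>insert w S. (e(w := M)) v * u v) (insert w S \<rightarrow>\<^sub>E {..L})"
  proof (rule inj_onI)
    fix u u' assume u: "u \<in> insert w S \<rightarrow>\<^sub>E {..L}" "u' \<in> insert w S \<rightarrow>\<^sub>E {..L}"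
      and "(\<Sum>v\<in>insert w S. (e(w := M)) v * u v) = (\<Sum>v\<in>insert w S. (e(w := M)) v * u' v)"
    then have eq: "M * u w + (\<Sum>v\<in>S. e v * u v) = M * u' w + (\<Sum>v\<in>S. e v * u' v)"
      by (simp only: val)
    have l: "(\<Sum>v\<in>S. e v * u v) < M" "(\<Sum>v\<in>S. e v * u' v) < M"
      using less u by (auto intro!: less)
    have M: "M > 0" by (simp add: M_def)
    have "(M * u w + (\<Sum>v\<in>S. e v * u v)) div M = u w" "(M * u' w + (\<Sum>v\<in>S. e v * u' v)) div M = u' w"
      using l M by simp_all
    then have w: "u w = u' w" using eq by simp
    then have "(\<Sum>v\<in>S. e v * u v) = (\<Sum>v\<in>S. e v * u' v)" using eq by simp
    moreover have "(\<Sum>v\<in>S. e v * restrict u S v) = (\<Sum>v\<in>S. e v * u v)" for u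
      by (rule sum.cong) auto
    ultimately have "restrict u S = restrict u' S"
      using inj_onD[OF e, of "restrict u S" "restrict u' S"] u by auto
    then have "u v = u' v" if "v \<in> S" for v using that by (metis restrict_apply')
    with w u show "u = u'" by (intro PiE_ext[OF u]) auto
  qed
  then show ?case by blast
qed

text \<open>The sum is a polynomial composed with \<open>a + X\<close>, and composition with a
  polynomial of degree 1 is injective; injectivity of \<open>w\<close> keeps the coefficients apart.
  It is applied with \<open>a = 1\<close> to the summation weights and with the constant
  \<open>z\<close> to expansions in \<open>q - z\<close>.\<close>

lemma weighted_sum_eq_0:
  fixes c :: "'u \<Rightarrow> 'a::field" and w :: "'u \<Rightarrow> nat"
  assumes U: "finite U" and w: "inj_on w U"
    and 0: "(\<Sum>u\<in>U. fps_const (c u) * (fps_const a + fps_X) ^ w u) = 0" and u: "u \<in> U"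
  shows "c u = 0"
proof -
  define p where "p = (\<Sum>u\<in>U. monom (c u) (w u))"
  have "fps_of_poly (pcompose p [:a, 1:]) = (\<Sum>u\<in>U. fps_const (c u) * (fps_const a + fps_X) ^ w u)"
  proof -
    have "pcompose (monom b k) [:a, 1:] = Polynomial.smult b ([:a, 1:] ^ k)" for b k
      by (induction k) (simp_all add: monom_0 monom_Suc pcompose_pCons)
    moreover have X: "fps_of_poly [:a, 1:] = fps_const a + fps_X" by (simp add: fps_of_poly_pCons)
    ultimately show ?thesis
      by (simp only: p_def pcompose_sum fps_of_poly_sum fps_of_poly_smult fps_of_poly_power X)
  qed
  then have "pcompose p [:a, 1:] = 0" using 0 by (metis fps_of_poly_eq_iff fps_of_poly_0)
  then have "p = 0" by (rule pcompose_eq_0) simp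
  then have "0 = coeff p (w u)" by simp
  also have "\<dots> = (\<Sum>u'\<in>U. if u' = u then c u' else 0)"
    unfolding p_def coeff_sum
    by (rule sum.cong) (use w u in \<open>auto simp: inj_on_def\<close>)
  also have "\<dots> = c u" using U u by simp
  finally show ?thesis by simp
qed

text \<open>Summed naively, the coefficients of the relation of \<open>proper_relation\<close> may cancel. Summing with
  weights \<open>(1 + X)\<^bsup>e(\<sigma>)\<^esup>\<close> for a generic linear form \<open>e\<close> prevents this, and the weights are removed
  by dividing out a power of \<open>X\<close>.\<close>

lemma proper_sum_recurrence:
  fixes S :: "'i set" and f :: "('i \<Rightarrow> int) \<Rightarrow> ratfun"
  assumes f: "proper (insert z S) f" and S: "finite S" "z \<notin> S"
    and coord: "\<And>x y. (\<And>v. v \<in> insert z S \<Longrightarrow> x v = y v) \<Longrightarrow> f x = f y"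
    and supp: "\<And>x v. 1 \<le> x z \<Longrightarrow> v \<in> S \<Longrightarrow> f x \<noteq> 0 \<Longrightarrow> 0 \<le> x v \<and> x v < x z"
  defines "T \<equiv> \<lambda>n. \<Sum>\<sigma>\<in>S \<rightarrow>\<^sub>E {..<n}. f (\<lambda>v. if v = z then int n else int (\<sigma> v))"
  shows "\<exists>L c. (\<forall>i j. c i j \<in> q_ring) \<and> (\<exists>i\<le>L. \<exists>j\<le>L. c i j \<noteq> 0) \<and>
    (\<forall>n\<ge>1. (\<Sum>(i, j)\<in>{..L} \<times> {..L}. c i j * (q_fun powi (int i * int n) * T (n + 4 * j))) = 0)"
proof -
  let ?V = "insert z S"
  \<comment> \<open>The color is shifted up and the states are shifted down: after reindexing, the
    summation ranges of all shifts lie in one box of natural numbers.\<close>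
  define s where "s = (\<lambda>v. if v = z then 1 else - 1 :: int)"
  have V: "finite ?V" using S by simp
  have "\<exists>L c. (\<forall>i u. c i u \<in> q_ring) \<and>
    (\<exists>i\<le>L. \<exists>u\<in>?V \<rightarrow>\<^sub>E {..L}. c i u \<noteq> 0) \<and>
    (\<forall>x. (\<Sum>(i, u)\<in>{..L} \<times> (?V \<rightarrow>\<^sub>E {..L}).
       c i u * (q_fun powi (int i * x z) * f (\<lambda>v. x v + 4 * (s v * int (u v))))) = 0)"
    by (rule proper_relation[OF f V]) (auto simp: s_def)
  then obtain L c i0 u0 where c: "\<And>i u. c i u \<in> q_ring"
    and nz: "i0 \<le> L" "u0 \<in> ?V \<rightarrow>\<^sub>E {..L}" "c i0 u0 \<noteq> 0"
    and rel: "\<And>x. (\<Sum>(i, u)\<in>{..L} \<times> (?V \<rightarrow>\<^sub>E {..L}).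
       c i u * (q_fun powi (int i * x z) * f (\<lambda>v. x v + 4 * (s v * int (u v))))) = 0"
    by blast
  define U where "U = ?V \<rightarrow>\<^sub>E {..L}"
  have finU: "finite U" unfolding U_def using V by (auto intro: finite_PiE)
  obtain e :: "'i \<Rightarrow> nat" where e: "inj_on (\<lambda>u. \<Sum>v\<in>S. e v * u v) (S \<rightarrow>\<^sub>E {..L})"
    using exists_separating_weights[OF S(1)] by blast
  define wt where "wt = (\<lambda>u. \<Sum>v\<in>S. e v * u v)"
  define Y where "Y = (1 + fps_X :: ratfun fps)"
  have Y0: "fps_nth (Y ^ k) 0 = 1" for k by (induction k) (simp_all add: Y_def)
  define pt where "pt = (\<lambda>n (\<sigma> :: 'i \<Rightarrow> nat) v. if v = z then int n else int (\<sigma> v))"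
  \<comment> \<open>Moving the states by \<open>4 u\<close> multiplies their weight by
    \<open>Y ^ (4 * wt u)\<close>. Coefficients belonging to the same color shift
    \<open>u z = j\<close> are collected, since they multiply the same sum
    \<open>TT (n + 4 * j)\<close>.\<close>
  define D where "D = (\<lambda>i j. \<Sum>u\<in>{u\<in>U. u z = j}. fps_const (c i u) * Y ^ (4 * wt u))"
  define TT where "TT = (\<lambda>n. \<Sum>\<sigma>\<in>S \<rightarrow>\<^sub>E {..<n}. fps_const (f (pt n \<sigma>)) * Y ^ wt \<sigma>)"
  have e': "inj_on wt (S \<rightarrow>\<^sub>E {..L})" using e by (simp add: wt_def)
  have wt_restrict: "wt (restrict u S) = wt u" for u
    unfolding wt_def by (rule sum.cong) auto
  \<comment> \<open>Shifts with the same value at \<open>z\<close> differ on \<open>S\<close>, so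
    they carry different powers of \<open>Y\<close>, and the nonzero coefficient
    \<open>c i0 u0\<close> cannot be cancelled.\<close>
  have "D i0 (u0 z) \<noteq> 0"
  proof
    assume "D i0 (u0 z) = 0"
    then have w0: "(\<Sum>u | u \<in> U \<and> u z = u0 z. fps_const (c i0 u) * (fps_const 1 + fps_X) ^ (4 * wt u)) = 0"
      by (simp add: D_def Y_def)
    have winj: "inj_on (\<lambda>u. 4 * wt u) {u \<in> U. u z = u0 z}"
    proof (rule inj_onI)
      fix u u' assume u: "u \<in> {u \<in> U. u z = u0 z}" "u' \<in> {u \<in> U. u z = u0 z}" and "4 * wt u = 4 * wt u'"
      then have "wt (restrict u S) = wt (restrict u' S)" by (simp add: wt_restrict)
      moreover have "restrict u S \<in> S \<rightarrow>\<^sub>E {..L}" "restrict u' S \<in> S \<rightarrow>\<^sub>E {..L}"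
        using u by (auto simp: U_def)
      ultimately have "restrict u S = restrict u' S"
        using inj_onD[OF e'] by blast
      then have "u v = u' v" if "v \<in> S" for v using that by (metis restrict_apply')
      with u show "u = u'" by (intro PiE_ext[of u ?V "\<lambda>_. {..L}"]) (auto simp: U_def)
    qed
    have "c i0 u0 = 0"
      by (rule weighted_sum_eq_0[OF _ winj w0]) (use nz finU in \<open>auto simp: U_def\<close>)
    with nz show False by simp
  qed
  moreover have "D i j \<in> coeffs_in q_ring" for i j
  proof -
    have sub: "is_subring (coeffs_in q_ring)" by (rule is_subring_coeffs_in[OF is_subring_q_ring])
    have "Y \<in> coeffs_in q_ring"
      unfolding Y_def by (intro is_subring_add[OF sub] is_subring_1[OF sub] fps_X_in_coeffs_in is_subring_q_ring)
    then show ?thesis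
      unfolding D_def
      by (intro is_subring_sum[OF sub] is_subring_mult[OF sub] is_subring_power[OF sub]
          fps_const_in_coeffs_in is_subring_q_ring c)
  qed
  ultimately have "\<exists>d. (\<forall>p\<in>{..L} \<times> {..L}. d p \<in> q_ring) \<and> (\<exists>p\<in>{..L} \<times> {..L}. d p \<noteq> 0) \<and>
    (\<forall>g. (\<Sum>p\<in>{..L} \<times> {..L}. D (fst p) (snd p) * g p) = 0 \<longrightarrow>
       (\<Sum>p\<in>{..L} \<times> {..L}. d p * fps_nth (g p) 0) = 0)"
    by (intro specialize_relation[where ?i0.0 = "(i0, u0 z)"]) (use nz in auto)
  then obtain d where d: "\<forall>p\<in>{..L} \<times> {..L}. d p \<in> q_ring" "\<exists>p\<in>{..L} \<times> {..L}. d p \<noteq> 0"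
    "\<forall>g. (\<Sum>p\<in>{..L} \<times> {..L}. D (fst p) (snd p) * g p) = 0 \<longrightarrow>
       (\<Sum>p\<in>{..L} \<times> {..L}. d p * fps_nth (g p) 0) = 0"
    by (elim exE conjE)
  \<comment> \<open>The margin \<open>8 * L\<close> accommodates the color shift
    \<open>4 * u z\<close> together with a state shift \<open>4 * u v\<close>. The additional terms
    in the larger box lie outside the support of \<open>f\<close>.\<close>
  have shifted: "Y ^ (4 * wt u) * TT (n + 4 * u z)
      = (\<Sum>\<sigma>\<in>S \<rightarrow>\<^sub>E {..<n + 8 * L}. fps_const (f (\<lambda>v. pt n \<sigma> v + 4 * (s v * int (u v)))) * Y ^ wt \<sigma>)"
    (is "_ = sum ?F ?R") if n: "n \<ge> 1" and u: "u \<in> U" for n u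
  proof -
    have uL: "u v \<le> L" if "v \<in> ?V" for v using u that by (auto simp: U_def)
    define R' where "R' = {\<sigma>\<in>?R. \<forall>v\<in>S. 4 * u v \<le> \<sigma> v \<and> \<sigma> v < n + 4 * u z + 4 * u v}"
    have finR: "finite ?R" using S by (auto intro: finite_PiE)
    have "sum ?F ?R = sum ?F R'"
    proof (rule sum.mono_neutral_right[OF finR])
      show "R' \<subseteq> ?R" by (auto simp: R'_def)
      show "\<forall>\<sigma>\<in>?R - R'. ?F \<sigma> = 0"
      proof
        fix \<sigma> assume \<sigma>: "\<sigma> \<in> ?R - R'"
        then obtain v where v: "v \<in> S" "\<not> (4 * u v \<le> \<sigma> v \<and> \<sigma> v < n + 4 * u z + 4 * u v)"
          by (auto simp: R'_def)
        let ?y = "\<lambda>v. pt n \<sigma> v + 4 * (s v * int (u v))"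
        have "v \<noteq> z" using v S by auto
        then have y: "?y v = int (\<sigma> v) - 4 * int (u v)" "?y z = int n + 4 * int (u z)"
          by (auto simp: pt_def s_def)
        have "\<not> (0 \<le> ?y v \<and> ?y v < ?y z)" unfolding y using v(2) by linarith
        moreover have "1 \<le> ?y z" unfolding y using n by simp
        ultimately have "f ?y = 0" using supp[of ?y v] v(1) by blast
        then show "?F \<sigma> = 0" by simp
      qed
    qed
    also have "sum ?F R' = (\<Sum>\<sigma>\<in>S \<rightarrow>\<^sub>E {..<n + 4 * u z}. fps_const (f (pt (n + 4 * u z) \<sigma>)) * Y ^ (4 * wt u + wt \<sigma>))"
    proof (rule sum.reindex_bij_witness[of _ "\<lambda>\<sigma>. \<lambda>v\<in>S. \<sigma> v + 4 * u v" "\<lambda>\<sigma>. \<lambda>v\<in>S. \<sigma> v - 4 * u v"])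
      fix \<sigma> assume \<sigma>: "\<sigma> \<in> R'"
      then have \<sigma>': "\<sigma> \<in> S \<rightarrow>\<^sub>E {..<n + 8 * L}" and b: "\<And>v. v \<in> S \<Longrightarrow> 4 * u v \<le> \<sigma> v \<and> \<sigma> v < n + 4 * u z + 4 * u v"
        by (auto simp: R'_def)
      show "(\<lambda>v\<in>S. (\<lambda>v\<in>S. \<sigma> v - 4 * u v) v + 4 * u v) = \<sigma>"
      proof (rule ext)
        fix v
        show "(\<lambda>v\<in>S. (\<lambda>v\<in>S. \<sigma> v - 4 * u v) v + 4 * u v) v = \<sigma> v"
          using b[of v] PiE_arb[OF \<sigma>', of v] by (cases "v \<in> S") simp_all
      qed
      show "(\<lambda>v\<in>S. \<sigma> v - 4 * u v) \<in> S \<rightarrow>\<^sub>E {..<n + 4 * u z}"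
      proof (rule PiE_I)
        show "(\<lambda>v\<in>S. \<sigma> v - 4 * u v) v \<in> {..<n + 4 * u z}" if "v \<in> S" for v
          using b[OF that] that by auto
      qed simp
      have "f (pt (n + 4 * u z) (\<lambda>v\<in>S. \<sigma> v - 4 * u v)) = f (\<lambda>v. pt n \<sigma> v + 4 * (s v * int (u v)))"
      proof (rule coord)
        fix v assume v: "v \<in> ?V"
        show "pt (n + 4 * u z) (\<lambda>v\<in>S. \<sigma> v - 4 * u v) v = pt n \<sigma> v + 4 * (s v * int (u v))"
        proof (cases "v = z")
          case False
          with v have "v \<in> S" by simp
          with False b[of v] show ?thesis by (simp add: pt_def s_def of_nat_diff)
        qed (simp add: pt_def s_def)
      qed
      moreover have "4 * wt u + wt (\<lambda>v\<in>S. \<sigma> v - 4 * u v) = wt \<sigma>"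
        unfolding wt_def sum_distrib_left sum.distrib[symmetric]
      proof (rule sum.cong[OF refl])
        fix v assume v: "v \<in> S"
        have "4 * (e v * u v) + e v * (\<sigma> v - 4 * u v) = e v * (4 * u v + (\<sigma> v - 4 * u v))"
          by (simp add: distrib_left)
        also have "\<dots> = e v * \<sigma> v" using b[OF v] by simp
        finally show "4 * (e v * u v) + e v * (\<lambda>v\<in>S. \<sigma> v - 4 * u v) v = e v * \<sigma> v"
          using v by simp
      qed
      ultimately show "fps_const (f (pt (n + 4 * u z) (\<lambda>v\<in>S. \<sigma> v - 4 * u v))) * Y ^ (4 * wt u + wt (\<lambda>v\<in>S. \<sigma> v - 4 * u v))
          = ?F \<sigma>" by simp
    next
      fix \<sigma> assume \<sigma>: "\<sigma> \<in> S \<rightarrow>\<^sub>E {..<n + 4 * u z}"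
      show "(\<lambda>v\<in>S. (\<lambda>v\<in>S. \<sigma> v + 4 * u v) v - 4 * u v) = \<sigma>"
      proof (rule ext)
        fix v
        show "(\<lambda>v\<in>S. (\<lambda>v\<in>S. \<sigma> v + 4 * u v) v - 4 * u v) v = \<sigma> v"
          using PiE_arb[OF \<sigma>, of v] by (cases "v \<in> S") simp_all
      qed
      have "\<sigma> v + 4 * u v < n + 8 * L" if "v \<in> S" for v
      proof -
        have "\<sigma> v < n + 4 * u z" using \<sigma> that by auto
        moreover have "u z \<le> L" "u v \<le> L" using uL that by auto
        ultimately show ?thesis by linarith
      qed
      then show "(\<lambda>v\<in>S. \<sigma> v + 4 * u v) \<in> R'"
        using \<sigma> by (auto simp: R'_def)
    qed
    also have "\<dots> = Y ^ (4 * wt u) * TT (n + 4 * u z)"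
      unfolding TT_def sum_distrib_left by (rule sum.cong) (simp_all only: power_add mult_ac)
    finally show ?thesis ..
  qed
  have TT0: "fps_nth (TT n) 0 = T n" for n
    by (simp add: TT_def T_def fps_sum_nth pt_def Y0)
  have main: "(\<Sum>p\<in>{..L} \<times> {..L}. d p * (q_fun powi (int (fst p) * int n) * T (n + 4 * snd p))) = 0"
    if n: "n \<ge> 1" for n
  proof -
    let ?q = "\<lambda>i. fps_const (q_fun powi (int i * int n))"
    have "(\<Sum>p\<in>{..L} \<times> {..L}. D (fst p) (snd p) * (?q (fst p) * TT (n + 4 * snd p)))
        = (\<Sum>i\<le>L. \<Sum>j\<le>L. D i j * (?q i * TT (n + 4 * j)))"
      by (simp add: sum.cartesian_product case_prod_unfold)
    also have "\<dots> = (\<Sum>i\<le>L. \<Sum>u\<in>U. fps_const (c i u) * Y ^ (4 * wt u) * (?q i * TT (n + 4 * u z)))"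
    proof (rule sum.cong[OF refl])
      fix i
      have "(\<Sum>j\<le>L. D i j * (?q i * TT (n + 4 * j)))
          = (\<Sum>j\<le>L. \<Sum>u\<in>{u\<in>U. u z = j}. fps_const (c i u) * Y ^ (4 * wt u) * (?q i * TT (n + 4 * u z)))"
        unfolding D_def by (intro sum.cong refl) (simp add: sum_distrib_right)
      also have "\<dots> = (\<Sum>u\<in>U. fps_const (c i u) * Y ^ (4 * wt u) * (?q i * TT (n + 4 * u z)))"
        by (rule sum.group) (use finU in \<open>auto simp: U_def\<close>)
      finally show "(\<Sum>j\<le>L. D i j * (?q i * TT (n + 4 * j)))
          = (\<Sum>u\<in>U. fps_const (c i u) * Y ^ (4 * wt u) * (?q i * TT (n + 4 * u z)))" .
    qed
    also have "\<dots> = (\<Sum>p\<in>{..L} \<times> U. fps_const (c (fst p) (snd p)) * Y ^ (4 * wt (snd p))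
        * (?q (fst p) * TT (n + 4 * snd p z)))"
      by (simp add: sum.cartesian_product case_prod_unfold)
    also have "\<dots> = (\<Sum>p\<in>{..L} \<times> U. \<Sum>\<sigma>\<in>S \<rightarrow>\<^sub>E {..<n + 8 * L}.
        fps_const (c (fst p) (snd p) * (q_fun powi (int (fst p) * pt n \<sigma> z)
          * f (\<lambda>v. pt n \<sigma> v + 4 * (s v * int (snd p v))))) * Y ^ wt \<sigma>)"
    proof (rule sum.cong[OF refl])
      fix p assume "p \<in> {..L} \<times> U"
      then have "snd p \<in> U" by auto
      have "fps_const (c (fst p) (snd p)) * Y ^ (4 * wt (snd p)) * (?q (fst p) * TT (n + 4 * snd p z))
          = fps_const (c (fst p) (snd p)) * ?q (fst p) * (Y ^ (4 * wt (snd p)) * TT (n + 4 * snd p z))"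
        by (simp only: mult_ac)
      also have "\<dots> = (\<Sum>\<sigma>\<in>S \<rightarrow>\<^sub>E {..<n + 8 * L}. fps_const (c (fst p) (snd p)) * ?q (fst p) *
          (fps_const (f (\<lambda>v. pt n \<sigma> v + 4 * (s v * int (snd p v)))) * Y ^ wt \<sigma>))"
        unfolding shifted[OF n \<open>snd p \<in> U\<close>] sum_distrib_left ..
      also have "\<dots> = (\<Sum>\<sigma>\<in>S \<rightarrow>\<^sub>E {..<n + 8 * L}.
        fps_const (c (fst p) (snd p) * (q_fun powi (int (fst p) * pt n \<sigma> z)
          * f (\<lambda>v. pt n \<sigma> v + 4 * (s v * int (snd p v))))) * Y ^ wt \<sigma>)"
        by (rule sum.cong) (simp_all only: pt_def if_True simp_thms fps_const_mult[symmetric] mult.assoc)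
      finally show "fps_const (c (fst p) (snd p)) * Y ^ (4 * wt (snd p)) * (?q (fst p) * TT (n + 4 * snd p z))
          = (\<Sum>\<sigma>\<in>S \<rightarrow>\<^sub>E {..<n + 8 * L}.
        fps_const (c (fst p) (snd p) * (q_fun powi (int (fst p) * pt n \<sigma> z)
          * f (\<lambda>v. pt n \<sigma> v + 4 * (s v * int (snd p v))))) * Y ^ wt \<sigma>)" .
    qed
    also have "\<dots> = (\<Sum>\<sigma>\<in>S \<rightarrow>\<^sub>E {..<n + 8 * L}. \<Sum>p\<in>{..L} \<times> U.
        fps_const (c (fst p) (snd p) * (q_fun powi (int (fst p) * pt n \<sigma> z)
          * f (\<lambda>v. pt n \<sigma> v + 4 * (s v * int (snd p v))))) * Y ^ wt \<sigma>)"
      by (rule sum.swap)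
    also have "\<dots> = 0"
    proof (rule sum.neutral, rule ballI)
      fix \<sigma>
      have const: "(\<Sum>p\<in>A. fps_const (h p)) = fps_const (sum h A)" for h :: "nat \<times> ('i \<Rightarrow> nat) \<Rightarrow> ratfun" and A
        by (induction A rule: infinite_finite_induct) auto
      show "(\<Sum>p\<in>{..L} \<times> U. fps_const (c (fst p) (snd p) * (q_fun powi (int (fst p) * pt n \<sigma> z)
          * f (\<lambda>v. pt n \<sigma> v + 4 * (s v * int (snd p v))))) * Y ^ wt \<sigma>) = 0"
        using rel[of "pt n \<sigma>"] unfolding sum_distrib_right[symmetric] const U_def[symmetric]
        by (simp add: case_prod_unfold)
    qed
    finally have "(\<Sum>p\<in>{..L} \<times> {..L}. D (fst p) (snd p) * (?q (fst p) * TT (n + 4 * snd p))) = 0" .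
    from d(3)[rule_format, OF this] show ?thesis by (simp add: TT0)
  qed
  let ?c = "\<lambda>i j. if i \<le> L \<and> j \<le> L then d (i, j) else 0"
  show ?thesis
  proof (rule exI[of _ L], rule exI[of _ ?c], intro conjI allI impI)
    show "?c i j \<in> q_ring" for i j
      using d(1) is_subring_0[OF is_subring_q_ring] by auto
    show "\<exists>i\<le>L. \<exists>j\<le>L. ?c i j \<noteq> 0" using d(2) by auto
    fix n :: nat assume n: "1 \<le> n"
    have "(\<Sum>(i, j)\<in>{..L} \<times> {..L}. ?c i j * (q_fun powi (int i * int n) * T (n + 4 * j)))
      = (\<Sum>p\<in>{..L} \<times> {..L}. d p * (q_fun powi (int (fst p) * int n) * T (n + 4 * snd p)))"
      by (rule sum.cong) auto
    then show "(\<Sum>(i, j)\<in>{..L} \<times> {..L}. ?c i j * (q_fun powi (int i * int n) * T (n + 4 * j))) = 0"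
      using main[OF n] by simp
  qed
qed

section \<open>The state sum of the colored Jones polynomial\<close>

text \<open>Like its companion for reciprocals, extended by 0 to negative integers, as the limits of
  the deformations require; the two are mutually inverse on nonnegative integers only.\<close>

definition brace_fact :: "int \<Rightarrow> ratfun" where
  "brace_fact a = (if 0 \<le> a then qbrace_fact (nat a) else 0)"

definition inv_brace_fact :: "int \<Rightarrow> ratfun" where
  "inv_brace_fact a = (if 0 \<le> a then inverse (qbrace_fact (nat a)) else 0)"

lemma proper_brace_fact:
  assumes "is_affine V l" "finite V"
  shows "proper V (\<lambda>x. brace_fact (l x))" and "proper V (\<lambda>x. inv_brace_fact (l x))"
  unfolding brace_fact_def inv_brace_fact_def by (rule proper_qbrace_fact[OF assms])+

text \<open>The R-matrix as a product of factors already known to be proper, with integer arguments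
  so that the color \<open>N\<close> is a lattice variable too. The conditions
  \<open>i \<le> l\<close> and \<open>l \<le> i\<close> are hidden in the reciprocal factorials of
  \<open>l - i\<close> and \<open>i - l\<close>. For a positive crossing the exponent
  \<open>- m (m + 1) / 2\<close> is split into \<open>- m (m + 1)\<close>, a product of affine
  forms, and a triangular number.\<close>

definition R_int :: "bool \<Rightarrow> int \<Rightarrow> int \<Rightarrow> int \<Rightarrow> int \<Rightarrow> int \<Rightarrow> ratfun" where
  "R_int e N k l i j = (if i + j = k + l then 1 else 0) *
     (if e then
        indet powi (2 * i * j) * indet powi (- (i + j + 1) * (N - 1)) * indet powi (- (l - i) * (i - j)) *
        (indet powi (- (l - i) * (l - i + 1)) * indet powi ((l - i) * (l - i + 1) div 2)) *
        (brace_fact l * brace_fact (N - 1 - k)) *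
        (inv_brace_fact i * inv_brace_fact (l - i) * inv_brace_fact (N - 1 - j))
      else
        (if even (i - l) then 1 else - 1) *
        (indet powi (- 2 * i * j) * indet powi ((i + j + 1) * (N - 1)) * indet powi (- (i - l) * (i - j)) *
        indet powi ((i - l) * (i - l + 1) div 2)) *
        (brace_fact k * brace_fact (N - 1 - l)) *
        (inv_brace_fact j * inv_brace_fact (i - l) * inv_brace_fact (N - 1 - i)))"

lemma proper_R_int:
  assumes V: "finite V" and a: "is_affine V N" "is_affine V k" "is_affine V l" "is_affine V i" "is_affine V j"
  shows "proper V (\<lambda>x. R_int e (N x) (k x) (l x) (i x) (j x))"
  unfolding R_int_def
  by (cases e; simp only: if_True if_False)
    (intro proper_mult proper_eq_indicator proper_sign proper_brace_fact proper_indet_powi_mult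
      proper_indet_powi_triangle is_affine_diff is_affine_add is_affine_uminus is_affine_scale
      is_affine_const a V)+

lemma triangle_half: "a * (a + 1) div 2 = a * (a + 1) - a * (a + 1) div 2" for a :: int
proof -
  have "even (a * (a + 1))" by auto
  then show ?thesis by (auto elim!: evenE)
qed

lemma R_int_eq:
  assumes "k < N" "l < N" "i < N" "j < N"
  shows "R_int e (int N) (int k) (int l) (int i) (int j)
    = (if e then R_matrix else R_matrix_inv) N k l i j"
proof (cases "i + j = k + l")
  case False
  then have "int i + int j \<noteq> int k + int l" by linarith
  with False show ?thesis by (auto simp: R_int_def R_matrix_def R_matrix_inv_def)
next
  case True
  then have ijkl: "int i + int j = int k + int l" by linarith
  have nat: "nat (int N - 1 - int a) = N - 1 - a" "0 \<le> int N - 1 - int a" if "a < N" for a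
    using that by auto
  have nat2: "nat (int a - int b) = a - b" if "b \<le> a" for a b
    using that by auto
  have ind: "indet powi a * indet powi b = (indet powi (a + b) :: ratfun)" for a b
    by (simp add: power_int_add)
  show ?thesis
  proof (cases e)
    case e: True
    show ?thesis
    proof (cases "i \<le> l")
      case False
      then have "inv_brace_fact (int l - int i) = 0" by (simp add: inv_brace_fact_def)
      then show ?thesis using e False by (simp add: R_int_def R_matrix_def)
    next
      case il: True
      define m where "m = l - i"
      have m: "int l - int i = int m" using il by (simp add: m_def)
      have exp: "2 * int i * int j + - (int i + int j + 1) * (int N - 1) + - int m * (int i - int j)
          + (- int m * (int m + 1) + int m * (int m + 1) div 2)
        = 2 * int i * int j - (int i + int j + 1) * (int N - 1) - int m * (int i - int j) - int (m * (m + 1) div 2)"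
        using triangle_half[of "int m"] by (simp add: zdiv_int algebra_simps)
      have "R_int e (int N) (int k) (int l) (int i) (int j) =
        indet powi (2 * int i * int j - (int i + int j + 1) * (int N - 1) - int m * (int i - int j) - int (m * (m + 1) div 2)) *
        (qbrace_fact l * qbrace_fact (N - 1 - k)) *
        (inverse (qbrace_fact i) * inverse (qbrace_fact m) * inverse (qbrace_fact (N - 1 - j)))"
        unfolding R_int_def m ind exp using e ijkl assms
        by (simp only: brace_fact_def inv_brace_fact_def nat if_True of_nat_0_le_iff nat_int simp_thms mult_1_left)
      then show ?thesis using e il True
        by (simp add: R_matrix_def Let_def m_def divide_inverse mult_ac)
    qed
  next
    case e: False
    show ?thesis
    proof (cases "l \<le> i")
      case False
      then have "inv_brace_fact (int i - int l) = 0" by (simp add: inv_brace_fact_def)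
      then show ?thesis using e False by (simp add: R_int_def R_matrix_inv_def)
    next
      case il: True
      define m where "m = i - l"
      have m: "int i - int l = int m" using il by (simp add: m_def)
      have exp: "- 2 * int i * int j + (int i + int j + 1) * (int N - 1) + - int m * (int i - int j)
          + int m * (int m + 1) div 2
        = - 2 * int i * int j + (int i + int j + 1) * (int N - 1) - int m * (int i - int j) + int (m * (m + 1) div 2)"
        by (simp add: zdiv_int algebra_simps)
      have sign: "(if even (int m) then 1 else - 1 :: ratfun) = (- 1) ^ m" by simp
      have "R_int e (int N) (int k) (int l) (int i) (int j) =
        (- 1) ^ m * (indet powi (- 2 * int i * int j + (int i + int j + 1) * (int N - 1) - int m * (int i - int j) + int (m * (m + 1) div 2))) *
        (qbrace_fact k * qbrace_fact (N - 1 - l)) *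
        (inverse (qbrace_fact j) * inverse (qbrace_fact m) * inverse (qbrace_fact (N - 1 - i)))"
        unfolding R_int_def m ind exp sign using e ijkl assms
        by (simp only: brace_fact_def inv_brace_fact_def nat if_True if_False of_nat_0_le_iff nat_int simp_thms mult_1_left)
      then show ?thesis using e il True
        by (simp add: R_matrix_inv_def Let_def m_def divide_inverse mult_ac)
    qed
  qed
qed

text \<open>The variable \<open>None\<close> is the color \<open>N\<close> and \<open>Some (t, p)\<close> is the state of the strand at position \<open>p\<close>
  below the letter \<open>t\<close>.\<close>

definition path_vars :: "nat \<Rightarrow> nat \<Rightarrow> (nat \<times> nat) option set" where
  "path_vars len k = Some ` ({..len} \<times> {..<k})"

definition letter_weight :: "nat \<Rightarrow> nat \<Rightarrow> nat \<times> bool \<Rightarrow> ((nat \<times> nat) option \<Rightarrow> int) \<Rightarrow> ratfun" where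
  "letter_weight k t g x = (case g of (p, e) \<Rightarrow>
     (\<Prod>y\<in>{..<k} - {p, Suc p}. if x (Some (t, y)) = x (Some (Suc t, y)) then 1 else 0) *
     R_int e (x None) (x (Some (t, p))) (x (Some (t, Suc p))) (x (Some (Suc t, p))) (x (Some (Suc t, Suc p))))"

text \<open>The quotient \<open>{N - 1}! / {N}!\<close> is the normalizing factor
  \<open>1 / {N}\<close>, written with factorials so as to be proper in \<open>N\<close>. Indicators
  confine the states to \<open>0, ..., N - 1\<close>, close the path, and, in
  \<open>letter_weight\<close>, keep strands away from a crossing constant.\<close>

definition path_weight :: "nat \<Rightarrow> braid_word \<Rightarrow> ((nat \<times> nat) option \<Rightarrow> int) \<Rightarrow> ratfun" where
  "path_weight k w x =
     (\<Prod>v\<in>path_vars (length w) k. (if 0 \<le> x v then 1 else 0) * (if 0 \<le> x None - 1 - x v then 1 else 0)) *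
     (brace_fact (x None - 1) * inv_brace_fact (x None)) *
     (\<Prod>p<k. (if x (Some (0, p)) = x (Some (length w, p)) then 1 else 0) *
        indet powi (2 * x (Some (0, p)) - x None + 1)) *
     (\<Prod>t<length w. letter_weight k t (w ! t) x)"

lemma finite_path_vars: "finite (path_vars len k)"
  by (simp add: path_vars_def)

lemma proper_path_weight:
  assumes w: "braid_word k w"
  shows "proper (insert None (path_vars (length w) k)) (path_weight k w)"
proof -
  let ?V = "insert None (path_vars (length w) k)"
  have V: "finite ?V" by (simp add: finite_path_vars)
  have var: "is_affine ?V (\<lambda>x. x (Some (t, p)))" if "t \<le> length w" "p < k" for t p
    by (rule is_affine_var[OF V]) (use that in \<open>auto simp: path_vars_def\<close>)
  have N: "is_affine ?V (\<lambda>x. x None)" by (rule is_affine_var[OF V]) simp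
  have letter: "proper ?V (letter_weight k t (w ! t))" if t: "t < length w" for t
  proof -
    obtain p e where pe: "w ! t = (p, e)" by (cases "w ! t") auto
    then have p: "Suc p < k" using w t nth_mem[OF t] by (auto simp: braid_word_def)
    show ?thesis
      unfolding letter_weight_def pe prod.case
      by (intro proper_mult proper_prod proper_eq_indicator proper_R_int N V var)
        (use t p in auto)
  qed
  show ?thesis
    unfolding path_weight_def
    by (intro proper_mult proper_prod proper_brace_fact proper_nonneg_indicator proper_eq_indicator
        proper_indet_powi_affine is_affine_add is_affine_diff is_affine_scale is_affine_const N V var letter
        finite_path_vars)
      (auto intro: is_affine_var[OF V])
qed

lemma path_weight_cong:
  assumes w: "braid_word k w" and xy: "\<And>v. v \<in> insert None (path_vars (length w) k) \<Longrightarrow> x v = y v"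
  shows "path_weight k w x = path_weight k w y"
proof -
  have N: "x None = y None" using xy by simp
  have var: "x (Some (t, p)) = y (Some (t, p))" if "t \<le> length w" "p < k" for t p
    by (rule xy) (use that in \<open>auto simp: path_vars_def\<close>)
  have letter: "letter_weight k t (w ! t) x = letter_weight k t (w ! t) y" if t: "t < length w" for t
  proof -
    obtain p e where pe: "w ! t = (p, e)" by (cases "w ! t") auto
    then have p: "Suc p < k" using w t nth_mem[OF t] by (auto simp: braid_word_def)
    show ?thesis
      unfolding letter_weight_def pe prod.case
      using t p by (intro arg_cong2[of _ _ _ _ "(*)"] prod.cong) (simp_all add: var N)
  qed
  show ?thesis
    unfolding path_weight_def
    by (intro arg_cong2[of _ _ _ _ "(*)"] prod.cong) (simp_all add: var N letter xy)
qed

lemma path_weight_support: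
  assumes v: "v \<in> path_vars (length w) k" and nz: "path_weight k w x \<noteq> 0"
  shows "0 \<le> x v \<and> x v < x None"
proof -
  have "(\<Prod>v\<in>path_vars (length w) k. (if 0 \<le> x v then 1 else 0 :: ratfun) * (if 0 \<le> x None - 1 - x v then 1 else 0)) \<noteq> 0"
    using nz unfolding path_weight_def by auto
  then have "(if 0 \<le> x v then 1 else 0 :: ratfun) * (if 0 \<le> x None - 1 - x v then 1 else 0) \<noteq> 0"
    using v finite_path_vars by (simp only: prod_zero_iff finite_path_vars) blast
  then show ?thesis by (auto split: if_splits)
qed

section \<open>The quantum trace as a sum over paths of states\<close>

definition state_paths :: "nat \<Rightarrow> nat \<Rightarrow> nat \<Rightarrow> nat list list set" where
  "state_paths N k len = {l. length l = Suc len \<and> set l \<subseteq> color_states N k}"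

lemma finite_color_states: "finite (color_states N k)"
proof -
  have "color_states N k = {s. set s \<subseteq> {..<N} \<and> length s = k}" by (auto simp: color_states_def)
  then show ?thesis by (simp add: finite_lists_length_eq)
qed

lemma state_paths_Suc:
  "state_paths N k (Suc len) = (\<lambda>(a, l). a # l) ` (color_states N k \<times> state_paths N k len)"
proof (rule equalityI; rule subsetI)
  fix l assume "l \<in> state_paths N k (Suc len)"
  then show "l \<in> (\<lambda>(a, l). a # l) ` (color_states N k \<times> state_paths N k len)"
    by (cases l) (auto simp: state_paths_def image_iff)
qed (auto simp: state_paths_def)

text \<open>The iterated matrix product is expanded over all intermediate states. The endpoints
  enter as conditions under the sum, so that one index set serves all matrix entries and the
  trace.\<close>

lemma braid_entry_eq_sum_paths:
  assumes "s \<in> color_states N k" "r \<in> color_states N k"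
  shows "braid_entry N k w s r = (\<Sum>l\<in>state_paths N k (length w).
    if l ! 0 = s \<and> l ! length w = r then \<Prod>t<length w. letter_entry N (w ! t) (l ! t) (l ! Suc t) else 0)"
  using assms(1)
proof (induction w arbitrary: s)
  case Nil
  have "state_paths N k 0 = (\<lambda>a. [a]) ` color_states N k"
    by (auto simp: state_paths_def length_Suc_conv)
  then have "(\<Sum>l\<in>state_paths N k 0. if l ! 0 = s \<and> l ! 0 = r then 1 else 0 :: ratfun)
      = (\<Sum>a\<in>color_states N k. if a = s \<and> a = r then 1 else 0)"
    by (simp add: sum.reindex inj_on_def)
  also have "\<dots> = (\<Sum>a\<in>color_states N k. if a = s then if s = r then 1 else 0 else 0)"
    by (rule sum.cong) auto
  also have "\<dots> = (if s = r then 1 else 0)"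
    using Nil finite_color_states by simp
  finally show ?case by (simp cong: if_cong)
next
  case (Cons g w)
  let ?n = "length w"
  let ?P = "\<lambda>l. \<Prod>t<?n. letter_entry N (w ! t) (l ! t) (l ! Suc t)"
  have "(\<Sum>l\<in>state_paths N k (Suc ?n). if l ! 0 = s \<and> l ! Suc ?n = r
      then \<Prod>t<Suc ?n. letter_entry N ((g # w) ! t) (l ! t) (l ! Suc t) else 0)
    = (\<Sum>(a, l)\<in>color_states N k \<times> state_paths N k ?n. if a = s then
        (if l ! ?n = r then letter_entry N g s (l ! 0) * ?P l else 0) else 0)"
    unfolding state_paths_Suc
    by (subst sum.reindex) (auto simp: inj_on_def prod.lessThan_Suc_shift case_prod_unfold intro!: sum.cong
        simp del: prod.lessThan_Suc)
  also have "\<dots> = (\<Sum>l\<in>state_paths N k ?n. \<Sum>a\<in>color_states N k. if a = s then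
        (if l ! ?n = r then letter_entry N g s (l ! 0) * ?P l else 0) else 0)"
    unfolding sum.cartesian_product[symmetric] by (rule sum.swap)
  also have "\<dots> = (\<Sum>l\<in>state_paths N k ?n. if l ! ?n = r then letter_entry N g s (l ! 0) * ?P l else 0)"
    using Cons.prems finite_color_states by simp
  also have "\<dots> = (\<Sum>l\<in>state_paths N k ?n. \<Sum>u\<in>color_states N k.
      if u = l ! 0 then (if l ! ?n = r then letter_entry N g s u * ?P l else 0) else 0)"
  proof (rule sum.cong[OF refl])
    fix l assume "l \<in> state_paths N k ?n"
    then have "l ! 0 \<in> color_states N k" by (auto simp: state_paths_def)
    then show "(if l ! ?n = r then letter_entry N g s (l ! 0) * ?P l else 0) = (\<Sum>u\<in>color_states N k.
      if u = l ! 0 then (if l ! ?n = r then letter_entry N g s u * ?P l else 0) else 0)"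
      using finite_color_states by simp
  qed
  also have "\<dots> = (\<Sum>u\<in>color_states N k. \<Sum>l\<in>state_paths N k ?n.
      letter_entry N g s u * (if l ! 0 = u \<and> l ! ?n = r then ?P l else 0))"
    by (subst sum.swap) (intro sum.cong refl, auto)
  also have "\<dots> = braid_entry N k (g # w) s r"
    by (simp add: Cons.IH sum_distrib_left)
  finally show ?case by (simp only: list.size add_Suc_right add_0_right)
qed

lemma quantum_trace_eq_sum_paths:
  "quantum_trace N k w = (\<Sum>l\<in>state_paths N k (length w). if l ! 0 = l ! length w then
     (\<Prod>p<k. indet powi (2 * int (l ! 0 ! p) - int N + 1)) *
     (\<Prod>t<length w. letter_entry N (w ! t) (l ! t) (l ! Suc t)) else 0)"
proof -
  let ?P = "\<lambda>l. \<Prod>t<length w. letter_entry N (w ! t) (l ! t) (l ! Suc t)"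
  let ?m = "\<lambda>s. \<Prod>p<k. indet powi (2 * int (s ! p) - int N + 1)"
  have "quantum_trace N k w = (\<Sum>s\<in>color_states N k. \<Sum>l\<in>state_paths N k (length w).
      if s = l ! 0 then (if l ! 0 = l ! length w then ?m (l ! 0) * ?P l else 0) else 0)"
    unfolding quantum_trace_def
    by (intro sum.cong refl) (auto simp: braid_entry_eq_sum_paths sum_distrib_left intro!: sum.cong)
  also have "\<dots> = (\<Sum>l\<in>state_paths N k (length w). \<Sum>s\<in>color_states N k.
      if s = l ! 0 then (if l ! 0 = l ! length w then ?m (l ! 0) * ?P l else 0) else 0)"
    by (rule sum.swap)
  also have "\<dots> = (\<Sum>l\<in>state_paths N k (length w). if l ! 0 = l ! length w then ?m (l ! 0) * ?P l else 0)"
  proof (rule sum.cong[OF refl])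
    fix l assume "l \<in> state_paths N k (length w)"
    then have "l ! 0 \<in> color_states N k" by (auto simp: state_paths_def)
    then show "(\<Sum>s\<in>color_states N k. if s = l ! 0 then (if l ! 0 = l ! length w then ?m (l ! 0) * ?P l else 0) else 0)
      = (if l ! 0 = l ! length w then ?m (l ! 0) * ?P l else 0)"
      using finite_color_states by simp
  qed
  finally show ?thesis .
qed

lemma prod_indicator:
  "finite A \<Longrightarrow> (\<Prod>a\<in>A. if P a then 1 else 0 :: 'b::comm_semiring_1) = (if \<forall>a\<in>A. P a then 1 else 0)"
  by (induction A rule: finite_induct) auto

lemma path_weight_eq:
  assumes w: "braid_word k w" and N: "N \<ge> 1" and l: "l \<in> state_paths N k (length w)"
    and x: "x None = int N" "\<And>t p. t \<le> length w \<Longrightarrow> p < k \<Longrightarrow> x (Some (t, p)) = int (l ! t ! p)"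
  shows "path_weight k w x = inverse (qbrace N) * (if l ! 0 = l ! length w then
     (\<Prod>p<k. indet powi (2 * int (l ! 0 ! p) - int N + 1)) *
     (\<Prod>t<length w. letter_entry N (w ! t) (l ! t) (l ! Suc t)) else 0)"
proof -
  have st: "length (l ! t) = k" "set (l ! t) \<subseteq> {..<N}" if "t \<le> length w" for t
  proof -
    have "l ! t \<in> color_states N k"
      using l that nth_mem[of t l] by (auto simp: state_paths_def)
    then show "length (l ! t) = k" "set (l ! t) \<subseteq> {..<N}" by (simp_all add: color_states_def)
  qed
  have lt: "l ! t ! p < N" if "t \<le> length w" "p < k" for t p
    using st[OF that(1)] that(2) by (metis lessThan_iff nth_mem subsetD)
  have 1: "(\<Prod>v\<in>path_vars (length w) k. (if 0 \<le> x v then 1 else 0) * (if 0 \<le> x None - 1 - x v then 1 else 0)) = (1::ratfun)"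
  proof (rule prod.neutral, rule ballI)
    fix v assume "v \<in> path_vars (length w) k"
    then obtain t p where tp: "v = Some (t, p)" "t \<le> length w" "p < k" by (auto simp: path_vars_def)
    then show "(if 0 \<le> x v then 1 else 0) * (if 0 \<le> x None - 1 - x v then 1 else 0) = (1::ratfun)"
      using lt[OF tp(2,3)] by (simp add: x)
  qed
  have 2: "brace_fact (x None - 1) * inv_brace_fact (x None) = inverse (qbrace N)"
  proof -
    have "qbrace_fact N = qbrace_fact (N - 1) * qbrace N" by (rule qbrace_fact_rec[OF N])
    moreover have "nat (int N - 1) = N - 1" by simp
    ultimately show ?thesis using N by (simp add: brace_fact_def inv_brace_fact_def x)
  qed
  have 3: "(\<Prod>p<k. (if x (Some (0, p)) = x (Some (length w, p)) then 1 else 0) *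
        indet powi (2 * x (Some (0, p)) - x None + 1))
      = (if l ! 0 = l ! length w then \<Prod>p<k. indet powi (2 * int (l ! 0 ! p) - int N + 1) else 0)"
  proof -
    have "(l ! 0 = l ! length w) = (\<forall>p\<in>{..<k}. x (Some (0, p)) = x (Some (length w, p)))"
      using st[of 0] st[of "length w"] by (auto simp: x list_eq_iff_nth_eq)
    then show ?thesis
      by (simp only: prod.distrib prod_indicator finite_lessThan) (simp add: x)
  qed
  have 4: "letter_weight k t (w ! t) x = letter_entry N (w ! t) (l ! t) (l ! Suc t)" if t: "t < length w" for t
  proof -
    obtain p e where pe: "w ! t = (p, e)" by (cases "w ! t") auto
    then have p: "Suc p < k" using w t nth_mem[OF t] by (auto simp: braid_word_def)
    have "R_int e (x None) (x (Some (t, p))) (x (Some (t, Suc p))) (x (Some (Suc t, p))) (x (Some (Suc t, Suc p)))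
      = (if e then R_matrix else R_matrix_inv) N (l ! t ! p) (l ! t ! Suc p) (l ! Suc t ! p) (l ! Suc t ! Suc p)"
      using t p by (simp only: x Suc_leI less_imp_le Suc_lessD) (rule R_int_eq, auto intro!: lt)
    moreover have "(\<forall>y\<in>{..<k} - {p, Suc p}. x (Some (t, y)) = x (Some (Suc t, y)))
      = (\<forall>y<length (l ! t). y \<noteq> p \<and> y \<noteq> Suc p \<longrightarrow> l ! t ! y = l ! Suc t ! y)"
      using t st[of t] by (auto simp: x)
    ultimately show ?thesis
      unfolding letter_weight_def letter_entry_def pe prod.case
      by (simp only: prod_indicator finite_Diff finite_lessThan) (simp only: if_distrib[of "\<lambda>t. t * _"] mult_1_left mult_zero_left)
  qed
  have 5: "(\<Prod>t<length w. letter_weight k t (w ! t) x) = (\<Prod>t<length w. letter_entry N (w ! t) (l ! t) (l ! Suc t))"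
    by (rule prod.cong) (simp_all add: 4)
  show ?thesis
    unfolding path_weight_def 1 2 3 5 by simp
qed

text \<open>Lists of states are exchanged for functions on \<open>path_vars\<close>, the form in
  which the recurrence theorem sums; \<open>qbrace N\<close> undoes the normalization contained in
  \<open>path_weight\<close>.\<close>

lemma quantum_trace_eq_sum_path_weight:
  assumes w: "braid_word k w" and N: "N \<ge> 1"
  shows "quantum_trace N k w = qbrace N * (\<Sum>\<sigma>\<in>path_vars (length w) k \<rightarrow>\<^sub>E {..<N}.
    path_weight k w (\<lambda>v. if v = None then int N else int (\<sigma> v)))"
proof -
  let ?S = "path_vars (length w) k"
  let ?t = "\<lambda>l. if l ! 0 = l ! length w then
     (\<Prod>p<k. indet powi (2 * int (l ! 0 ! p) - int N + 1)) *
     (\<Prod>t<length w. letter_entry N (w ! t) (l ! t) (l ! Suc t)) else 0"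
  \<comment> \<open>The value at \<open>None\<close> is a dummy, since \<open>None\<close> is not in
    \<open>?S\<close>.\<close>
  let ?to = "\<lambda>l. \<lambda>v\<in>?S. case v of Some (t, p) \<Rightarrow> l ! t ! p | None \<Rightarrow> 0"
  let ?from = "\<lambda>\<sigma>. map (\<lambda>t. map (\<lambda>p. \<sigma> (Some (t, p))) [0..<k]) [0..<Suc (length w)]"
  have nz: "qbrace N \<noteq> 0" by (rule qbrace_nonzero[OF N])
  have "(\<Sum>\<sigma>\<in>?S \<rightarrow>\<^sub>E {..<N}. path_weight k w (\<lambda>v. if v = None then int N else int (\<sigma> v)))
    = (\<Sum>l\<in>state_paths N k (length w). inverse (qbrace N) * ?t l)"
  proof (rule sum.reindex_bij_witness[of _ ?to ?from])
    fix \<sigma> assume \<sigma>: "\<sigma> \<in> ?S \<rightarrow>\<^sub>E {..<N}"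
    have nth: "?from \<sigma> ! t ! p = \<sigma> (Some (t, p))" if "t \<le> length w" "p < k" for t p
    proof -
      have "[0..<Suc (length w)] ! t = t" using that by (subst nth_upt) auto
      then show ?thesis using that by (simp del: upt_Suc)
    qed
    show "?to (?from \<sigma>) = \<sigma>"
    proof (rule ext)
      fix v
      show "?to (?from \<sigma>) v = \<sigma> v"
      proof (cases "v \<in> ?S")
        case True
        then obtain t p where tp: "v = Some (t, p)" "t \<le> length w" "p < k" by (auto simp: path_vars_def)
        show ?thesis using True nth[OF tp(2,3)] unfolding tp(1) by (simp del: upt_Suc)
      next
        case False
        then show ?thesis using PiE_arb[OF \<sigma> False] by simp
      qed
    qed
    have in_S: "Some (t, p) \<in> ?S" if "t \<le> length w" "p < k" for t p
      using that by (auto simp: path_vars_def)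
    show l: "?from \<sigma> \<in> state_paths N k (length w)"
      using \<sigma> in_S by (auto simp: state_paths_def color_states_def PiE_iff simp del: upt_Suc)
    show "inverse (qbrace N) * ?t (?from \<sigma>) = path_weight k w (\<lambda>v. if v = None then int N else int (\<sigma> v))"
      by (rule path_weight_eq[OF w N l, symmetric]) (use nth in \<open>auto simp del: upt_Suc\<close>)
  next
    fix l assume l: "l \<in> state_paths N k (length w)"
    have st: "length (l ! t) = k" "set (l ! t) \<subseteq> {..<N}" if "t \<le> length w" for t
    proof -
      have "l ! t \<in> color_states N k"
        using l that nth_mem[of t l] by (auto simp: state_paths_def)
      then show "length (l ! t) = k" "set (l ! t) \<subseteq> {..<N}" by (simp_all add: color_states_def)
    qed
    show "?to l \<in> ?S \<rightarrow>\<^sub>E {..<N}"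
    proof (rule PiE_I)
      fix v assume v: "v \<in> ?S"
      then obtain t p where tp: "v = Some (t, p)" "t \<le> length w" "p < k" by (auto simp: path_vars_def)
      have "l ! t ! p < N" using st[OF tp(2)] tp(3) by (metis lessThan_iff nth_mem subsetD)
      then show "?to l v \<in> {..<N}" using v tp(1) by simp
    qed simp
    have len: "length l = Suc (length w)" using l by (simp add: state_paths_def)
    show "?from (?to l) = l"
    proof (rule nth_equalityI)
      show "length (?from (?to l)) = length l" using len by simp
      fix t assume "t < length (?from (?to l))"
      then have t: "t \<le> length w" by simp
      then have "[0..<Suc (length w)] ! t = t" by (subst nth_upt) auto
      then have "?from (?to l) ! t = map (\<lambda>p. ?to l (Some (t, p))) [0..<k]"
        using t by (simp del: upt_Suc)
      also have "\<dots> = map (\<lambda>p. l ! t ! p) [0..<k]"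
        by (rule map_cong) (use t in \<open>auto simp: path_vars_def\<close>)
      also have "\<dots> = l ! t" using st(1)[OF t] by (metis map_nth)
      finally show "?from (?to l) ! t = l ! t" .
    qed
  qed
  then show ?thesis
    unfolding quantum_trace_eq_sum_paths using nz by (simp add: sum_distrib_left mult.assoc[symmetric])
qed

section \<open>Descent of the recurrence to integral Laurent polynomials\<close>

lemma poly_to_fract_sum: "to_fract (sum f A) = (\<Sum>a\<in>A. to_fract (f a))"
  by (induction A rule: infinite_finite_induct) simp_all

lemma q_fun_independent:
  assumes "(\<Sum>k\<le>n. of_int (c k) * q_fun ^ k) = 0"
  shows "\<forall>k\<le>n. c k = (0::int)"
proof -
  have of_int: "to_fract (of_int a) = (of_int a :: ratfun)" for a
  proof -
    have nat: "to_fract (of_nat m) = (of_nat m :: ratfun)" for m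
      by (induction m) (simp_all add: to_fract_add)
    obtain m n where "a = int m - int n" by (metis int_diff_cases)
    then show ?thesis by (simp add: nat to_fract_diff)
  qed
  let ?p = "\<Sum>k\<le>n. of_int (c k) * [:0, 1 :: complex:] ^ (2 * k)"
  have "to_fract ?p = (\<Sum>k\<le>n. of_int (c k) * q_fun ^ k)"
    unfolding poly_to_fract_sum by (simp only: to_fract_mult of_int to_fract_var_power power_mult[symmetric])
  then have "to_fract ?p = to_fract 0" unfolding assms by (simp only: to_fract_0)
  then have "?p = 0" by (simp only: to_fract_eq_iff)
  moreover have "?p = (\<Sum>k\<le>n. monom (of_int (c k)) (2 * k))"
    by (rule sum.cong) (auto simp: monom_altdef of_int_poly)
  ultimately have p: "(\<Sum>k\<le>n. monom (of_int (c k) :: complex) (2 * k)) = 0" by simp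
  show ?thesis
  proof (intro allI impI)
    fix k assume k: "k \<le> n"
    have "0 = coeff (\<Sum>k\<le>n. monom (of_int (c k) :: complex) (2 * k)) (2 * k)" by (simp add: p)
    also have "\<dots> = (\<Sum>i\<le>n. if i = k then of_int (c i) else 0)"
      unfolding coeff_sum by (rule sum.cong) auto
    also have "\<dots> = of_int (c k)" using k by simp
    finally show "c k = 0" by simp
  qed
qed

lemma laurent_eq_0_if_at_q_fun:
  assumes "laurent_at a q_fun = 0"
  shows "a = 0"
  by (rule laurent_eq_0_if_laurent_at_eq_0[of q_fun]) (use assms q_fun_independent in auto)

text \<open>With \<open>1 / {n}\<close> absorbed into the summand, the invariant and the state sum
  differ by the factor \<open>{1}\<close>, which does not depend on \<open>n\<close>. Hence they
  share the recurrence, and evaluation at \<open>q = v^2\<close> is injective on Laurent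
  polynomials.\<close>

lemma colored_jones_recurrence:
  assumes "colored_jones K J"
  shows "\<exists>L c. (\<exists>i\<le>L. \<exists>j\<le>L. c i j \<noteq> 0) \<and>
    (\<forall>n\<ge>1. (\<Sum>(i, j)\<in>{..L} \<times> {..L}. c i j * Poly_Mapping.single (int i * int n) 1 * J (n + 4 * j)) = (0::laurent))"
proof -
  obtain k w where cl: "is_closure_of K k w"
    and J: "\<And>n. n \<ge> 1 \<Longrightarrow> laurent_at (J n) q_fun = qbrace 1 / qbrace n * quantum_trace n k w"
    using assms unfolding colored_jones_def by blast
  have w: "braid_word k w" using cl by (simp add: is_closure_of_def)
  define T where "T = (\<lambda>n. \<Sum>\<sigma>\<in>path_vars (length w) k \<rightarrow>\<^sub>E {..<n}.
    path_weight k w (\<lambda>v. if v = None then int n else int (\<sigma> v)))"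
  have JT: "laurent_at (J n) q_fun = qbrace 1 * T n" if n: "n \<ge> 1" for n
    unfolding J[OF n] quantum_trace_eq_sum_path_weight[OF w n] T_def using qbrace_nonzero[OF n] by simp
  have "\<exists>L c. (\<forall>i j. c i j \<in> q_ring) \<and> (\<exists>i\<le>L. \<exists>j\<le>L. c i j \<noteq> 0) \<and>
    (\<forall>n\<ge>1. (\<Sum>(i, j)\<in>{..L} \<times> {..L}. c i j * (q_fun powi (int i * int n) * T (n + 4 * j))) = 0)"
    unfolding T_def
  proof (rule proper_sum_recurrence[OF proper_path_weight[OF w] finite_path_vars])
    show "None \<notin> path_vars (length w) k" by (auto simp: path_vars_def)
    show "path_weight k w x = path_weight k w y"
      if "\<And>v. v \<in> insert None (path_vars (length w) k) \<Longrightarrow> x v = y v" for x y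
      by (rule path_weight_cong[OF w that])
    show "0 \<le> x v \<and> x v < x None" if "v \<in> path_vars (length w) k" "path_weight k w x \<noteq> 0" for x v
      by (rule path_weight_support[OF that])
  qed
  then obtain L c where c: "\<And>i j. c i j \<in> q_ring" "\<exists>i\<le>L. \<exists>j\<le>L. c i j \<noteq> 0"
    and rel: "\<And>n. n \<ge> 1 \<Longrightarrow> (\<Sum>(i, j)\<in>{..L} \<times> {..L}. c i j * (q_fun powi (int i * int n) * T (n + 4 * j))) = 0"
    by blast
  have "\<forall>i. \<forall>j. \<exists>b. c i j = laurent_at b q_fun"
    using c(1) q_ring_laurent_at by metis
  then have "\<exists>b. \<forall>i j. c i j = laurent_at (b i j) q_fun"
    by (intro choice allI) (blast intro: choice)
  then obtain b where b: "\<And>i j. c i j = laurent_at (b i j) q_fun" by blast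
  have u: "q_fun * inverse q_fun = 1" by simp
  show ?thesis
  proof (rule exI[of _ L], rule exI[of _ b], intro conjI allI impI)
    show "\<exists>i\<le>L. \<exists>j\<le>L. b i j \<noteq> 0" using c(2) b by force
    fix n :: nat assume n: "1 \<le> n"
    have "laurent_at (\<Sum>(i, j)\<in>{..L} \<times> {..L}. b i j * Poly_Mapping.single (int i * int n) 1 * J (n + 4 * j)) q_fun
      = (\<Sum>(i, j)\<in>{..L} \<times> {..L}. c i j * q_fun powi (int i * int n) * (qbrace 1 * T (n + 4 * j)))"
      unfolding laurent_at_sum
      by (rule sum.cong) (use n in \<open>auto simp: laurent_at_mult[OF u] b[symmetric] JT simp del: power_int_of_nat\<close>)
    also have "\<dots> = qbrace 1 * (\<Sum>(i, j)\<in>{..L} \<times> {..L}. c i j * (q_fun powi (int i * int n) * T (n + 4 * j)))"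
      by (simp add: sum_distrib_left case_prod_unfold mult_ac)
    also have "\<dots> = 0" unfolding rel[OF n] by simp
    finally show "(\<Sum>(i, j)\<in>{..L} \<times> {..L}. b i j * Poly_Mapping.single (int i * int n) 1 * J (n + 4 * j)) = 0"
      by (rule laurent_eq_0_if_at_q_fun)
  qed
qed

section \<open>Substitution in power series\<close>

lemma const_fun_simps [simp]:
  "const_fun 0 = 0" "const_fun 1 = 1" "const_fun (a + b) = const_fun a + const_fun b"
  "const_fun (a * b) = const_fun a * const_fun b"
proof -
  show "const_fun (a + b) = const_fun a + const_fun b"
    by (simp add: const_fun_def flip: to_fract_add)
  show "const_fun (a * b) = const_fun a * const_fun b"
    by (simp add: const_fun_def flip: to_fract_mult)
qed (simp_all add: const_fun_def flip: one_pCons)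

lemma const_fun_eq_iff [simp]: "const_fun a = const_fun b \<longleftrightarrow> a = b"
  by (simp add: const_fun_def)

lemma const_fun_eq_0_iff [simp]: "const_fun a = 0 \<longleftrightarrow> a = 0"
  using const_fun_eq_iff[of a 0] by simp

lemma const_fun_sum: "const_fun (sum f A) = (\<Sum>a\<in>A. const_fun (f a))"
  by (induction A rule: infinite_finite_induct) simp_all

lemma const_fun_power: "const_fun (a ^ n) = const_fun a ^ n"
  by (induction n) simp_all

lemma const_fun_of_nat: "const_fun (of_nat n) = of_nat n"
  by (induction n) simp_all

lemma const_fun_of_int: "const_fun (of_int i) = of_int i"
proof -
  obtain m n where i: "i = int m - int n" by (metis int_diff_cases)
  have "const_fun (of_int i) + const_fun (of_nat n) = of_nat m"
    unfolding const_fun_simps(3)[symmetric] by (simp add: i const_fun_of_nat)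
  then show ?thesis by (simp add: i const_fun_of_nat eq_diff_eq)
qed

lemma const_fun_inverse: "const_fun (inverse a) = inverse (const_fun a)"
proof (cases "a = 0")
  case False
  then have "const_fun a * const_fun (inverse a) = 1"
    unfolding const_fun_simps(4)[symmetric] by simp
  then show ?thesis by (metis inverse_unique)
qed simp

definition poly_at :: "ratfun fps \<Rightarrow> complex poly \<Rightarrow> ratfun fps" where
  "poly_at u p = poly (map_poly (\<lambda>c. fps_const (const_fun c)) p) u"

lemma poly_at_pCons: "poly_at u (pCons a p) = fps_const (const_fun a) + u * poly_at u p"
  by (cases "pCons a p = 0") (simp_all add: poly_at_def map_poly_pCons)

lemma poly_at_0 [simp]: "poly_at u 0 = 0"
  by (simp add: poly_at_def)

lemma poly_at_add: "poly_at u (p + r) = poly_at u p + poly_at u r"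
  by (induction p r rule: poly_induct2) (simp_all add: poly_at_pCons algebra_simps flip: fps_const_add)

lemma poly_at_smult: "poly_at u (Polynomial.smult a p) = fps_const (const_fun a) * poly_at u p"
  by (induction p) (simp_all add: poly_at_pCons algebra_simps flip: fps_const_mult)

lemma poly_at_mult: "poly_at u (p * r) = poly_at u p * poly_at u r"
  by (induction p) (simp_all add: poly_at_pCons poly_at_add poly_at_smult algebra_simps)

lemma poly_at_1 [simp]: "poly_at u 1 = 1"
  by (simp add: one_pCons poly_at_pCons)

lemma poly_at_power: "poly_at u (p ^ n) = poly_at u p ^ n"
  by (induction n) (simp_all add: poly_at_mult)

lemma poly_at_nth_0_const:
  assumes "fps_nth u 0 = const_fun c"
  shows "fps_nth (poly_at u p) 0 = const_fun (poly p c)"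
  by (induction p) (simp_all add: poly_at_pCons assms)

lemma poly_at_nth_0_scale:
  assumes "fps_nth u 0 = const_fun c * indet"
  shows "fps_nth (poly_at u p) 0 = to_fract (pcompose p [:0, c:])"
proof (induction p)
  case (pCons a p)
  have "const_fun c * indet = to_fract [:0, c:]"
    unfolding const_fun_def indet_def to_fract_mult[symmetric] by simp
  then have "fps_nth (poly_at u (pCons a p)) 0 = to_fract [:a:] + to_fract [:0, c:] * to_fract (pcompose p [:0, c:])"
    using pCons by (simp add: poly_at_pCons assms) (simp add: const_fun_def)
  then show ?case by (simp only: pcompose_pCons to_fract_add to_fract_mult)
qed simp

text \<open>The domain on which substituting \<open>u\<close> is meaningful: outside it the reduced
  denominator takes a value without constant term, whose \<open>inverse\<close> is 0.\<close>

definition regular_ring :: "ratfun fps \<Rightarrow> ratfun set" where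
  "regular_ring u = {g. \<exists>a b. g = to_fract a / to_fract b \<and> fps_nth (poly_at u b) 0 \<noteq> 0}"

text \<open>\<open>subst_coeff\<close> uses the fraction in lowest terms. Its denominator
  \<open>d\<close> divides \<open>b\<close>, so the values of \<open>d\<close> and of the cofactor
  \<open>e\<close> at \<open>u\<close> are units, and \<open>e\<close> cancels. Sums and products
  can then be computed with any common denominator.\<close>

lemma subst_coeff_eq:
  assumes g: "g = to_fract a / to_fract b" and b: "fps_nth (poly_at u b) 0 \<noteq> 0"
  shows "subst_coeff u g = poly_at u a * inverse (poly_at u b)"
proof -
  obtain c d where cd: "quot_of_fract g = (c, d)" by force
  have d0: "d \<noteq> 0" using snd_quot_of_fract_nonzero[of g] cd by simp
  have b0: "b \<noteq> 0" using b by auto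
  have "to_fract c / to_fract d = g"
    using Fract_quot_of_fract[of g] cd by (simp add: Fract_conv_to_fract)
  then have "to_fract (c * b) = to_fract (a * d)"
    using g d0 b0 by (simp add: field_simps to_fract_mult)
  then have cb: "c * b = a * d" by (simp only: to_fract_eq_iff)
  have "coprime c d" using coprime_quot_of_fract[of g] cd by simp
  moreover have "d dvd c * b" unfolding cb by simp
  ultimately have "d dvd b" by (metis coprime_commute coprime_dvd_mult_right_iff)
  then obtain e where e: "b = d * e" by auto
  have a: "a = c * e" using cb d0 unfolding e by (simp add: mult_ac)
  have "fps_nth (poly_at u d) 0 \<noteq> 0" "fps_nth (poly_at u e) 0 \<noteq> 0"
    using b unfolding e poly_at_mult by auto
  then have "poly_at u a * inverse (poly_at u b) = poly_at u c * inverse (poly_at u d)"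
    unfolding a e poly_at_mult fps_inverse_mult
    by (metis (no_types, lifting) inverse_mult_eq_1' mult.assoc mult.left_commute mult.right_neutral)
  then show ?thesis by (simp add: subst_coeff_def cd poly_at_def)
qed

lemma subst_coeff_hom:
  assumes "g \<in> regular_ring u" "h \<in> regular_ring u"
  shows subst_coeff_add: "subst_coeff u (g + h) = subst_coeff u g + subst_coeff u h"
    and subst_coeff_mult: "subst_coeff u (g * h) = subst_coeff u g * subst_coeff u h"
    and regular_ring_diff: "g - h \<in> regular_ring u"
    and regular_ring_mult: "g * h \<in> regular_ring u"
proof -
  obtain a b where ab: "g = to_fract a / to_fract b" "fps_nth (poly_at u b) 0 \<noteq> 0"
    using assms(1) by (auto simp: regular_ring_def)
  obtain c d where cd: "h = to_fract c / to_fract d" "fps_nth (poly_at u d) 0 \<noteq> 0"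
    using assms(2) by (auto simp: regular_ring_def)
  have nz: "to_fract b \<noteq> 0" "to_fract d \<noteq> 0" using ab(2) cd(2) by auto
  have bd: "fps_nth (poly_at u (b * d)) 0 \<noteq> 0" using ab(2) cd(2) by (simp add: poly_at_mult)
  have add: "g + h = to_fract (a * d + c * b) / to_fract (b * d)"
    unfolding ab(1) cd(1) using nz by (simp add: to_fract_add to_fract_mult field_simps)
  have diff: "g - h = to_fract (a * d - c * b) / to_fract (b * d)"
    unfolding ab(1) cd(1) using nz by (simp add: to_fract_diff to_fract_mult field_simps)
  have mult: "g * h = to_fract (a * c) / to_fract (b * d)"
    unfolding ab(1) cd(1) by (simp add: to_fract_mult)
  note g = subst_coeff_eq[OF ab] and h = subst_coeff_eq[OF cd]
  let ?B = "inverse (poly_at u b)" and ?D = "inverse (poly_at u d)"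
  have B: "poly_at u b * ?B = 1" "poly_at u d * ?D = 1"
    using ab(2) cd(2) by (simp_all add: inverse_mult_eq_1')
  show "subst_coeff u (g + h) = subst_coeff u g + subst_coeff u h"
  proof -
    have "subst_coeff u (g + h) = (poly_at u a * poly_at u d + poly_at u c * poly_at u b) * (?B * ?D)"
      unfolding subst_coeff_eq[OF add bd] by (simp add: poly_at_add poly_at_mult fps_inverse_mult)
    also have "\<dots> = poly_at u a * ?B * (poly_at u d * ?D) + poly_at u c * ?D * (poly_at u b * ?B)"
      by (simp add: algebra_simps)
    finally show ?thesis unfolding B g h by simp
  qed
  show "subst_coeff u (g * h) = subst_coeff u g * subst_coeff u h"
    unfolding subst_coeff_eq[OF mult bd] g h by (simp add: poly_at_mult fps_inverse_mult mult_ac)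
  show "g - h \<in> regular_ring u" unfolding regular_ring_def using diff bd by blast
  show "g * h \<in> regular_ring u" unfolding regular_ring_def using mult bd by blast
qed

lemma to_fract_in_regular_ring: "to_fract p \<in> regular_ring u"
  unfolding regular_ring_def by (rule CollectI, rule exI[of _ p], rule exI[of _ 1]) simp

lemma const_fun_in_regular_ring: "const_fun c \<in> regular_ring u"
  by (simp add: const_fun_def to_fract_in_regular_ring)

lemma subst_coeff_to_fract: "subst_coeff u (to_fract p) = poly_at u p"
  using subst_coeff_eq[of "to_fract p" p 1 u] by simp

lemma subst_coeff_const_fun: "subst_coeff u (const_fun c) = fps_const (const_fun c)"
  by (simp add: const_fun_def subst_coeff_to_fract poly_at_pCons)

lemma subst_coeff_indet: "subst_coeff u indet = u"
  by (simp add: indet_def subst_coeff_to_fract poly_at_pCons)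

lemma is_subring_regular_ring: "is_subring (regular_ring u)"
proof -
  have "1 \<in> regular_ring u" using to_fract_in_regular_ring[of 1 u] by simp
  then show ?thesis by (simp add: is_subring_def regular_ring_diff regular_ring_mult)
qed

lemma subst_coeff_0 [simp]: "subst_coeff u 0 = 0"
  using subst_coeff_const_fun[of u 0] by simp

lemma subst_coeff_1 [simp]: "subst_coeff u 1 = 1"
  using subst_coeff_const_fun[of u 1] by simp

lemma subst_coeff_sum:
  assumes "\<And>i. i \<in> I \<Longrightarrow> f i \<in> regular_ring u"
  shows "subst_coeff u (sum f I) = (\<Sum>i\<in>I. subst_coeff u (f i))"
  using assms
  by (induction I rule: infinite_finite_induct)
    (simp_all add: subst_coeff_add is_subring_sum[OF is_subring_regular_ring])

text \<open>The diagonal of a series in two variables. It separates the two roles of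
  \<open>q - z\<close> in \<open>subst\<close>: the variable of the given series, and the variable
  of the series obtained from its coefficients.\<close>

definition equate_variables :: "'a::comm_ring_1 fps fps \<Rightarrow> 'a fps" where
  "equate_variables F = Abs_fps (\<lambda>n. \<Sum>k\<le>n. fps_nth (fps_nth F k) (n - k))"

lemma equate_variables_mult: "equate_variables (F * G) = equate_variables F * equate_variables G"
proof (rule fps_ext)
  fix n
  let ?F = "\<lambda>i a. fps_nth (fps_nth F i) a" and ?G = "\<lambda>i a. fps_nth (fps_nth G i) a"
  have "fps_nth (equate_variables (F * G)) n
      = (\<Sum>k\<le>n. \<Sum>i\<le>k. \<Sum>a\<le>n - k. ?F i a * ?G (k - i) (n - k - a))"
    by (simp add: equate_variables_def fps_mult_nth fps_sum_nth atLeast0AtMost)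
  also have "\<dots> = (\<Sum>(k, i, a)\<in>Sigma {..n} (\<lambda>k. {..k} \<times> {..n - k}). ?F i a * ?G (k - i) (n - k - a))"
    by (simp add: sum.Sigma sum.cartesian_product)
  \<comment> \<open>Here \<open>b\<close> is the total order taken from \<open>F\<close>, while
    \<open>i\<close> and \<open>j\<close> are the outer orders in \<open>F\<close> and
    \<open>G\<close>; for fixed \<open>b\<close> the sum factors.\<close>
  also have "\<dots> = (\<Sum>(b, i, j)\<in>Sigma {..n} (\<lambda>b. {..b} \<times> {..n - b}). ?F i (b - i) * ?G j (n - b - j))"
    by (rule sum.reindex_bij_witness[of _ "\<lambda>(b, i, j). (i + j, i, b - i)" "\<lambda>(k, i, a). (i + a, i, k - i)"])
      (auto simp: algebra_simps)
  also have "\<dots> = (\<Sum>b\<le>n. (\<Sum>i\<le>b. ?F i (b - i)) * (\<Sum>j\<le>n - b. ?G j (n - b - j)))"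
    by (simp add: sum.Sigma sum.cartesian_product sum_product)
  also have "\<dots> = fps_nth (equate_variables F * equate_variables G) n"
    by (simp add: equate_variables_def fps_mult_nth atLeast0AtMost)
  finally show "fps_nth (equate_variables (F * G)) n = fps_nth (equate_variables F * equate_variables G) n" .
qed

lemma subst_eq_equate_variables: "subst u f = equate_variables (Abs_fps (\<lambda>k. subst_coeff u (fps_nth f k)))"
  by (simp add: subst_def equate_variables_def)

lemma subst_add:
  assumes "f \<in> coeffs_in (regular_ring u)" "g \<in> coeffs_in (regular_ring u)"
  shows "subst u (f + g) = subst u f + subst u g"
  by (rule fps_ext) (use assms in \<open>simp add: subst_def coeffs_in_def subst_coeff_add sum.distrib\<close>)

lemma subst_mult:
  assumes f: "f \<in> coeffs_in (regular_ring u)" and g: "g \<in> coeffs_in (regular_ring u)"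
  shows "subst u (f * g) = subst u f * subst u g"
proof -
  have "Abs_fps (\<lambda>k. subst_coeff u (fps_nth (f * g) k))
    = Abs_fps (\<lambda>k. subst_coeff u (fps_nth f k)) * Abs_fps (\<lambda>k. subst_coeff u (fps_nth g k))"
  proof (rule fps_ext)
    fix k
    have "subst_coeff u (fps_nth (f * g) k) = (\<Sum>i=0..k. subst_coeff u (fps_nth f i * fps_nth g (k - i)))"
      unfolding fps_mult_nth
      by (rule subst_coeff_sum) (use f g in \<open>auto simp: coeffs_in_def intro: regular_ring_mult\<close>)
    also have "\<dots> = (\<Sum>i=0..k. subst_coeff u (fps_nth f i) * subst_coeff u (fps_nth g (k - i)))"
      by (rule sum.cong) (use f g in \<open>auto simp: coeffs_in_def subst_coeff_mult\<close>)
    finally show "fps_nth (Abs_fps (\<lambda>k. subst_coeff u (fps_nth (f * g) k))) k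
      = fps_nth (Abs_fps (\<lambda>k. subst_coeff u (fps_nth f k)) * Abs_fps (\<lambda>k. subst_coeff u (fps_nth g k))) k"
      by (simp add: fps_mult_nth)
  qed
  then show ?thesis unfolding subst_eq_equate_variables by (simp add: equate_variables_mult)
qed

lemma subst_fps_const: "subst u (fps_const g) = subst_coeff u g"
proof (rule fps_ext)
  fix n
  have "fps_nth (subst u (fps_const g)) n
      = (\<Sum>k\<le>n. if k = 0 then fps_nth (subst_coeff u g) n else 0)"
    unfolding subst_def fps_nth_Abs_fps by (rule sum.cong) auto
  then show "fps_nth (subst u (fps_const g)) n = fps_nth (subst_coeff u g) n" by simp
qed

lemma subst_fps_X: "subst u fps_X = fps_X"
proof (rule fps_ext)
  fix n
  have "fps_nth (subst u fps_X) n = (\<Sum>k\<le>n. if k = 1 then fps_nth 1 (n - 1) else 0)"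
    unfolding subst_def fps_nth_Abs_fps by (rule sum.cong) auto
  also have "\<dots> = fps_nth fps_X n" by (cases n) auto
  finally show "fps_nth (subst u fps_X) n = fps_nth fps_X n" .
qed

lemma subst_0 [simp]: "subst u 0 = 0"
  using subst_fps_const[of u 0] by simp

lemma subst_1 [simp]: "subst u 1 = 1"
  using subst_fps_const[of u 1] by simp

lemma subst_sum:
  assumes "\<And>i. i \<in> I \<Longrightarrow> f i \<in> coeffs_in (regular_ring u)"
  shows "subst u (sum f I) = (\<Sum>i\<in>I. subst u (f i))"
  using assms
  by (induction I rule: infinite_finite_induct)
    (simp_all add: subst_add is_subring_sum[OF is_subring_coeffs_in[OF is_subring_regular_ring]])

lemma subst_power:
  assumes "f \<in> coeffs_in (regular_ring u)"
  shows "subst u (f ^ n) = subst u f ^ n"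
  by (induction n)
    (simp_all add: assms subst_mult is_subring_power[OF is_subring_coeffs_in[OF is_subring_regular_ring]])

lemma subst_inverse:
  assumes f: "f \<in> coeffs_in (regular_ring u)" "inverse f \<in> coeffs_in (regular_ring u)"
    and 0: "fps_nth f 0 \<noteq> 0"
  shows "subst u (inverse f) = inverse (subst u f)"
proof -
  have "subst u f * subst u (inverse f) = 1"
    unfolding subst_mult[OF f, symmetric] using 0 by (simp add: inverse_mult_eq_1')
  then show ?thesis by (rule fps_inverse_unique[symmetric])
qed

lemma subst_powi:
  assumes f: "f \<in> coeffs_in (regular_ring u)" "inverse f \<in> coeffs_in (regular_ring u)"
    and 0: "fps_nth f 0 \<noteq> 0"
  shows "subst u (f powi i) = subst u f powi i"
  by (auto simp: power_int_def subst_power f subst_inverse[OF f 0])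

section \<open>The expansion of q at a root of unity and the substitution of its powers\<close>

definition q_series :: "complex \<Rightarrow> ratfun fps" where
  "q_series z = fps_const (const_fun z) + fps_X"

lemma q_at_eq: "q_at \<zeta> m = q_series (\<zeta> m)"
  by (simp add: q_at_def q_series_def)

lemma q_series_nth_0 [simp]: "fps_nth (q_series z) 0 = const_fun z"
  by (simp add: q_series_def)

lemma q_series_power_nth_0: "fps_nth (q_series z ^ n) 0 = const_fun (z ^ n)"
  by (induction n) simp_all

lemma q_series_unit: "z \<noteq> 0 \<Longrightarrow> q_series z ^ n * inverse (q_series z ^ n) = 1"
  by (rule inverse_mult_eq_1') (simp add: q_series_power_nth_0)

text \<open>Powers of \<open>z + X\<close> are linearly independent over constants, so a single
  component of the Habiro ring already determines a Laurent polynomial in \<open>q\<close>.\<close>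

lemma laurent_eq_0_if_at_q_series:
  assumes z: "z \<noteq> 0" and a: "laurent_at a (q_series z) = 0"
  shows "a = 0"
proof (rule laurent_eq_0_if_laurent_at_eq_0[OF _ _ a])
  show "q_series z * inverse (q_series z) = 1" using q_series_unit[OF z, of 1] by simp
  fix n and c :: "nat \<Rightarrow> int"
  assume "(\<Sum>k\<le>n. of_int (c k) * q_series z ^ k) = 0"
  then have *: "(\<Sum>k\<le>n. fps_const (of_int (c k)) * (fps_const (const_fun z) + fps_X) ^ k) = 0"
    by (simp add: q_series_def fps_of_int)
  show "\<forall>k\<le>n. c k = 0"
  proof (intro allI impI)
    fix k assume "k \<le> n"
    then have "(of_int (c k) :: ratfun) = 0"
      by (intro weighted_sum_eq_0[where U = "{..n}" and w = "\<lambda>k. k" and c = "\<lambda>k. of_int (c k)", OF _ _ *])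
        auto
    then have "(of_int (c k) :: complex) = 0" by (simp add: const_fun_of_int[symmetric])
    then show "c k = 0" by simp
  qed
qed

text \<open>The rational functions without poles at the powers of \<open>z\<close>: this ring contains the coefficients that
  occur, is stable under \<open>\<sigma>\<close>, and every \<open>t \<mapsto> q\<^sup>n\<close> is defined on it.\<close>

definition local_ring :: "complex \<Rightarrow> ratfun set" where
  "local_ring z = {g. \<exists>a b. g = to_fract a / to_fract b \<and> (\<forall>i. poly b (z ^ i) \<noteq> 0)}"

lemma local_ring_subset_regular_ring: "local_ring z \<subseteq> regular_ring (q_series z ^ n)"
  unfolding local_ring_def regular_ring_def
  using poly_at_nth_0_const[OF q_series_power_nth_0[of z n]] by auto

lemma to_fract_in_local_ring: "to_fract p \<in> local_ring z"
  unfolding local_ring_def by (rule CollectI, rule exI[of _ p], rule exI[of _ 1]) simp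

lemma const_fun_in_local_ring: "const_fun c \<in> local_ring z"
  by (simp add: const_fun_def to_fract_in_local_ring)

lemma indet_in_local_ring: "indet \<in> local_ring z"
  by (simp add: indet_def to_fract_in_local_ring)

lemma inverse_to_fract_in_local_ring:
  assumes "\<And>i. poly b (z ^ i) \<noteq> 0"
  shows "inverse (to_fract b) \<in> local_ring z"
  unfolding local_ring_def
  by (rule CollectI, rule exI[of _ 1], rule exI[of _ b]) (simp add: assms inverse_eq_divide)

lemma is_subring_local_ring: "is_subring (local_ring z)"
  unfolding is_subring_def
proof (intro conjI ballI)
  show "1 \<in> local_ring z" using to_fract_in_local_ring[of 1 z] by simp
  fix g h assume gh: "g \<in> local_ring z" "h \<in> local_ring z"
  obtain a b where ab: "g = to_fract a / to_fract b" "\<And>i. poly b (z ^ i) \<noteq> 0"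
    using gh(1) unfolding local_ring_def by blast
  obtain c d where cd: "h = to_fract c / to_fract d" "\<And>i. poly d (z ^ i) \<noteq> 0"
    using gh(2) unfolding local_ring_def by blast
  have nz: "to_fract b \<noteq> 0" "to_fract d \<noteq> 0" using ab(2)[of 0] cd(2)[of 0] by auto
  have bd: "\<forall>i. poly (b * d) (z ^ i) \<noteq> 0" using ab(2) cd(2) by simp
  have "g - h = to_fract (a * d - c * b) / to_fract (b * d)"
    unfolding ab(1) cd(1) using nz by (simp add: to_fract_diff to_fract_mult field_simps)
  then show "g - h \<in> local_ring z" unfolding local_ring_def using bd by blast
  have "g * h = to_fract (a * c) / to_fract (b * d)"
    unfolding ab(1) cd(1) by (simp add: to_fract_mult)
  then show "g * h \<in> local_ring z" unfolding local_ring_def using bd by blast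
qed

lemma is_subring_local_series: "is_subring (coeffs_in (local_ring z))"
  by (rule is_subring_coeffs_in[OF is_subring_local_ring])

lemma local_series_regular: "f \<in> coeffs_in (local_ring z) \<Longrightarrow> f \<in> coeffs_in (regular_ring (q_series z ^ n))"
  using local_ring_subset_regular_ring by (auto simp: coeffs_in_def)

lemma q_series_in_local_series: "q_series z \<in> coeffs_in (local_ring z)"
  unfolding q_series_def
  by (intro is_subring_add[OF is_subring_local_series] fps_const_in_coeffs_in fps_X_in_coeffs_in
      is_subring_local_ring const_fun_in_local_ring)

lemma inverse_q_series_in_local_series: "inverse (q_series z) \<in> coeffs_in (local_ring z)"
  by (rule inverse_in_coeffs_in[OF is_subring_local_ring q_series_in_local_series])
    (simp add: const_fun_inverse[symmetric] const_fun_in_local_ring)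

lemma inverse_indet_in_local_ring:
  assumes "z \<noteq> 0"
  shows "inverse indet \<in> local_ring z"
  unfolding indet_def by (rule inverse_to_fract_in_local_ring) (use assms in simp)

definition sigma_unit :: "complex \<Rightarrow> ratfun fps" where
  "sigma_unit z = q_series z * fps_const indet"

lemma sigma_unit_nth_0: "fps_nth (sigma_unit z) 0 = const_fun z * indet"
  by (simp add: sigma_unit_def)

lemma sigma_unit_in_local_series: "sigma_unit z \<in> coeffs_in (local_ring z)"
  unfolding sigma_unit_def
  by (intro is_subring_mult[OF is_subring_local_series] q_series_in_local_series fps_const_in_coeffs_in
      is_subring_local_ring indet_in_local_ring)

lemma poly_at_in_local_series:
  assumes "u \<in> coeffs_in (local_ring z)"
  shows "poly_at u p \<in> coeffs_in (local_ring z)"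
proof (induction p)
  case 0
  then show ?case by (simp add: is_subring_0[OF is_subring_local_series])
next
  case (pCons a p)
  then show ?case unfolding poly_at_pCons
    by (intro is_subring_add[OF is_subring_local_series] is_subring_mult[OF is_subring_local_series]
        fps_const_in_coeffs_in is_subring_local_ring const_fun_in_local_ring assms)
qed

lemma subst_q_power_q_series: "subst (q_series z ^ n) (q_series z) = q_series z"
  unfolding q_series_def
  by (subst subst_add)
    (simp_all add: fps_const_in_coeffs_in fps_X_in_coeffs_in is_subring_regular_ring subst_fps_const
      subst_coeff_const_fun subst_fps_X const_fun_in_regular_ring)

lemma subst_q_power_sigma_unit: "subst (q_series z ^ n) (sigma_unit z) = q_series z ^ Suc n"
proof -
  let ?u = "q_series z ^ n"
  have "subst ?u (sigma_unit z) = subst ?u (q_series z) * subst ?u (fps_const indet)"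
    unfolding sigma_unit_def
    by (rule subst_mult; rule local_series_regular)
      (simp_all add: q_series_in_local_series fps_const_in_coeffs_in is_subring_local_ring indet_in_local_ring)
  then show ?thesis by (simp add: subst_q_power_q_series subst_fps_const subst_coeff_indet)
qed

lemma subst_q_power_poly_at_sigma_unit:
  "subst (q_series z ^ n) (poly_at (sigma_unit z) p) = poly_at (q_series z ^ Suc n) p"
proof (induction p)
  case (pCons a p)
  have "subst (q_series z ^ n) (poly_at (sigma_unit z) (pCons a p))
    = subst (q_series z ^ n) (fps_const (const_fun a))
      + subst (q_series z ^ n) (sigma_unit z * poly_at (sigma_unit z) p)"
    unfolding poly_at_pCons
    by (rule subst_add; rule local_series_regular)
      (intro is_subring_mult[OF is_subring_local_series] sigma_unit_in_local_series poly_at_in_local_series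
        fps_const_in_coeffs_in is_subring_local_ring const_fun_in_local_ring)+
  also have "subst (q_series z ^ n) (sigma_unit z * poly_at (sigma_unit z) p)
    = subst (q_series z ^ n) (sigma_unit z) * subst (q_series z ^ n) (poly_at (sigma_unit z) p)"
    by (rule subst_mult; rule local_series_regular)
      (intro sigma_unit_in_local_series poly_at_in_local_series)+
  finally show ?case
    by (simp add: pCons.IH subst_q_power_sigma_unit subst_fps_const subst_coeff_const_fun poly_at_pCons
        del: power_Suc)
qed simp

text \<open>The constant term of the denominator \<open>b(q t)\<close> is \<open>b(z t)\<close>,
  whose value at \<open>z^i\<close> is the value of \<open>b\<close> at \<open>z^(i+1)\<close>. This
  is why \<open>local_ring\<close> excludes poles at all powers of \<open>z\<close>
  simultaneously.\<close>

lemma sigma_unit_coeff: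
  assumes "g \<in> local_ring z" "z \<noteq> 0"
  shows subst_sigma_unit_in_local_series: "subst_coeff (sigma_unit z) g \<in> coeffs_in (local_ring z)"
    and subst_q_power_subst_sigma_unit:
      "subst (q_series z ^ n) (subst_coeff (sigma_unit z) g) = subst_coeff (q_series z ^ Suc n) g"
proof -
  obtain a b where g: "g = to_fract a / to_fract b" and b: "\<And>i. poly b (z ^ i) \<noteq> 0"
    using assms(1) unfolding local_ring_def by blast
  let ?b = "poly_at (sigma_unit z) b"
  have b0: "fps_nth ?b 0 = to_fract (pcompose b [:0, z:])"
    by (rule poly_at_nth_0_scale[OF sigma_unit_nth_0])
  have pb: "poly (pcompose b [:0, z:]) (z ^ i) \<noteq> 0" for i
    using b[of "Suc i"] by (simp add: poly_pcompose mult.commute)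
  then have "pcompose b [:0, z:] \<noteq> 0" by force
  then have nz: "fps_nth ?b 0 \<noteq> 0" using b0 by simp
  have inv: "inverse ?b \<in> coeffs_in (local_ring z)"
    by (rule inverse_in_coeffs_in[OF is_subring_local_ring poly_at_in_local_series[OF sigma_unit_in_local_series]])
      (simp add: b0 inverse_to_fract_in_local_ring pb)
  note eq = subst_coeff_eq[OF g nz]
  show "subst_coeff (sigma_unit z) g \<in> coeffs_in (local_ring z)"
    unfolding eq
    by (intro is_subring_mult[OF is_subring_local_series] inv poly_at_in_local_series sigma_unit_in_local_series)
  have "fps_nth (poly_at (q_series z ^ Suc n) b) 0 \<noteq> 0"
    using poly_at_nth_0_const[OF q_series_power_nth_0[of z "Suc n"]] b[of "Suc n"] by (simp del: power_Suc)
  note eq' = subst_coeff_eq[OF g this]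
  have "subst (q_series z ^ n) (poly_at (sigma_unit z) a * inverse ?b)
    = subst (q_series z ^ n) (poly_at (sigma_unit z) a) * subst (q_series z ^ n) (inverse ?b)"
    by (rule subst_mult; rule local_series_regular) (intro inv poly_at_in_local_series sigma_unit_in_local_series)+
  also have "subst (q_series z ^ n) (inverse ?b) = inverse (subst (q_series z ^ n) ?b)"
    by (rule subst_inverse[OF local_series_regular local_series_regular nz])
      (intro inv poly_at_in_local_series sigma_unit_in_local_series)+
  finally show "subst (q_series z ^ n) (subst_coeff (sigma_unit z) g) = subst_coeff (q_series z ^ Suc n) g"
    unfolding eq eq' subst_q_power_poly_at_sigma_unit .
qed

lemma sigma_series:
  assumes f: "f \<in> coeffs_in (local_ring z)" and z: "z \<noteq> 0"
  shows sigma_in_local_series: "subst (sigma_unit z) f \<in> coeffs_in (local_ring z)"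
    and subst_q_power_sigma: "subst (q_series z ^ n) (subst (sigma_unit z) f) = subst (q_series z ^ Suc n) f"
proof -
  have loc: "fps_nth (subst_coeff (sigma_unit z) (fps_nth f i)) k \<in> local_ring z" for i k
    using subst_sigma_unit_in_local_series[OF coeffs_inD[OF f] z] by (rule coeffs_inD)
  then show "subst (sigma_unit z) f \<in> coeffs_in (local_ring z)"
    unfolding coeffs_in_def subst_def by (auto intro!: is_subring_sum[OF is_subring_local_ring])
  show "subst (q_series z ^ n) (subst (sigma_unit z) f) = subst (q_series z ^ Suc n) f"
  proof (rule fps_ext)
    fix N
    let ?u = "q_series z ^ n" and ?s = "\<lambda>i j. fps_nth (subst_coeff (sigma_unit z) (fps_nth f i)) j"
    have reg: "?s i j \<in> regular_ring ?u" for i j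
      using loc local_ring_subset_regular_ring by blast
    have "fps_nth (subst ?u (subst (sigma_unit z) f)) N
        = (\<Sum>k\<le>N. fps_nth (subst_coeff ?u (\<Sum>i\<le>k. ?s i (k - i))) (N - k))"
      by (simp add: subst_def)
    also have "\<dots> = (\<Sum>k\<le>N. \<Sum>i\<le>k. fps_nth (subst_coeff ?u (?s i (k - i))) (N - k))"
      by (simp add: subst_coeff_sum reg fps_sum_nth)
    also have "\<dots> = (\<Sum>(k, i)\<in>Sigma {..N} (\<lambda>k. {..k}). fps_nth (subst_coeff ?u (?s i (k - i))) (N - k))"
      by (simp add: sum.Sigma)
    \<comment> \<open>Here \<open>i\<close> is the order in the given series and \<open>j\<close>
      the additional order created by \<open>\<sigma>\<close>. Fixing \<open>i\<close> isolates one
      coefficient, for which the composition rule is known.\<close>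
    also have "\<dots> = (\<Sum>(i, j)\<in>Sigma {..N} (\<lambda>i. {..N - i}). fps_nth (subst_coeff ?u (?s i j)) (N - i - j))"
      by (rule sum.reindex_bij_witness[of _ "\<lambda>(i, j). (i + j, i)" "\<lambda>(k, i). (i, k - i)"]) auto
    also have "\<dots> = (\<Sum>i\<le>N. \<Sum>j\<le>N - i. fps_nth (subst_coeff ?u (?s i j)) (N - i - j))"
      by (simp add: sum.Sigma)
    also have "\<dots> = (\<Sum>i\<le>N. fps_nth (subst ?u (subst_coeff (sigma_unit z) (fps_nth f i))) (N - i))"
      by (simp add: subst_def)
    also have "\<dots> = fps_nth (subst (q_series z ^ Suc n) f) N"
      unfolding subst_q_power_subst_sigma_unit[OF coeffs_inD[OF f] z] by (simp add: subst_def)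
    finally show "fps_nth (subst ?u (subst (sigma_unit z) f)) N = fps_nth (subst (q_series z ^ Suc n) f) N" .
  qed
qed

section \<open>Difference operators under specialization\<close>

lemma iterate_sigma:
  assumes f: "f m \<in> coeffs_in (local_ring (\<zeta> m))" and z: "\<zeta> m \<noteq> 0"
  shows "(sigma \<zeta> ^^ j) f m \<in> coeffs_in (local_ring (\<zeta> m)) \<and>
    (\<forall>n. specialize \<zeta> n ((sigma \<zeta> ^^ j) f) m = specialize \<zeta> (n + j) f m)"
proof (induction j)
  case 0
  then show ?case using f by simp
next
  case (Suc j)
  have "(sigma \<zeta> ^^ Suc j) f m = subst (sigma_unit (\<zeta> m)) ((sigma \<zeta> ^^ j) f m)"
    by (simp add: sigma_def sigma_unit_def q_at_eq)
  then show ?case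
    using sigma_series[OF conjunct1[OF Suc.IH] z] conjunct2[OF Suc.IH, THEN spec, of "Suc _"]
    by (simp add: specialize_def q_at_eq del: power_Suc)
qed

lemma laurent2_at_local:
  assumes z: "z \<noteq> 0"
  shows laurent2_at_in_local_series: "laurent2_at a (fps_const indet) (q_series z) \<in> coeffs_in (local_ring z)"
    and subst_laurent2_at: "subst (q_series z ^ n) (laurent2_at a (fps_const indet) (q_series z))
      = laurent2_at a (q_series z ^ n) (q_series z)"
proof -
  let ?u = "q_series z ^ n" and ?t = "fps_const indet"
  have t: "?t \<in> coeffs_in (local_ring z)" "inverse ?t \<in> coeffs_in (local_ring z)"
    using indet_in_local_ring inverse_indet_in_local_ring[OF z]
    by (simp_all add: fps_const_inverse fps_const_in_coeffs_in is_subring_local_ring)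
  note q = q_series_in_local_series[of z] inverse_q_series_in_local_series[of z]
  note closed = is_subring_powi[OF is_subring_local_series] is_subring_mult[OF is_subring_local_series]
    is_subring_of_int[OF is_subring_local_series]
  show "laurent2_at a ?t (q_series z) \<in> coeffs_in (local_ring z)"
    unfolding laurent2_at_def case_prod_unfold
    by (intro is_subring_sum[OF is_subring_local_series] closed t q)
  have int: "subst ?u (of_int c) = of_int c" for c
  proof -
    have "(of_int c :: ratfun fps) = fps_const (const_fun (of_int c))"
      by (simp add: const_fun_of_int fps_of_int)
    then show ?thesis by (simp only: subst_fps_const subst_coeff_const_fun)
  qed
  have pow: "subst ?u (?t powi i) = ?u powi i" "subst ?u (q_series z powi i) = q_series z powi i" for i
    using subst_powi[OF local_series_regular[OF t(1)] local_series_regular[OF t(2)]]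
      subst_powi[OF local_series_regular[OF q(1)] local_series_regular[OF q(2)]] z
    by (simp_all add: subst_fps_const subst_coeff_indet subst_q_power_q_series)
  have "subst ?u (of_int c * (?t powi i * q_series z powi l)) = of_int c * (?u powi i * q_series z powi l)" for c i l
  proof -
    have "subst ?u (of_int c * (?t powi i * q_series z powi l))
      = subst ?u (of_int c) * subst ?u (?t powi i * q_series z powi l)"
      by (rule subst_mult; rule local_series_regular) (intro closed t q)+
    also have "subst ?u (?t powi i * q_series z powi l) = subst ?u (?t powi i) * subst ?u (q_series z powi l)"
      by (rule subst_mult; rule local_series_regular) (intro closed t q)+
    finally show ?thesis by (simp add: int pow)
  qed
  moreover have "subst ?u (laurent2_at a ?t (q_series z)) = (\<Sum>p\<in>Poly_Mapping.keys a.
      subst ?u (of_int (Poly_Mapping.lookup a p) * (?t powi fst p * q_series z powi snd p)))"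
    unfolding laurent2_at_def case_prod_unfold prod.collapse
    by (rule subst_sum, rule local_series_regular) (intro closed t q)
  ultimately show "subst ?u (laurent2_at a ?t (q_series z)) = laurent2_at a ?u (q_series z)"
    by (simp add: laurent2_at_def case_prod_unfold)
qed

text \<open>Substituting \<open>q^n\<close> for the variable after \<open>\<sigma>^j\<close> is
  substituting \<open>q^(n + j)\<close>, and substitution is a homomorphism on the local series, so
  it passes through the operator term by term.\<close>

lemma specialize_q_difference_op:
  assumes f: "f m \<in> coeffs_in (local_ring (\<zeta> m))" and z: "\<zeta> m \<noteq> 0"
  shows "q_difference_op \<zeta> d a f m \<in> coeffs_in (local_ring (\<zeta> m))"
    and "specialize \<zeta> n (q_difference_op \<zeta> d a f) m
      = (\<Sum>j\<le>d. laurent_at (laurent2_at_q_power (a j) (int n)) (q_at \<zeta> m) * specialize \<zeta> (n + j) f m)"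
proof -
  let ?u = "q_series (\<zeta> m) ^ n"
  note it = iterate_sigma[where f = f and m = m and \<zeta> = \<zeta>, OF f z]
  have loc: "laurent2_at (a j) (fps_const indet) (q_at \<zeta> m) * (sigma \<zeta> ^^ j) f m \<in> coeffs_in (local_ring (\<zeta> m))" for j
    unfolding q_at_eq
    by (intro is_subring_mult[OF is_subring_local_series] laurent2_at_in_local_series z conjunct1[OF it])
  then show "q_difference_op \<zeta> d a f m \<in> coeffs_in (local_ring (\<zeta> m))"
    unfolding q_difference_op_def by (intro is_subring_sum[OF is_subring_local_series])
  have u: "q_series (\<zeta> m) * inverse (q_series (\<zeta> m)) = 1" using q_series_unit[OF z, of 1] by simp
  have "specialize \<zeta> n (q_difference_op \<zeta> d a f) m
      = (\<Sum>j\<le>d. subst ?u (laurent2_at (a j) (fps_const indet) (q_at \<zeta> m) * (sigma \<zeta> ^^ j) f m))"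
    unfolding specialize_def q_difference_op_def q_at_eq
    by (rule subst_sum, rule local_series_regular) (rule loc[unfolded q_at_eq])
  also have "\<dots> = (\<Sum>j\<le>d. subst ?u (laurent2_at (a j) (fps_const indet) (q_at \<zeta> m)) * subst ?u ((sigma \<zeta> ^^ j) f m))"
    unfolding q_at_eq
    by (intro sum.cong refl subst_mult local_series_regular laurent2_at_in_local_series z conjunct1[OF it])
  also have "\<dots> = (\<Sum>j\<le>d. laurent_at (laurent2_at_q_power (a j) (int n)) (q_at \<zeta> m) * specialize \<zeta> (n + j) f m)"
  proof (rule sum.cong[OF refl])
    fix j
    have "subst ?u ((sigma \<zeta> ^^ j) f m) = specialize \<zeta> (n + j) f m"
      using conjunct2[OF it, THEN spec, of n j] by (simp add: specialize_def q_at_eq)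
    then show "subst ?u (laurent2_at (a j) (fps_const indet) (q_at \<zeta> m)) * subst ?u ((sigma \<zeta> ^^ j) f m)
      = laurent_at (laurent2_at_q_power (a j) (int n)) (q_at \<zeta> m) * specialize \<zeta> (n + j) f m"
      by (simp add: q_at_eq subst_laurent2_at[OF z] laurent2_at_q_power[OF u q_series_unit[OF z]])
  qed
  finally show "specialize \<zeta> n (q_difference_op \<zeta> d a f) m
      = (\<Sum>j\<le>d. laurent_at (laurent2_at_q_power (a j) (int n)) (q_at \<zeta> m) * specialize \<zeta> (n + j) f m)" .
qed

text \<open>Write \<open>q\<^bsup>ml\<^esup> = 1 + (m l / z) h + O(h\<^sup>2)\<close> with \<open>h = q - z\<close>. If the order of \<open>g\<close> at 1 is \<open>r\<close>, then
  \<open>g(q\<^bsup>ml\<^esup>)\<close> has order at least \<open>r\<close> in \<open>h\<close>, and its coefficient at \<open>h\<^sup>r\<close> is a nonzero multiple of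
  \<open>l\<^sup>r\<close>.\<close>

lemma local_ring_leading_term:
  assumes z: "z ^ m = 1" "m \<ge> 1" and g: "g \<in> local_ring z" "g \<noteq> 0"
  shows "\<exists>r h. h \<noteq> 0 \<and> (\<forall>l. \<exists>W. subst_coeff (q_series z ^ (m * l)) g = fps_X ^ r * W \<and>
    fps_nth W 0 = const_fun ((of_nat (m * l) * z ^ (m - 1)) ^ r * h))"
proof -
  obtain a b where ab: "g = to_fract a / to_fract b" and b: "\<And>i. poly b (z ^ i) \<noteq> 0"
    using g(1) unfolding local_ring_def by blast
  have a0: "a \<noteq> 0" using ab g(2) by auto
  define r where "r = order 1 a"
  obtain a' where a': "a = [:- 1, 1:] ^ r * a'" "\<not> [:- 1, 1:] dvd a'"
    using order_decomp[OF a0, of 1] by (auto simp: r_def)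
  have a1: "poly a' 1 \<noteq> 0" using a'(2) by (simp add: poly_eq_0_iff_dvd)
  have b1: "poly b 1 \<noteq> 0" using b[of 0] by simp
  show ?thesis
  proof (rule exI[of _ r], rule exI[of _ "poly a' 1 / poly b 1"], intro conjI allI)
    show "poly a' 1 / poly b 1 \<noteq> 0" using a1 b1 by simp
    fix l
    let ?u = "q_series z ^ (m * l)"
    have zml: "z ^ (m * l) = 1" by (simp add: power_mult z(1))
    then have u0: "fps_nth ?u 0 = const_fun 1" by (simp only: q_series_power_nth_0)
    \<comment> \<open>The derivative of \<open>q^(m l)\<close> at \<open>z\<close> is
      \<open>m l z^(m l - 1)\<close>; by \<open>z^m = 1\<close> the power of \<open>z\<close> can be
      made independent of \<open>l\<close>, so the value is linear in \<open>l\<close>.\<close>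
    have u1: "fps_nth ?u 1 = const_fun (of_nat (m * l) * z ^ (m - 1))"
    proof -
      have 1: "fps_nth (q_series z ^ Suc k) 1 = const_fun (of_nat (Suc k) * z ^ k)" for k
      proof (induction k)
        case (Suc k)
        have "fps_nth (q_series z ^ Suc (Suc k)) 1
          = const_fun z * fps_nth (q_series z ^ Suc k) 1 + fps_nth (q_series z ^ Suc k) 0"
          by (subst power_Suc) (simp add: fps_mult_nth q_series_def del: power_Suc)
        then show ?case
          unfolding Suc.IH q_series_power_nth_0 const_fun_simps(3,4)[symmetric]
          by (simp add: algebra_simps del: const_fun_simps)
      qed (simp add: q_series_def)
      show ?thesis
      proof (cases l)
        case (Suc l')
        then obtain k where k: "m * l = Suc k" using z(2) by (cases "m * l") auto
        have "z ^ k * z ^ 1 = z ^ (m - 1) * z ^ 1"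
          using zml z unfolding power_add[symmetric] k by simp
        moreover have "z \<noteq> 0" using z by (auto simp: power_0_left)
        ultimately have "z ^ k = z ^ (m - 1)" by simp
        then show ?thesis using 1[of k] by (simp only: k)
      qed simp
    qed
    define y where "y = fps_shift 1 (?u - 1)"
    have y: "?u - 1 = fps_X * y"
      by (rule fps_ext) (use u0 in \<open>simp add: y_def fps_X_mult_nth\<close>)
    have y0: "fps_nth y 0 = const_fun (of_nat (m * l) * z ^ (m - 1))"
      using u1 by (simp add: y_def)
    have pb: "fps_nth (poly_at ?u b) 0 = const_fun (poly b 1)"
      by (rule poly_at_nth_0_const[OF u0])
    have "poly_at ?u [:- 1, 1:] = ?u - 1"
    proof -
      have "const_fun (- 1) + 1 = 0" unfolding const_fun_simps(2)[symmetric] const_fun_simps(3)[symmetric] by simp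
      then have "const_fun (- 1) = - 1" by (simp add: eq_neg_iff_add_eq_0)
      then show ?thesis by (simp add: poly_at_pCons fps_const_neg[symmetric] del: fps_const_neg)
    qed
    then have "subst_coeff ?u g = (?u - 1) ^ r * poly_at ?u a' * inverse (poly_at ?u b)"
      using subst_coeff_eq[OF ab, of ?u] pb b1 by (simp add: a'(1) poly_at_mult poly_at_power)
    then have "subst_coeff ?u g = fps_X ^ r * (y ^ r * poly_at ?u a' * inverse (poly_at ?u b))"
      unfolding y by (simp add: power_mult_distrib mult_ac)
    moreover have "fps_nth (y ^ r * poly_at ?u a' * inverse (poly_at ?u b)) 0
      = const_fun ((of_nat (m * l) * z ^ (m - 1)) ^ r * (poly a' 1 / poly b 1))"
    proof -
      have yr: "fps_nth (y ^ r) 0 = fps_nth y 0 ^ r" by (induction r) simp_all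
      show ?thesis
        unfolding fps_mult_nth_0 fps_inverse_nth_0 yr y0 pb poly_at_nth_0_const[OF u0]
          const_fun_power[symmetric] const_fun_inverse[symmetric] const_fun_simps(4)[symmetric]
        by (simp only: divide_inverse mult.assoc)
    qed
    ultimately show "\<exists>W. subst_coeff ?u g = fps_X ^ r * W \<and>
      fps_nth W 0 = const_fun ((of_nat (m * l) * z ^ (m - 1)) ^ r * (poly a' 1 / poly b 1))" by blast
  qed
qed

text \<open>If \<open>r k\<close> is the vanishing order at 1 of the \<open>k\<close>-th
  coefficient, this coefficient contributes from order \<open>k + r k\<close> on. In the minimal
  order \<open>M\<close> only the indices with \<open>k + r k = M\<close> are seen, each through a
  nonzero multiple of \<open>y l ^ (M - k)\<close>. Different \<open>k\<close> give different
  powers, so nothing cancels, yet the resulting polynomial has all the infinitely many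
  \<open>y l\<close> as roots.\<close>

lemma series_eq_0_if_specializations_eq_0:
  assumes z: "z ^ m = 1" "m \<ge> 1" and f: "f \<in> coeffs_in (local_ring z)"
    and 0: "\<And>l. subst (q_series z ^ (m * l)) f = 0"
  shows "f = 0"
proof (rule ccontr)
  assume "f \<noteq> 0"
  have z0: "z \<noteq> 0" using z by (auto simp: power_0_left)
  define y where "y = (\<lambda>l. of_nat (m * l) * z ^ (m - 1))"
  have "\<forall>k. \<exists>r h. fps_nth f k \<noteq> 0 \<longrightarrow> h \<noteq> 0 \<and> (\<forall>l. \<exists>W. subst_coeff (q_series z ^ (m * l)) (fps_nth f k) = fps_X ^ r * W \<and>
    fps_nth W 0 = const_fun (y l ^ r * h))"
    using local_ring_leading_term[OF z coeffs_inD[OF f]] unfolding y_def by blast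
  then obtain r h where rh: "\<And>k. fps_nth f k \<noteq> 0 \<Longrightarrow> h k \<noteq> 0"
    "\<And>k l. fps_nth f k \<noteq> 0 \<Longrightarrow> \<exists>W. subst_coeff (q_series z ^ (m * l)) (fps_nth f k) = fps_X ^ (r k) * W \<and>
    fps_nth W 0 = const_fun (y l ^ (r k) * h k)" by metis
  obtain k1 where k1: "fps_nth f k1 \<noteq> 0" using \<open>f \<noteq> 0\<close> fps_nonzero_nth by blast
  define M where "M = (LEAST s. \<exists>k. fps_nth f k \<noteq> 0 \<and> s = k + r k)"
  have "\<exists>k. fps_nth f k \<noteq> 0 \<and> M = k + r k"
    unfolding M_def by (rule LeastI[of _ "k1 + r k1"]) (use k1 in blast)
  then obtain k0 where k0: "fps_nth f k0 \<noteq> 0" "M = k0 + r k0" by blast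
  have le: "M \<le> k + r k" if "fps_nth f k \<noteq> 0" for k
    unfolding M_def by (rule Least_le) (use that in blast)
  define c where "c = (\<lambda>k. if fps_nth f k \<noteq> 0 \<and> M = k + r k then h k else 0)"
  have "(\<Sum>k\<le>M. c k * y l ^ (M - k)) = 0" for l
  proof -
    have "fps_nth (subst_coeff (q_series z ^ (m * l)) (fps_nth f k)) (M - k) = const_fun (c k * y l ^ (M - k))"
      if "k \<le> M" for k
    proof (cases "fps_nth f k = 0")
      case True
      then show ?thesis by (simp add: c_def)
    next
      case False
      obtain W where W: "subst_coeff (q_series z ^ (m * l)) (fps_nth f k) = fps_X ^ (r k) * W"
        "fps_nth W 0 = const_fun (y l ^ (r k) * h k)" using rh(2)[OF False] by blast
      show ?thesis
      proof (cases "M = k + r k")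
        case True
        then have "fps_nth (fps_X ^ r k * W) (M - k) = fps_nth W 0" by (simp add: fps_X_power_mult_nth)
        then show ?thesis unfolding W(1) using False True by (simp add: W(2) c_def mult.commute)
      next
        \<comment> \<open>Minimality of \<open>M\<close> forces \<open>M - k < r k\<close>, so the
          coefficient lies below the order of the series.\<close>
        case neq: False
        then have "M - k < r k" using le[OF False] that by linarith
        then show ?thesis using neq W by (simp add: c_def fps_X_power_mult_nth)
      qed
    qed
    then have "const_fun (c k * y l ^ (M - k)) = fps_nth (subst_coeff (q_series z ^ (m * l)) (fps_nth f k)) (M - k)"
      if "k \<le> M" for k using that by simp
    then have "(\<Sum>k\<le>M. const_fun (c k * y l ^ (M - k))) = fps_nth (subst (q_series z ^ (m * l)) f) M"
      unfolding subst_def fps_nth_Abs_fps by (intro sum.cong) auto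
    also have "\<dots> = const_fun 0" unfolding 0 by simp
    also have "(\<Sum>k\<le>M. const_fun (c k * y l ^ (M - k))) = const_fun (\<Sum>k\<le>M. c k * y l ^ (M - k))"
      by (rule const_fun_sum[symmetric])
    finally show ?thesis by (simp only: const_fun_eq_iff)
  qed
  then have "range y \<subseteq> {x. poly (\<Sum>k\<le>M. monom (c k) (M - k)) x = 0}"
    by (auto simp: poly_sum poly_monom)
  moreover have "infinite (range y)"
  proof (rule range_inj_infinite)
    show "inj y" using z z0 by (auto simp: inj_def y_def)
  qed
  ultimately have "(\<Sum>k\<le>M. monom (c k) (M - k)) = 0"
    by (metis finite_subset poly_roots_finite)
  then have "0 = coeff (\<Sum>k\<le>M. monom (c k) (M - k)) (M - k0)" by simp
  also have "\<dots> = (\<Sum>k\<le>M. if k = k0 then c k else 0)"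
    unfolding coeff_sum by (rule sum.cong) (use k0(2) in auto)
  also have "\<dots> = h k0" using k0 by (simp add: c_def)
  finally show False using rh(1)[OF k0(1)] by simp
qed

section \<open>Recurrences and operators\<close>

text \<open>Clearing negative exponents gives the polynomial
  \<open>P(x) = x^(m N) \<Delta>(x^m)\<close>. At every power \<open>x\<close> of \<open>z\<close>
  one has \<open>x^m = 1\<close>, hence \<open>P(x) = \<Delta>(1) = 1\<close>.\<close>

lemma inverse_laurent_in_local_ring:
  assumes z: "z ^ m = 1" "m \<ge> 1" and \<Delta>: "(\<Sum>i\<in>Poly_Mapping.keys \<Delta>. Poly_Mapping.lookup \<Delta> i) = 1"
  shows "inverse (laurent_at \<Delta> (indet ^ m)) \<in> local_ring z"
proof -
  have z0: "z \<noteq> 0" using z by (auto simp: power_0_left)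
  define N where "N = (\<Sum>i\<in>Poly_Mapping.keys \<Delta>. nat \<bar>i\<bar>)"
  have N: "\<bar>i\<bar> \<le> int N" if "i \<in> Poly_Mapping.keys \<Delta>" for i
  proof -
    have "nat \<bar>i\<bar> \<le> N" unfolding N_def by (rule member_le_sum) (use that in auto)
    then show ?thesis by linarith
  qed
  let ?c = "Poly_Mapping.lookup \<Delta>" and ?x = "[:0, 1 :: complex:]"
  define P where "P = (\<Sum>i\<in>Poly_Mapping.keys \<Delta>. Polynomial.smult (of_int (?c i)) (?x ^ (m * nat (i + int N))))"
  have "to_fract P = (\<Sum>i\<in>Poly_Mapping.keys \<Delta>. of_int (?c i) * indet ^ (m * nat (i + int N)))"
    unfolding P_def poly_to_fract_sum
  proof (rule sum.cong[OF refl])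
    fix i
    have "Polynomial.smult (of_int (?c i)) (?x ^ k) = [:of_int (?c i):] * ?x ^ k" for k by simp
    then show "to_fract (Polynomial.smult (of_int (?c i)) (?x ^ (m * nat (i + int N))))
      = of_int (?c i) * indet ^ (m * nat (i + int N))"
      by (simp only: to_fract_mult to_fract_var_power const_fun_def[symmetric] const_fun_of_int)
  qed
  also have "\<dots> = (\<Sum>i\<in>Poly_Mapping.keys \<Delta>. indet ^ (m * N) * (of_int (?c i) * (indet ^ m) powi i))"
  proof (rule sum.cong[OF refl])
    fix i assume "i \<in> Poly_Mapping.keys \<Delta>"
    then have "int (nat (i + int N)) = i + int N" using N[of i] by simp
    then have "indet ^ (m * nat (i + int N)) = (indet ^ m) powi (i + int N)"
      by (metis power_int_of_nat power_mult)
    also have "\<dots> = (indet ^ m) powi i * indet ^ (m * N)"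
      by (simp add: power_int_add power_mult)
    finally show "of_int (?c i) * indet ^ (m * nat (i + int N)) = indet ^ (m * N) * (of_int (?c i) * (indet ^ m) powi i)"
      by (simp add: mult_ac)
  qed
  also have "\<dots> = indet ^ (m * N) * laurent_at \<Delta> (indet ^ m)"
    by (simp add: laurent_at_def sum_distrib_left)
  finally have "laurent_at \<Delta> (indet ^ m) = inverse (indet ^ (m * N)) * to_fract P" by simp
  then have "inverse (laurent_at \<Delta> (indet ^ m)) = indet ^ (m * N) * inverse (to_fract P)" by simp
  moreover have "poly P (z ^ k) \<noteq> 0" for k
  proof -
    have "(z ^ k) ^ (m * j) = 1" for j
      by (metis z(1) mult.commute power_mult power_one)
    then have "poly P (z ^ k) = of_int (\<Sum>i\<in>Poly_Mapping.keys \<Delta>. ?c i)"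
      by (simp add: P_def poly_sum)
    then show ?thesis unfolding \<Delta> by simp
  qed
  ultimately show ?thesis
    by (simp add: is_subring_mult[OF is_subring_local_ring] is_subring_power[OF is_subring_local_ring]
        indet_in_local_ring inverse_to_fract_in_local_ring)
qed

lemma habiro_ring_in_local_series:
  assumes f: "f \<in> habiro_ring \<zeta> \<Delta>" and m: "m \<ge> 1" and z: "\<zeta> m ^ m = 1"
    and \<Delta>: "(\<Sum>i\<in>Poly_Mapping.keys \<Delta>. Poly_Mapping.lookup \<Delta> i) = 1"
  shows "f m \<in> coeffs_in (local_ring (\<zeta> m))"
proof -
  have "\<zeta> m \<noteq> 0" using z m by (auto simp: power_0_left)
  then have "coeff_ring \<zeta> \<Delta> m m \<subseteq> local_ring (\<zeta> m)"
    unfolding coeff_ring_def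
    by (intro subring_generated_subset is_subring_local_ring)
      (use const_fun_in_local_ring indet_in_local_ring inverse_indet_in_local_ring
        inverse_laurent_in_local_ring[OF z m \<Delta>] in auto)
  then show ?thesis using f m by (auto simp: habiro_ring_def coeffs_in_def)
qed

lemma laurent2_at_q_power_eq_pm_eval:
  "laurent2_at_q_power a s = pm_eval (\<lambda>(i, l). Poly_Mapping.single (s * i + l) 1) a"
proof -
  have "of_int c * Poly_Mapping.single k 1 = (Poly_Mapping.single k c :: laurent)" for c k :: int
    by (simp add: mult_single flip: single_of_int)
  then show ?thesis by (simp add: laurent2_at_q_power_def pm_eval_def case_prod_unfold)
qed

text \<open>In terms of \<open>t = q\<^bsup>n - 1\<^esup>\<close> the factor \<open>q\<^bsup>in\<^esup>\<close> of a recurrence is \<open>t\<^sup>i q\<^sup>i\<close>.\<close>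

lemma operator_of_recurrence:
  fixes c :: "nat \<Rightarrow> nat \<Rightarrow> laurent"
  assumes "\<exists>i\<le>L. \<exists>j\<le>L. c i j \<noteq> 0"
  shows "\<exists>d a. (\<exists>j\<le>d. a j \<noteq> 0) \<and>
    (\<forall>n J. (\<Sum>j\<le>d. laurent2_at_q_power (a j) (int n - 1) * J (n + j))
      = (\<Sum>(i, j)\<in>{..L} \<times> {..L}. c i j * Poly_Mapping.single (int i * int n) 1 * J (n + 4 * j)))"
proof -
  define A where "A = (\<lambda>j. \<Sum>i\<le>L. \<Sum>l\<in>Poly_Mapping.keys (c i j).
    Poly_Mapping.single (int i, int i + l) (Poly_Mapping.lookup (c i j) l))"
  \<comment> \<open>The recurrence moves the color in steps of 4, so only powers of
    \<open>\<sigma>\<close> divisible by 4 receive a coefficient.\<close>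
  define a where "a = (\<lambda>j. if 4 dvd j then A (j div 4) else 0)"
  obtain i0 j0 where ij: "i0 \<le> L" "j0 \<le> L" "c i0 j0 \<noteq> 0" using assms by blast
  obtain l0 where l0: "Poly_Mapping.lookup (c i0 j0) l0 \<noteq> 0"
    using ij(3) by (metis poly_mapping_eqI lookup_zero)
  \<comment> \<open>Different \<open>i\<close> give different powers of \<open>t\<close>, so a
    nonzero coefficient of \<open>c i0 j0\<close> survives in \<open>A j0\<close>.\<close>
  have "Poly_Mapping.lookup (A j0) (int i0, int i0 + l0)
    = (\<Sum>i\<le>L. if i = i0 then \<Sum>l\<in>Poly_Mapping.keys (c i0 j0). if l = l0 then Poly_Mapping.lookup (c i0 j0) l else 0 else 0)"
    unfolding A_def lookup_sum
    by (rule sum.cong) (auto simp: lookup_single when_def intro!: sum.cong sum.neutral)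
  also have "\<dots> = Poly_Mapping.lookup (c i0 j0) l0"
    using ij l0 by (simp add: in_keys_iff)
  finally have A_nz: "A j0 \<noteq> 0" using l0 by auto
  have A: "laurent2_at_q_power (A j) (int n - 1) = (\<Sum>i\<le>L. c i j * Poly_Mapping.single (int i * int n) 1)" for j n
  proof -
    have 1: "of_int b * Poly_Mapping.single k 1 = (Poly_Mapping.single k b :: laurent)" for b k :: int
      by (simp add: mult_single flip: single_of_int)
    have "c i j * Poly_Mapping.single (int i * int n) 1 = (\<Sum>l\<in>Poly_Mapping.keys (c i j).
        Poly_Mapping.single ((int n - 1) * int i + (int i + l)) (Poly_Mapping.lookup (c i j) l))" for i
    proof -
      have "c i j * Poly_Mapping.single (int i * int n) 1 = (\<Sum>l\<in>Poly_Mapping.keys (c i j).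
          Poly_Mapping.single l (Poly_Mapping.lookup (c i j) l)) * Poly_Mapping.single (int i * int n) 1"
        by (simp only: pm_expansion)
      then show ?thesis
        unfolding sum_distrib_right by (simp add: mult_single algebra_simps)
    qed
    then show ?thesis
      by (simp add: A_def laurent2_at_q_power_eq_pm_eval pm_eval_sum 1)
  qed
  show ?thesis
  proof (rule exI[of _ "4 * L"], rule exI[of _ a], intro conjI allI)
    show "\<exists>j\<le>4 * L. a j \<noteq> 0"
      by (rule exI[of _ "4 * j0"]) (use ij A_nz in \<open>simp add: a_def\<close>)
    fix n :: nat and J :: "nat \<Rightarrow> laurent"
    have "(\<Sum>j\<le>4 * L. laurent2_at_q_power (a j) (int n - 1) * J (n + j))
      = (\<Sum>j\<in>(\<lambda>j. 4 * j) ` {..L}. laurent2_at_q_power (a j) (int n - 1) * J (n + j))"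
    proof (rule sum.mono_neutral_right)
      show "\<forall>j\<in>{..4 * L} - (\<lambda>j. 4 * j) ` {..L}. laurent2_at_q_power (a j) (int n - 1) * J (n + j) = 0"
      proof
        fix j assume "j \<in> {..4 * L} - (\<lambda>j. 4 * j) ` {..L}"
        then have "\<not> 4 dvd j" by auto
        then show "laurent2_at_q_power (a j) (int n - 1) * J (n + j) = 0"
          by (simp add: a_def laurent2_at_q_power_eq_pm_eval)
      qed
    qed auto
    also have "\<dots> = (\<Sum>j\<le>L. laurent2_at_q_power (A j) (int n - 1) * J (n + 4 * j))"
      by (subst sum.reindex) (auto simp: inj_on_def a_def)
    also have "\<dots> = (\<Sum>j\<le>L. \<Sum>i\<le>L. c i j * Poly_Mapping.single (int i * int n) 1 * J (n + 4 * j))"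
      by (simp only: A sum_distrib_right)
    also have "\<dots> = (\<Sum>(i, j)\<in>{..L} \<times> {..L}. c i j * Poly_Mapping.single (int i * int n) 1 * J (n + 4 * j))"
      by (subst sum.swap) (simp add: sum.cartesian_product)
    finally show "(\<Sum>j\<le>4 * L. laurent2_at_q_power (a j) (int n - 1) * J (n + j))
      = (\<Sum>(i, j)\<in>{..L} \<times> {..L}. c i j * Poly_Mapping.single (int i * int n) 1 * J (n + 4 * j))" .
  qed
qed

theorem corollary1p9:
  fixes K :: "(R3 \<times> real) set"
    and \<Delta> :: laurent
    and J :: "nat \<Rightarrow> laurent"
    and \<zeta> :: "nat \<Rightarrow> complex"
    and JK :: "nat \<Rightarrow> ratfun fps"
  assumes "knot K"
    and "alexander_polynomial K \<Delta>"
    and "colored_jones K J"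
    and "compatible_roots_of_unity \<zeta>"
    and "jones_lift \<zeta> \<Delta> J JK"
  shows "(\<exists>d a. (\<exists>j\<le>d. a j \<noteq> 0) \<and> (\<forall>m\<ge>1. q_difference_op \<zeta> d a JK m = 0)) \<and>
         (\<forall>d a. (\<forall>m\<ge>1. q_difference_op \<zeta> d a JK m = 0) \<longleftrightarrow>
            (\<forall>n\<ge>1. (\<Sum>j\<le>d. laurent2_at_q_power (a j) (int n - 1) * J (n + j)) = 0))"
proof -
  have \<Delta>: "(\<Sum>i\<in>Poly_Mapping.keys \<Delta>. Poly_Mapping.lookup \<Delta> i) = 1"
    using assms(2) by (simp add: alexander_polynomial_def)
  have \<zeta>: "\<zeta> m ^ m = 1" if "m \<ge> 1" for m
    using assms(4) that by (simp add: compatible_roots_of_unity_def)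
  have \<zeta>0: "\<zeta> m \<noteq> 0" if "m \<ge> 1" for m
    using \<zeta>[OF that] that by (auto simp: power_0_left)
  have JK: "JK \<in> habiro_ring \<zeta> \<Delta>"
    "\<And>n m. n \<ge> 1 \<Longrightarrow> m \<ge> 1 \<Longrightarrow> specialize \<zeta> (n - 1) JK m = laurent_at (J n) (q_at \<zeta> m)"
    using assms(5) by (auto simp: jones_lift_def)
  have loc: "JK m \<in> coeffs_in (local_ring (\<zeta> m))" if "m \<ge> 1" for m
    by (rule habiro_ring_in_local_series[OF JK(1) that \<zeta>[OF that] \<Delta>])
  \<comment> \<open>The exponent \<open>n\<close> of the substituted power of \<open>q\<close>
    belongs to the color \<open>Suc n\<close>.\<close>
  have key: "specialize \<zeta> n (q_difference_op \<zeta> d a JK) m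
      = laurent_at (\<Sum>j\<le>d. laurent2_at_q_power (a j) (int (Suc n) - 1) * J (Suc n + j)) (q_at \<zeta> m)"
    if m: "m \<ge> 1" for d a n m
  proof -
    have u: "q_at \<zeta> m * inverse (q_at \<zeta> m) = 1"
      unfolding q_at_eq using q_series_unit[OF \<zeta>0[OF m], of 1] by simp
    have "specialize \<zeta> (n + j) JK m = laurent_at (J (Suc n + j)) (q_at \<zeta> m)" for j
      using JK(2)[of "Suc n + j" m] m by simp
    then show ?thesis
      unfolding specialize_q_difference_op(2)[where f = JK and m = m and \<zeta> = \<zeta>, OF loc[OF m] \<zeta>0[OF m]]
      by (simp add: laurent_at_sum laurent_at_mult[OF u])
  qed
  have iff: "(\<forall>m\<ge>1. q_difference_op \<zeta> d a JK m = 0) \<longleftrightarrow>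
    (\<forall>n\<ge>1. (\<Sum>j\<le>d. laurent2_at_q_power (a j) (int n - 1) * J (n + j)) = 0)" for d a
  proof
    assume *: "\<forall>m\<ge>1. q_difference_op \<zeta> d a JK m = 0"
    show "\<forall>n\<ge>1. (\<Sum>j\<le>d. laurent2_at_q_power (a j) (int n - 1) * J (n + j)) = 0"
    proof (intro allI impI)
      fix n :: nat assume "n \<ge> 1"
      then obtain n' where n: "n = Suc n'" by (cases n) auto
      \<comment> \<open>The component at \<open>m = 1\<close> suffices, because the specialization
        is the expansion of a Laurent polynomial.\<close>
      have "specialize \<zeta> n' (q_difference_op \<zeta> d a JK) 1 = 0"
        using * by (simp add: specialize_def)
      then have "laurent_at (\<Sum>j\<le>d. laurent2_at_q_power (a j) (int n - 1) * J (n + j)) (q_series (\<zeta> 1)) = 0"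
        unfolding key[OF le_refl] q_at_eq n .
      then show "(\<Sum>j\<le>d. laurent2_at_q_power (a j) (int n - 1) * J (n + j)) = 0"
        by (rule laurent_eq_0_if_at_q_series[OF \<zeta>0[OF le_refl]])
    qed
  next
    assume *: "\<forall>n\<ge>1. (\<Sum>j\<le>d. laurent2_at_q_power (a j) (int n - 1) * J (n + j)) = 0"
    show "\<forall>m\<ge>1. q_difference_op \<zeta> d a JK m = 0"
    proof (intro allI impI)
      fix m :: nat assume m: "m \<ge> 1"
      show "q_difference_op \<zeta> d a JK m = 0"
      proof (rule series_eq_0_if_specializations_eq_0[OF \<zeta>[OF m] m])
        show "q_difference_op \<zeta> d a JK m \<in> coeffs_in (local_ring (\<zeta> m))"
          by (rule specialize_q_difference_op(1)[where f = JK and m = m and \<zeta> = \<zeta>, OF loc[OF m] \<zeta>0[OF m]])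
        fix l
        \<comment> \<open>Substituting \<open>q^(m l)\<close> corresponds to the recurrence at
          \<open>n = m l + 1\<close>.\<close>
        have "specialize \<zeta> (m * l) (q_difference_op \<zeta> d a JK) m = 0"
          unfolding key[OF m] using *[rule_format, of "Suc (m * l)"] by simp
        then show "subst (q_series (\<zeta> m) ^ (m * l)) (q_difference_op \<zeta> d a JK m) = 0"
          by (simp add: specialize_def q_at_eq)
      qed
    qed
  qed
  obtain L c where c: "\<exists>i\<le>L. \<exists>j\<le>L. c i j \<noteq> 0"
    and rec: "\<And>n. n \<ge> 1 \<Longrightarrow>
      (\<Sum>(i, j)\<in>{..L} \<times> {..L}. c i j * Poly_Mapping.single (int i * int n) 1 * J (n + 4 * j)) = (0::laurent)"
    using colored_jones_recurrence[OF assms(3)] by blast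
  from operator_of_recurrence[OF c] obtain d a where a: "\<exists>j\<le>d. a j \<noteq> 0"
    "\<And>n. (\<Sum>j\<le>d. laurent2_at_q_power (a j) (int n - 1) * J (n + j))
      = (\<Sum>(i, j)\<in>{..L} \<times> {..L}. c i j * Poly_Mapping.single (int i * int n) 1 * J (n + 4 * j))"
    by blast
  have "\<forall>m\<ge>1. q_difference_op \<zeta> d a JK m = 0"
    unfolding iff a(2) using rec by blast
  then have "\<exists>d a. (\<exists>j\<le>d. a j \<noteq> 0) \<and> (\<forall>m\<ge>1. q_difference_op \<zeta> d a JK m = 0)"
    using a(1) by blast
  then show ?thesis using iff by blast
qed

end
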